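(* Let $T>0$ and let $U\in C^{\alpha}_{0,T}\cap\mathcal{Q}_T^{\pi,\kappa}$ for some $1/3<\alpha<1/2$ and $\kappa<2$. There are constants $b>2$, $p>1$ and $\epsilon>0$, depending only on $\kappa$, such that the following holds. For fixed $t\in[0,T]$ set $\beta_s:=U_t-U_{t-s}$, $0\le s\le t$, and for arbitrarily chosen $A\in\mathcal{H}_t$ consider the decomposition $\beta=N+A$ (i.e. $N:=\beta-A$). Then for every $y>0$ there exists a continuous function $\dot G$ on $[0,t]$, F\"ollmer integrable against $N$, such that $$|f_t'(iy+U_t)|^b\le \exp\Bigl(b\int_0^t\dot G_r\,d^\pi N_r-\frac{pb^2}{2}\int_0^t\dot G_r^2\,d[N]^\pi_r\Bigr)\exp\Bigl(\frac{b}{4\epsilon}\|A\|_t^2\Bigr).$$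
   Context: $\mathbb{H}$ is the open complex upper half-plane. For a continuous driver $U:[0,T]\to\mathbb{R}$ with $U_0=0$ and $z\in\overline{\mathbb{H}}\setminus\{0\}$, $g_t(z)$ denotes the solution of Loewner's differential equation $\dot g_t(z)=\frac{2}{g_t(z)-U_t}$, $g_0(z)=z$ (up to its lifetime), and $f_t=g_t^{-1}$, a conformal map defined on $\mathbb{H}$. $\mathcal{H}_t$ is the space of absolutely continuous $h:[0,t]\to\mathbb{R}$ with square-integrable derivative, $\|h\|_t^2:=\int_0^t|\dot h_s|^2ds$. $C^\alpha_{0,T}$ is the space of $\alpha$-H\"older paths $[0,T]\to\mathbb{R}$ started at $0$. Fix a sequence $\pi=(\pi_n)$ of partitions of $[0,T]$ with mesh going to zero. A path $U:[0,T]\to\mathbb{R}$ has finite quadratic variation in the sense of F\"ollmer along $\pi$ if for every $t\in[0,T]$ the limit $$[U]_t^\pi:=\lim_{n\to\infty}\sum_{[r,s]\in\pi_n}(U_{s\wedge t}-U_{r\wedge t})^2$$ exists and $t\mapsto[U]^\pi_t\equiv[U]_t$ is continuous. A function $V$ is F\"ollmer integrable (against $U$, along $\pi$) if $\int_0^tV\,d^\pi U:=\lim_{n\to\infty}\sum_{[r,s]\in\pi_n}V_r(U_{s\wedge t}-U_{r\wedge t})$ exists. One writes $U\in\mathcal{Q}_T^{\pi,\kappa}$ if $U$ has finite quadratic variation in the sense of F\"ollmer along $\pi$ and moreover $\sup_{0\le s<t\le T}\frac{[U]_t-[U]_s}{t-s}\le\kappa<\infty$. For the time-reversed path $\beta$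 on $[0,t]$ and for $N=\beta-A$, the bracket and the integral are taken on $[0,t]$ along the time-reversed partitions, with intervals $[t-(u\wedge t),\,t-r]$ for $[r,u]\in\pi_n$ with $r<t$ (integrand at the left endpoint). That is, for $0\le s\le t$, $$[N]^\pi_s:=\lim_{n\to\infty}\sum_{[r,u]\in\pi_n,\ r<t}\bigl(N_{(t-r)\wedge s}-N_{(t-(u\wedge t))\wedge s}\bigr)^2,$$ and likewise for $[\beta]^\pi_s$ with $\beta$ in place of $N$, while $$\int_0^sV\,d^\pi N:=\lim_{n\to\infty}\sum_{[r,u]\in\pi_n,\ r<t}V_{t-(u\wedge t)}\bigl(N_{(t-r)\wedge s}-N_{(t-(u\wedge t))\wedge s}\bigr),$$ and a function $V$ on $[0,t]$ is F\"ollmer integrable against $N$ if this last limit exists; thus $[N]^\pi_s=[\beta]^\pi_s=[U]^\pi_t-[U]^\pi_{t-s}$ for $0\le s\le t$. *)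

theory Defs
  imports "HOL-Analysis.Analysis"
begin

definition loewner_solution :: "(real \<Rightarrow> real) \<Rightarrow> real \<Rightarrow> complex \<Rightarrow> (real \<Rightarrow> complex) \<Rightarrow> bool" where
  "loewner_solution U t z g \<longleftrightarrow>
     g 0 = z \<and>
     (\<forall>s\<in>{0..t}. g s \<noteq> of_real (U s) \<and>
        (g has_vector_derivative 2 / (g s - of_real (U s))) (at s within {0..t}))"

definition loewner_domain :: "(real \<Rightarrow> real) \<Rightarrow> real \<Rightarrow> complex set" where
  "loewner_domain U t = {z. 0 < Im z \<and> (\<exists>g. loewner_solution U t z g)}"

definition loewner_g :: "(real \<Rightarrow> real) \<Rightarrow> real \<Rightarrow> complex \<Rightarrow> complex" where
  "loewner_g U t z = (THE w. \<exists>g. loewner_solution U t z g \<and> w = g t)"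

definition loewner_f :: "(real \<Rightarrow> real) \<Rightarrow> real \<Rightarrow> complex \<Rightarrow> complex" where
  "loewner_f U t = inv_into (loewner_domain U t) (loewner_g U t)"

definition holder_paths :: "real \<Rightarrow> real \<Rightarrow> (real \<Rightarrow> real) set" where
  "holder_paths \<alpha> T =
     {U. U 0 = 0 \<and> (\<exists>C. \<forall>s\<in>{0..T}. \<forall>t\<in>{0..T}. \<bar>U t - U s\<bar> \<le> C * \<bar>t - s\<bar> powr \<alpha>)}"

text \<open>
  Absolute continuity in the \<open>\<epsilon>\<close>-\<open>\<delta>\<close> sense. A finite family of non-overlapping closed intervals
  is a division of its own union.
\<close>

definition absolutely_continuous_path_on :: "real set \<Rightarrow> (real \<Rightarrow> real) \<Rightarrow> bool" where
  "absolutely_continuous_path_on S h \<longleftrightarrow>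
     (\<forall>\<epsilon>>0. \<exists>\<delta>>0. \<forall>D. D division_of \<Union>D \<and> \<Union>D \<subseteq> S \<and> (\<Sum>K\<in>D. Sup K - Inf K) < \<delta> \<longrightarrow>
        (\<Sum>K\<in>D. \<bar>h (Sup K) - h (Inf K)\<bar>) < \<epsilon>)"

text \<open>
  An absolutely continuous function is differentiable almost everywhere, so the unspecified
  value of \<^const>\<open>deriv\<close> at the remaining points is irrelevant below.
\<close>

definition cameron_martin :: "real \<Rightarrow> (real \<Rightarrow> real) set" where
  "cameron_martin t =
     {h. absolutely_continuous_path_on {0..t} h \<and>
         set_integrable lebesgue {0..t} (\<lambda>s. (deriv h s)\<^sup>2)}"

definition cameron_martin_norm :: "real \<Rightarrow> (real \<Rightarrow> real) \<Rightarrow> real" where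
  "cameron_martin_norm t h = sqrt (LINT s:{0..t}|lebesgue. (deriv h s)\<^sup>2)"

text \<open>
  A partition is the finite set of its closed intervals; the interval \<open>[r, s]\<close> is the set \<open>K\<close>
  with \<open>r = Inf K\<close> and \<open>s = Sup K\<close>. Degenerate intervals \<open>[r, r]\<close> are permitted by
  \<open>division_of\<close>, but contribute zero to each of the sums below.
\<close>

definition partition_sequence :: "real \<Rightarrow> (nat \<Rightarrow> real set set) \<Rightarrow> bool" where
  "partition_sequence T \<pi> \<longleftrightarrow>
     (\<forall>n. \<pi> n division_of {0..T}) \<and>
     (\<lambda>n. Max ((\<lambda>K. Sup K - Inf K) ` \<pi> n)) \<longlonglongrightarrow> 0"

definition follmer_qsum :: "real set set \<Rightarrow> (real \<Rightarrow> real) \<Rightarrow> real \<Rightarrow> real" where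
  "follmer_qsum D X t = (\<Sum>K\<in>D. (X (min (Sup K) t) - X (min (Inf K) t))\<^sup>2)"

definition follmer_bracket :: "(nat \<Rightarrow> real set set) \<Rightarrow> (real \<Rightarrow> real) \<Rightarrow> real \<Rightarrow> real" where
  "follmer_bracket \<pi> X t = lim (\<lambda>n. follmer_qsum (\<pi> n) X t)"

definition finite_follmer_qv :: "real \<Rightarrow> (nat \<Rightarrow> real set set) \<Rightarrow> (real \<Rightarrow> real) \<Rightarrow> bool" where
  "finite_follmer_qv T \<pi> X \<longleftrightarrow>
     (\<forall>t\<in>{0..T}. convergent (\<lambda>n. follmer_qsum (\<pi> n) X t)) \<and>
     continuous_on {0..T} (follmer_bracket \<pi> X)"

definition follmer_paths :: "real \<Rightarrow> (nat \<Rightarrow> real set set) \<Rightarrow> real \<Rightarrow> (real \<Rightarrow> real) set" where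
  "follmer_paths T \<pi> \<kappa> =
     {U. finite_follmer_qv T \<pi> U \<and>
         (\<forall>s t. 0 \<le> s \<and> s < t \<and> t \<le> T \<longrightarrow>
            (follmer_bracket \<pi> U t - follmer_bracket \<pi> U s) / (t - s) \<le> \<kappa>)}"

definition follmer_sum ::
  "real set set \<Rightarrow> (real \<Rightarrow> real) \<Rightarrow> (real \<Rightarrow> real) \<Rightarrow> real \<Rightarrow> real" where
  "follmer_sum D V X t = (\<Sum>K\<in>D. V (Inf K) * (X (min (Sup K) t) - X (min (Inf K) t)))"

definition follmer_integrable ::
  "real \<Rightarrow> (nat \<Rightarrow> real set set) \<Rightarrow> (real \<Rightarrow> real) \<Rightarrow> (real \<Rightarrow> real) \<Rightarrow> bool" where
  "follmer_integrable T \<pi> V X \<longleftrightarrow> (\<forall>t\<in>{0..T}. convergent (\<lambda>n. follmer_sum (\<pi> n) V X t))"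

definition follmer_integral ::
  "real \<Rightarrow> (nat \<Rightarrow> real set set) \<Rightarrow> (real \<Rightarrow> real) \<Rightarrow> (real \<Rightarrow> real) \<Rightarrow> real" where
  "follmer_integral t \<pi> V X = lim (\<lambda>n. follmer_sum (\<pi> n) V X t)"

text \<open>
  Integral against the Lebesgue-Stieltjes measure of the bracket. If every interval of every
  \<open>\<pi> n\<close> lies in \<open>[0, t]\<close>, then \<open>follmer_bracket \<pi> X\<close> is \<open>0\<close> on the negative half-line and constant
  on \<open>[t, \<infinity>)\<close>, so the measure has no mass outside \<open>[0, t]\<close>, and none at \<open>0\<close> or \<open>t\<close> when the bracket
  is continuous on \<open>[0, t]\<close>.
\<close>

definition bracket_integral ::
  "real \<Rightarrow> (nat \<Rightarrow> real set set) \<Rightarrow> (real \<Rightarrow> real) \<Rightarrow> (real \<Rightarrow> real) \<Rightarrow> real" where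
  "bracket_integral t \<pi> V X = (LINT r:{0..t}|interval_measure (follmer_bracket \<pi> X). V r)"

text \<open>
  The partition of \<open>[0, t]\<close> into the intervals \<open>[t - min u t, t - r]\<close>, where \<open>[r, u]\<close> ranges over the
  intervals of \<open>D\<close> with \<open>r < t\<close>. Distinct intervals of a division have distinct images.
\<close>

definition reverse_partition :: "real \<Rightarrow> real set set \<Rightarrow> real set set" where
  "reverse_partition t D = (\<lambda>K. {t - min (Sup K) t .. t - Inf K}) ` {K\<in>D. Inf K < t}"

definition reverse_path :: "real \<Rightarrow> (real \<Rightarrow> real) \<Rightarrow> real \<Rightarrow> real" where
  "reverse_path t U s = U t - U (t - s)"

end

theory Submission
  imports Defs
begin

text \<open>
  Run Loewner's equation backwards from time \<open>t\<close>. If \<open>k\<close> solves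
  \<open>k' = - 2 / (k + \<beta>)\<close> with \<open>k 0 = \<i> y\<close>, where \<open>\<beta>\<close> is the time-reversed driver, then
  \<open>f_t (\<i> y + U_t) = k t + U_t\<close>. The difference of two solutions of such an equation solves a linear
  equation, so it is its initial value times the exponential of an integral. This one formula gives
  the uniqueness of \<open>g_t\<close>, its injectivity and, letting the two initial values merge,
  \<open>log |f_t'(\<i> y + U_t)| = \<integral> Re (2 / Z\<^sup>2) dr\<close> with \<open>Z = k + \<beta>\<close> (lemma \<open>deriv_loewner_f\<close>).

  Take \<open>G = Re (1 / Z)\<close>. Follmer's form of Ito's formula for \<open>log |Z|\<close> (lemma \<open>ito_reverse_flow\<close>)
  reads
    \<open>\<integral> G d\<beta> = log |Z_t| - log y + \<integral> Re (2 / Z\<^sup>2) dr + 1/2 \<integral> Re (1 / Z\<^sup>2) d[\<beta>]\<close>,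
  so that \<open>log |f_t'|\<close> is \<open>\<integral> G d\<beta>\<close> minus explicit terms. Put \<open>P = \<integral> 1 / |Z|\<^sup>2 dr\<close>. Four facts
  finish the argument.

    \<^item> \<open>log |Z_t| \<ge> log (Im k_t) = log y + 2 P\<close>, because \<open>(log Im k)' = 2 / |Z|\<^sup>2\<close>.
    \<^item> \<open>Re (1 / Z\<^sup>2) = 2 G\<^sup>2 - 1 / |Z|\<^sup>2\<close> and \<open>G\<^sup>2 \<le> 1 / |Z|\<^sup>2\<close>.
    \<^item> \<open>d[\<beta>] \<le> \<kappa> dr\<close> on nonnegative continuous integrands (lemma \<open>interval_measure_integral_le\<close>).
    \<^item> \<open>\<integral> G dA \<le> \<epsilon> \<integral> G\<^sup>2 dr + \<parallel>A\<parallel>\<^sup>2 / (4 \<epsilon>)\<close> (lemma \<open>cameron_martin_young\<close>).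

  With \<open>p b = 3\<close>, the terms other than \<open>\<integral> G dN\<close>, \<open>- p b / 2 \<integral> G\<^sup>2 d[N]\<close> and \<open>\<parallel>A\<parallel>\<^sup>2 / (4 \<epsilon>)\<close>
  contribute at most \<open>(\<kappa> + \<epsilon> - 2) P\<close> to \<open>log |f_t'|\<close>. This vanishes for \<open>\<epsilon> = 2 - \<kappa>\<close>, which is
  where \<open>\<kappa> < 2\<close> enters; \<open>b = 5/2\<close> and \<open>p = 6/5\<close> satisfy \<open>p b = 3\<close>.

  Two points need separate work. The norm of \<open>A\<close> is defined through the pointwise derivative,
  so \<open>A_v - A_u = \<integral> A' dr\<close> requires Lebesgue's theorem that absolutely continuous functions are
  differentiable almost everywhere; it is derived from Vitali's covering theorem. And the Follmer
  bracket, a limit of sums of squares, has to be identified with the Stieltjes measure against which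
  \<open>G\<^sup>2\<close> is integrated (lemma \<open>weighted_square_sums_tendsto\<close>).
\<close>

section \<open>Absolutely continuous functions\<close>

text \<open>
  Vitali's covering theorem leaves a null set uncovered by countably many disjoint intervals. Since
  those intervals lie in a bounded set, finitely many of them already suffice up to a set of small
  measure. Finiteness matters because absolute continuity speaks of finite families.
\<close>

lemma vitali_real_intervals:
  fixes E :: "real set" and P :: "real \<Rightarrow> real \<Rightarrow> bool"
  assumes cover: "\<And>x d. x \<in> E \<Longrightarrow> d > 0 \<Longrightarrow> \<exists>u v. u < v \<and> u \<le> x \<and> x \<le> v \<and> v - u < d \<and> P u v"
    and bdd: "\<And>u v. P u v \<Longrightarrow> {u..v} \<subseteq> {a..b}"
    and "\<epsilon> > 0"
  obtains F H where "finite F" "\<And>K. K \<in> F \<Longrightarrow> \<exists>u v. u < v \<and> P u v \<and> K = {u..v}"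
    "disjoint F" "H \<in> lmeasurable" "measure lebesgue H < \<epsilon>" "E \<subseteq> H \<union> \<Union>F"
proof -
  let ?m = "measure lebesgue"
  define I where "I = {(u,v). u < v \<and> P u v}"
  define ctr where "ctr = (\<lambda>(u,v). (u+v)/2 :: real)"
  define rad where "rad = (\<lambda>(u,v). (v-u)/2 :: real)"
  have cb: "cball (ctr i) (rad i) = {fst i..snd i}" for i
    by (auto simp: ctr_def rad_def cball_eq_atLeastAtMost split: prod.splits) (simp_all add: field_simps)
  obtain C where C: "countable C" "C \<subseteq> I"
     "pairwise (\<lambda>i j. disjnt (cball (ctr i) (rad i)) (cball (ctr j) (rad j))) C"
     "negligible (E - (\<Union>i \<in> C. cball (ctr i) (rad i)))"
  proof (rule Vitali_covering_theorem_cballs[of I rad E ctr])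
    show "0 < rad i" if "i \<in> I" for i using that by (auto simp: I_def rad_def)
    show "\<exists>i. i \<in> I \<and> x \<in> cball (ctr i) (rad i) \<and> rad i < d" if xd: "x \<in> E" "0 < d" for x d
    proof -
      obtain u v where "u < v" "u \<le> x" "x \<le> v" "v - u < d" "P u v" using cover[OF xd] by blast
      then show ?thesis by (intro exI[of _ "(u,v)"]) (simp add: cb I_def, simp add: rad_def)
    qed
  qed
  define J where "J = (\<lambda>i. {fst i..snd i}) ` C"
  have disj: "disjoint J"
    unfolding J_def pairwise_image
    using C(3) by (rule pairwise_mono) (auto simp: cb)
  have cJ: "countable J" using C(1) by (simp add: J_def)
  have Jin: "K \<subseteq> {a..b}" if "K \<in> J" for K
    using that C(2) bdd by (force simp: J_def I_def)
  have Jform: "\<exists>u v. u < v \<and> P u v \<and> K = {u..v}" if "K \<in> J" for K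
    using that C(2) by (force simp: J_def I_def)
  have Jm: "K \<in> lmeasurable" if "K \<in> J" for K
    using Jform[OF that] by auto
  have neg: "negligible (E - \<Union>J)"
    using C(4) by (simp add: cb J_def)
  have UJ: "\<Union>J \<in> lmeasurable"
  proof (rule fmeasurableI2[of "{a..b}"])
    show "\<Union>J \<in> sets lebesgue" using cJ Jm by (meson sets.countable_Union fmeasurableD subsetI)
  qed (use Jin in auto)
  have "\<exists>F. finite F \<and> F \<subseteq> J \<and> ?m (\<Union>J - \<Union>F) < \<epsilon>"
  proof (cases "finite J")
    case True
    then show ?thesis using \<open>\<epsilon> > 0\<close> by (intro exI[of _ J]) auto
  next
    case False
    define K where "K = from_nat_into J"
    have K: "bij_betw K UNIV J" unfolding K_def using bij_betw_from_nat_into[OF cJ False] .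
    have UK: "\<Union>J = (\<Union>n. K n)" using K by (auto simp: bij_betw_def)
    have Km: "K n \<in> lmeasurable" for n using K Jm by (auto simp: bij_betw_def)
    have dis: "decseq (\<lambda>n. \<Union>J - (\<Union>i<n. K i))"
      by (auto simp: decseq_def intro: less_le_trans)
    have "(\<lambda>n. ?m (\<Union>J - (\<Union>i<n. K i))) \<longlonglongrightarrow> ?m (\<Inter>n. \<Union>J - (\<Union>i<n. K i))"
    proof (rule Lim_measure_decseq)
      show "range (\<lambda>n. \<Union>J - (\<Union>i<n. K i)) \<subseteq> sets lebesgue" using UJ Km by (auto intro!: sets.Diff sets.finite_UN)
      show "emeasure lebesgue (\<Union>J - (\<Union>i<i. K i)) \<noteq> \<infinity>" for i
      proof -
        have "(\<Union>J - (\<Union>i<i. K i)) \<in> lmeasurable" using UJ Km by (intro fmeasurable.Diff fmeasurable.finite_UN) auto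
        then show ?thesis by (metis fmeasurableD2 infinity_ennreal_def)
      qed
    qed fact
    moreover have "(\<Inter>n. \<Union>J - (\<Union>i<n. K i)) = {}" unfolding UK by (auto intro: lessI)
    ultimately have "(\<lambda>n. ?m (\<Union>J - (\<Union>i<n. K i))) \<longlonglongrightarrow> 0" by (simp only: measure_empty)
    then have "\<forall>\<^sub>F n in sequentially. ?m (\<Union>J - (\<Union>i<n. K i)) < \<epsilon>"
      using \<open>\<epsilon> > 0\<close> by (simp add: order_tendstoD(2))
    then obtain n where "?m (\<Union>J - (\<Union>i<n. K i)) < \<epsilon>"
      by (auto simp: eventually_sequentially)
    then show ?thesis using K by (intro exI[of _ "K ` {..<n}"]) (auto simp: bij_betw_def)
  qed
  then obtain F where F: "finite F" "F \<subseteq> J" "?m (\<Union>J - \<Union>F) < \<epsilon>" by blast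
  show thesis
  proof
    show "finite F" by fact
    show "\<exists>u v. u < v \<and> P u v \<and> K = {u..v}" if "K \<in> F" for K using that F(2) Jform by blast
    show "disjoint F" using disj F(2) by (meson pairwise_subset)
    have FU: "\<Union>F \<in> lmeasurable" using F(1,2) Jm by (intro fmeasurable.finite_Union) auto
    have 1: "\<Union>J - \<Union>F \<in> lmeasurable" using UJ FU by (rule fmeasurable.Diff)
    have 2: "E - \<Union>J \<in> lmeasurable" using neg by (rule negligible_imp_measurable)
    show "(\<Union>J - \<Union>F) \<union> (E - \<Union>J) \<in> lmeasurable" using 1 2 by (rule fmeasurable.Un)
    have "?m ((\<Union>J - \<Union>F) \<union> (E - \<Union>J)) \<le> ?m (\<Union>J - \<Union>F) + ?m (E - \<Union>J)"
      using 1 2 by (intro measure_Un_le) auto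
    then show "?m ((\<Union>J - \<Union>F) \<union> (E - \<Union>J)) < \<epsilon>"
      using negligible_imp_measure0[OF neg] F(3) by linarith
    show "E \<subseteq> (\<Union>J - \<Union>F) \<union> (E - \<Union>J) \<union> \<Union>F" by blast
  qed
qed

lemma division_telescope:
  fixes h :: "real \<Rightarrow> 'a::real_normed_vector"
  assumes "D division_of {a..b}" "a \<le> b"
  shows "(\<Sum>K\<in>D. h (Sup K) - h (Inf K)) = h b - h a"
proof -
  define p where "p = (\<lambda>K. (Inf K, K)) ` D"
  have fin: "finite D" and bK: "\<And>K. K \<in> D \<Longrightarrow> \<exists>u v. u \<le> v \<and> K = {u..v}"
    using assms(1) division_ofD(3,4)[OF assms(1)] by (fastforce, metis atLeastatMost_empty_iff box_real(2) )
  have "p tagged_division_of {a..b}"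
  proof (rule tagged_division_ofI)
    show "finite p" using fin by (simp add: p_def)
    fix x K assume "(x,K) \<in> p"
    then have xK: "K \<in> D" "x = Inf K" by (auto simp: p_def)
    then show "x \<in> K" using bK[of K] by auto
    show "K \<subseteq> {a..b}" "\<exists>u v. K = cbox u v" using xK division_ofD(2,4)[OF assms(1)] by auto
    fix x' K' assume "(x',K') \<in> p" "(x,K) \<noteq> (x',K')"
    then show "interior K \<inter> interior K' = {}" using xK division_ofD(5)[OF assms(1)] by (auto simp: p_def)
  next
    have "\<Union>{K. \<exists>x. (x, K) \<in> p} = \<Union>D" by (auto simp: p_def)
    then show "\<Union>{K. \<exists>x. (x, K) \<in> p} = {a..b}" using division_ofD(6)[OF assms(1)] by simp
  qed
  from additive_tagged_division_1[OF assms(2) this, of h]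
  have "(\<Sum>(x, K)\<in>p. h (Sup K) - h (Inf K)) = h b - h a" .
  moreover have "(\<Sum>(x, K)\<in>p. h (Sup K) - h (Inf K)) = (\<Sum>K\<in>D. h (Sup K) - h (Inf K))"
    unfolding p_def by (subst sum.reindex) (auto simp: inj_on_def)
  ultimately show ?thesis by simp
qed

lemma division_of_Union_intervalsI:
  assumes "finite D" "\<And>K. K \<in> D \<Longrightarrow> \<exists>u v. u \<le> v \<and> K = {u..v::real}"
    "\<And>K K'. K \<in> D \<Longrightarrow> K' \<in> D \<Longrightarrow> K \<noteq> K' \<Longrightarrow> interior K \<inter> interior K' = {}"
  shows "D division_of \<Union>D"
proof (rule division_ofI)
  fix K assume "K \<in> D"
  from assms(2)[OF this] obtain u v where "u \<le> v" "K = {u..v}" by blast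
  then show "K \<noteq> {}" "\<exists>a b. K = cbox a b" by auto
  show "K \<subseteq> \<Union>D" using \<open>K \<in> D\<close> by blast
qed (use assms in auto)

lemma division_of_IccD:
  assumes "D division_of {a..b::real}" "K \<in> D"
  obtains u v where "u \<le> v" "K = {u..v}" "a \<le> u" "v \<le> b"
proof -
  obtain u v where K: "K = {u..v}" using division_ofD(4)[OF assms] by auto
  moreover have "K \<noteq> {}" "K \<subseteq> {a..b}" using division_ofD(2,3)[OF assms] by auto
  ultimately show thesis using that[of u v] by auto
qed

text \<open>
  Extend the members of \<open>F'\<close> inside each interval of \<open>F\<close> to a division of that interval and telescope;
  \<open>D\<close> collects the added pieces, the gaps. With the identity for \<open>h\<close> the formula measures the gaps, with an absolutely continuous function it bounds the difference of the two sums.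
\<close>

lemma telescope_gaps:
  fixes F F' :: "real set set"
  assumes F: "finite F" "\<forall>K\<in>F. \<exists>u v. u < v \<and> K = {u..v}" "disjoint F"
    and F': "finite F'" "\<forall>K\<in>F'. \<exists>u v. u < v \<and> K = {u..v}" "disjoint F'"
    and sub: "\<forall>J\<in>F'. \<exists>I\<in>F. J \<subseteq> I"
  obtains D where "finite D" "\<And>K. K \<in> D \<Longrightarrow> (\<exists>I\<in>F. K \<subseteq> I) \<and> (\<exists>u v. u \<le> v \<and> K = {u..v})"
    "\<And>K K'. K \<in> D \<Longrightarrow> K' \<in> D \<Longrightarrow> K \<noteq> K' \<Longrightarrow> interior K \<inter> interior K' = {}"
    "\<And>h :: real \<Rightarrow> real. (\<Sum>K\<in>D. h (Sup K) - h (Inf K)) =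
       (\<Sum>K\<in>F. h (Sup K) - h (Inf K)) - (\<Sum>K\<in>F'. h (Sup K) - h (Inf K))"
proof -
  define p where "p I = {J\<in>F'. J \<subseteq> I}" for I
  have "\<exists>r. p I \<subseteq> r \<and> r division_of I" if IF: "I \<in> F" for I
  proof -
    obtain u v where I: "I = {u..v}" using bspec[OF F(2) IF] by blast
    have "p I division_of \<Union>(p I)"
    proof (rule division_of_Union_intervalsI)
      show "finite (p I)" using F'(1) by (simp add: p_def)
      show "\<exists>u v. u \<le> v \<and> K = {u..v}" if "K \<in> p I" for K
        using bspec[OF F'(2), of K] that less_imp_le by (auto simp: p_def)
      fix K K' assume "K \<in> p I" "K' \<in> p I" "K \<noteq> K'"
      then have "K \<inter> K' = {}" using F'(3) by (auto simp: p_def pairwise_def disjnt_def)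
      then show "interior K \<inter> interior K' = {}" using interior_subset[of K] interior_subset[of K'] by blast
    qed
    moreover have "\<Union>(p I) \<subseteq> cbox u v" using I by (auto simp: p_def)
    ultimately show ?thesis using partial_division_extend_interval[of "p I" u v] I
      by (metis box_real(2))
  qed
  then obtain r where r: "\<And>I. I \<in> F \<Longrightarrow> p I \<subseteq> r I" "\<And>I. I \<in> F \<Longrightarrow> r I division_of I" by metis
  define g where "g I = r I - p I" for I
  define D where "D = (\<Union>I\<in>F. g I)"
  have rsub: "K \<subseteq> I" "K \<noteq> {}" if "I \<in> F" "K \<in> r I" for I K
    using division_ofD(2,3)[OF r(2)[OF that(1)] that(2)] by auto
  have same: "I = I'" if "I \<in> F" "I' \<in> F" "K \<subseteq> I" "K' \<subseteq> I'" "K \<inter> K' \<noteq> {}" for I I' K K'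
    using F(3) that unfolding pairwise_def disjnt_def by blast
  have fr: "finite (r I)" if "I \<in> F" for I using division_ofD(1)[OF r(2)[OF that]] .
  show thesis
  proof
    show "finite D" unfolding D_def g_def using F(1) fr by auto
    show "(\<exists>I\<in>F. K \<subseteq> I) \<and> (\<exists>u v. u \<le> v \<and> K = {u..v})" if "K \<in> D" for K
    proof -
      obtain I where I: "I \<in> F" "K \<in> r I" using \<open>K \<in> D\<close> by (auto simp: D_def g_def)
      obtain u v where "I = {u..v}" using bspec[OF F(2) I(1)] by blast
      then obtain a b where "a \<le> b" "K = {a..b}" using division_of_IccD[of "r I" u v K] r(2)[OF I(1)] I(2) by metis
      then show ?thesis using I(1) rsub(1)[OF I] by blast
    qed
    show "interior K \<inter> interior K' = {}" if KK: "K \<in> D" "K' \<in> D" "K \<noteq> K'" for K K'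
    proof (rule ccontr)
      assume ne: "interior K \<inter> interior K' \<noteq> {}"
      obtain I I' where I: "I \<in> F" "K \<in> r I" "I' \<in> F" "K' \<in> r I'" using KK by (auto simp: D_def g_def)
      have "K \<inter> K' \<noteq> {}" using ne interior_subset by blast
      then have "I = I'" using same[OF I(1,3) rsub(1)[OF I(1,2)] rsub(1)[OF I(3,4)]] by blast
      then show False using ne division_ofD(5)[OF r(2)[OF I(1)], of K K'] I KK(3) by auto
    qed
    fix h :: "real \<Rightarrow> real"
    let ?h = "\<lambda>K. h (Sup K) - h (Inf K)"
    have "sum ?h D = (\<Sum>I\<in>F. sum ?h (g I))"
      unfolding D_def
    proof (rule sum.UNION_disjoint)
      show "\<forall>i\<in>F. \<forall>j\<in>F. i \<noteq> j \<longrightarrow> g i \<inter> g j = {}"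
      proof (intro ballI impI, rule ccontr)
        fix I I' assume I: "I \<in> F" "I' \<in> F" "I \<noteq> I'" "g I \<inter> g I' \<noteq> {}"
        then obtain K where K: "K \<in> r I" "K \<in> r I'" by (auto simp: g_def)
        then have "I = I'" using same[OF I(1,2), of K K] rsub[OF I(1) K(1)] rsub[OF I(2) K(2)] by auto
        then show False using I by simp
      qed
    qed (use F(1) fr in \<open>auto simp: g_def\<close>)
    also have "\<dots> = (\<Sum>I\<in>F. ?h I - sum ?h (p I))"
    proof (rule sum.cong)
      fix I assume I: "I \<in> F"
      obtain u v where uv: "u < v" "I = {u..v}" using bspec[OF F(2) I] by blast
      have "sum ?h (r I) = ?h I" using division_telescope[of "r I" u v h] r(2)[OF I] uv by simp
      then show "sum ?h (g I) = ?h I - sum ?h (p I)" unfolding g_def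
        using r(1)[OF I] fr[OF I] by (subst sum_diff) auto
    qed simp
    also have "\<dots> = sum ?h F - (\<Sum>I\<in>F. sum ?h (p I))" by (rule sum_subtractf)
    also have "(\<Sum>I\<in>F. sum ?h (p I)) = sum ?h (\<Union>I\<in>F. p I)"
    proof (rule sum.UNION_disjoint[symmetric])
      show "\<forall>i\<in>F. \<forall>j\<in>F. i \<noteq> j \<longrightarrow> p i \<inter> p j = {}"
      proof (intro ballI impI, rule ccontr)
        fix I I' assume I: "I \<in> F" "I' \<in> F" "I \<noteq> I'" "p I \<inter> p I' \<noteq> {}"
        then obtain K where K: "K \<in> F'" "K \<subseteq> I" "K \<subseteq> I'" by (auto simp: p_def)
        moreover have "K \<noteq> {}" using bspec[OF F'(2) K(1)] by auto
        ultimately have "I = I'" using same[OF I(1,2), of K K] by auto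
        then show False using I by simp
      qed
    qed (use F(1) F'(1) in \<open>auto simp: p_def\<close>)
    also have "(\<Union>I\<in>F. p I) = F'" using sub by (auto simp: p_def)
    finally show "sum ?h D = sum ?h F - sum ?h F'" .
  qed
qed

lemma measure_disjoint_intervals:
  assumes "finite F" "\<forall>K\<in>F. \<exists>u v. u < v \<and> K = {u..v::real}" "disjoint F"
  shows "(\<Sum>K\<in>F. Sup K - Inf K) = measure lebesgue (\<Union>F)" "\<Union>F \<in> lmeasurable"
proof -
  have m: "K \<in> lmeasurable \<and> measure lebesgue K = Sup K - Inf K" if "K \<in> F" for K
    using bspec[OF assms(2) that] by auto
  have "measure lebesgue (\<Union>F) = (\<Sum>K\<in>F. measure lebesgue K)"
    using assms(1,3) m by (intro measure_Union') auto
  then show "(\<Sum>K\<in>F. Sup K - Inf K) = measure lebesgue (\<Union>F)" using m by simp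
  show "\<Union>F \<in> lmeasurable" using m assms(1) by (intro fmeasurable.finite_Union) auto
qed

lemma lmeasurable_open_superset:
  fixes A :: "real set"
  assumes A: "A \<in> lmeasurable" and "e > 0"
  obtains G where "open G" "A \<subseteq> G" "G \<in> lmeasurable" "measure lebesgue G < measure lebesgue A + e"
proof -
  obtain G where G: "open G" "A \<subseteq> G" "(G - A) \<in> lmeasurable" "emeasure lebesgue (G - A) < ennreal e"
    using sets_lebesgue_outer_open[OF fmeasurableD[OF A] \<open>e > 0\<close>] by metis
  have eq: "G = A \<union> (G - A)" using G(2) by blast
  have "G \<in> lmeasurable" using A G(3) by (subst eq) (rule fmeasurable.Un)
  moreover have "measure lebesgue (G - A) < e"
    using G(3,4) \<open>e > 0\<close> by (simp add: emeasure_eq_measure2 ennreal_less_iff)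
  moreover have "measure lebesgue G \<le> measure lebesgue A + measure lebesgue (G - A)"
    using A G(3) by (subst eq) (intro measure_Un_le, auto)
  ultimately show thesis using that[of G] G by simp
qed

lemma measure_Union_division:
  assumes D: "D division_of \<Union>D"
  shows "measure lebesgue (\<Union>D) = (\<Sum>K\<in>D. Sup K - Inf (K :: real set))" "\<Union>D \<in> lmeasurable"
proof -
  have fin: "finite D" using division_ofD(1)[OF D] .
  have K: "\<exists>u v. u \<le> v \<and> K = {u..v}" if KD: "K \<in> D" for K
  proof -
    obtain a b where "K = {a..b}" using division_ofD(4)[OF D KD] by auto
    moreover have "K \<noteq> {}" using division_ofD(3)[OF D KD] .
    ultimately have "a \<le> b \<and> K = {a..b}" by auto
    then show ?thesis by blast
  qed
  have m: "K \<in> lmeasurable \<and> measure lebesgue K = Sup K - Inf K" if "K \<in> D" for K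
    using K[OF that] by auto
  have "measure lebesgue (\<Union>D) = (\<Sum>K\<in>D. measure lebesgue K)"
  proof (rule measure_negligible_finite_Union[OF fin])
    show "pairwise (\<lambda>K K'. negligible (K \<inter> K')) D"
    proof (rule pairwiseI)
      fix K K' assume KK: "K \<in> D" "K' \<in> D" "K \<noteq> K'"
      obtain u v u' v' where uv: "K = {u..v}" "K' = {u'..v'}" using K[OF KK(1)] K[OF KK(2)] by blast
      have "interior K \<inter> interior K' = {}" using division_ofD(5)[OF D KK] .
      then have "{u<..<v} \<inter> {u'<..<v'} = {}" by (simp add: uv interior_atLeastAtMost_real)
      then have "K \<inter> K' \<subseteq> {u,v,u',v'}" unfolding uv by fastforce
      then show "negligible (K \<inter> K')" by (meson negligible_finite finite.emptyI finite_insert finite_subset)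
    qed
  qed (use m in auto)
  then show "measure lebesgue (\<Union>D) = (\<Sum>K\<in>D. Sup K - Inf K)" using m by simp
  show "\<Union>D \<in> lmeasurable" using m fin by (intro fmeasurable.finite_Union) auto
qed

text \<open>
  The core of Lebesgue's differentiation theorem for absolutely continuous functions. Let \<open>e\<close> be the
  outer measure of \<open>E\<close>. Inside an open set that is barely larger than \<open>E\<close>, choose disjoint intervals
  \<open>F1\<close> of slope at most \<open>p\<close>, and inside these, disjoint intervals \<open>F2\<close> of slope at least \<open>q\<close>; both
  families fill almost all of \<open>E\<close>. The gaps between them then have tiny total length, yet \<open>f\<close> has to
  drop by about \<open>(q - p) e\<close> across them, which absolute continuity forbids.
\<close>

lemma negligible_two_slopes:
  assumes AC: "absolutely_continuous_path_on {a..b} f"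
    and "p < q" and E: "E \<subseteq> {a<..<b}"
    and low: "\<And>x d. x \<in> E \<Longrightarrow> d > 0 \<Longrightarrow> \<exists>u v. u < v \<and> u \<le> x \<and> x \<le> v \<and> v - u < d \<and> f v - f u \<le> p * (v - u)"
    and high: "\<And>x d. x \<in> E \<Longrightarrow> d > 0 \<Longrightarrow> \<exists>u v. u < v \<and> u \<le> x \<and> x \<le> v \<and> v - u < d \<and> q * (v - u) \<le> f v - f u"
  shows "negligible E"
proof (rule ccontr)
  assume nE: "\<not> negligible E"
  let ?m = "measure lebesgue"
  define M where "M = ?m ` {H \<in> lmeasurable. E \<subseteq> H}"
  define e where "e = Inf M"
  have elow: "e \<le> ?m H" if "H \<in> lmeasurable" "E \<subseteq> H" for H
    unfolding e_def by (rule cInf_lower) (use that in \<open>auto simp: M_def intro!: bdd_belowI[of _ 0]\<close>)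
  have Mne: "M \<noteq> {}" using E by (auto simp: M_def intro!: exI[of _ "{a<..<b}"])
  obtain \<epsilon>0 where \<epsilon>0: "\<epsilon>0 > 0" "\<And>T. E \<subseteq> T \<Longrightarrow> T \<in> lmeasurable \<Longrightarrow> ?m T \<ge> \<epsilon>0"
    using nE unfolding negligible_outer by (metis not_le)
  have "e \<ge> \<epsilon>0" unfolding e_def by (rule cInf_greatest[OF Mne]) (auto simp: M_def intro: \<epsilon>0)
  then have e0: "e > 0" using \<epsilon>0 by simp
  have "(q - p) * e / 4 > 0" using e0 \<open>p < q\<close> by simp
  then obtain \<delta> where \<delta>: "\<delta> > 0" and AC\<delta>: "\<forall>D. D division_of \<Union>D \<and> \<Union>D \<subseteq> {a..b} \<and> (\<Sum>K\<in>D. Sup K - Inf K) < \<delta> \<longrightarrow>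
        (\<Sum>K\<in>D. \<bar>f (Sup K) - f (Inf K)\<bar>) < (q - p) * e / 4"
    using AC unfolding absolutely_continuous_path_on_def by blast
  \<comment> \<open>the gaps will have length at most \<open>3 d\<close>: the first bound makes them short enough for absolute continuity, the
    second leaves half of \<open>e\<close> to the steep intervals, the third makes the slope \<open>p\<close> harmless on the gaps\<close>
  define d where "d = min (\<delta>/4) (min (e/4) ((q - p) * e / (12 * (\<bar>p\<bar> + 1))))"
  have d0: "d > 0" using \<delta> e0 \<open>p < q\<close> by (simp add: d_def)
  have d\<delta>: "d \<le> \<delta>/4" "d \<le> e/4" "d \<le> (q - p) * e / (12 * (\<bar>p\<bar> + 1))" unfolding d_def by linarith+
  have "\<exists>m\<in>M. m < e + d/2" using cInf_lessD[OF Mne, of "e + d/2"] d0 by (simp add: e_def)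
  then obtain H0 where H0: "H0 \<in> lmeasurable" "E \<subseteq> H0" "?m H0 < e + d/2" by (auto simp: M_def)
  obtain G where G: "open G" "H0 \<subseteq> G" "G \<in> lmeasurable" "?m G < ?m H0 + d/2"
    using lmeasurable_open_superset[OF H0(1), of "d/2"] d0 by auto
  have mG: "?m G < e + d" using H0 G by linarith
  let ?P = "\<lambda>u v. {u..v} \<subseteq> G \<inter> {a..b} \<and> f v - f u \<le> p * (v - u)"
  obtain F1 H1 where F1: "finite F1" "\<And>K. K \<in> F1 \<Longrightarrow> \<exists>u v. u < v \<and> (?P u v) \<and> K = {u..v}"
    "disjoint F1" and H1: "H1 \<in> lmeasurable" "?m H1 < d" "E \<subseteq> H1 \<union> \<Union>F1"
  proof (rule vitali_real_intervals[of E ?P a b d])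
    fix x d' :: real assume x: "x \<in> E" "d' > 0"
    have "open (G \<inter> {a<..<b})" "x \<in> G \<inter> {a<..<b}" using G(1,2) H0(2) x E by auto
    then obtain r where r: "r > 0" "ball x r \<subseteq> G \<inter> {a<..<b}" using open_contains_ball by blast
    obtain u v where uv: "u < v" "u \<le> x" "x \<le> v" "v - u < min d' r" "f v - f u \<le> p * (v - u)"
      using low[OF x(1), of "min d' r"] x r by auto
    have "{u..v} \<subseteq> ball x r" using uv by (auto simp: dist_real_def)
    also have "\<dots> \<subseteq> G \<inter> {a..b}" using r(2) by auto
    finally show "\<exists>u v. u < v \<and> u \<le> x \<and> x \<le> v \<and> v - u < d' \<and> ?P u v"
      using uv by auto
  qed (use d0 in auto)
  have F1': "\<forall>K\<in>F1. \<exists>u v. u < v \<and> K = {u..v}" using F1(2) by blast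
  let ?Q = "\<lambda>u v. {u..v} \<subseteq> {a..b} \<and> (\<exists>I\<in>F1. {u..v} \<subseteq> I) \<and> q * (v - u) \<le> f v - f u"
  obtain F2 H2 where F2: "finite F2" "\<And>K. K \<in> F2 \<Longrightarrow> \<exists>u v. u < v \<and> (?Q u v) \<and> K = {u..v}"
    "disjoint F2" and H2: "H2 \<in> lmeasurable" "?m H2 < d" "E \<inter> (\<Union>I\<in>F1. interior I) \<subseteq> H2 \<union> \<Union>F2"
  proof (rule vitali_real_intervals[of "E \<inter> (\<Union>I\<in>F1. interior I)" ?Q a b d])
    fix x d' :: real assume x: "x \<in> E \<inter> (\<Union>I\<in>F1. interior I)" "d' > 0"
    then obtain I where I: "I \<in> F1" "x \<in> interior I" by blast
    obtain r where r: "r > 0" "ball x r \<subseteq> I" using I(2) by (meson mem_interior)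
    have Iab: "I \<subseteq> {a..b}" using F1(2)[OF I(1)] by blast
    obtain u v where uv: "u < v" "u \<le> x" "x \<le> v" "v - u < min d' r" "q * (v - u) \<le> f v - f u"
      using high[of x "min d' r"] x r by auto
    have "{u..v} \<subseteq> ball x r" using uv by (auto simp: dist_real_def)
    also have "\<dots> \<subseteq> I" by (rule r)
    finally have "u < v \<and> u \<le> x \<and> x \<le> v \<and> v - u < d' \<and> ?Q u v"
      using uv Iab I(1) by (intro conjI; (linarith | blast))
    then show "\<exists>u v. u < v \<and> u \<le> x \<and> x \<le> v \<and> v - u < d' \<and> ?Q u v"
      by blast
  qed (use d0 in auto)
  have F2': "\<forall>K\<in>F2. \<exists>u v. u < v \<and> K = {u..v}" using F2(2) by blast
  have sub: "\<forall>J\<in>F2. \<exists>I\<in>F1. J \<subseteq> I" using F2(2) by blast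
  let ?L = "\<lambda>F. \<Sum>K\<in>F. Sup K - Inf K"
  have L1: "?L F1 \<le> e + d"
  proof -
    have "\<Union>F1 \<subseteq> G" using F1(2) by blast
    then have "?m (\<Union>F1) \<le> ?m G"
      using measure_disjoint_intervals(2)[OF F1(1) F1' F1(3)] G(3) by (intro measure_mono_fmeasurable) auto
    then show ?thesis using mG measure_disjoint_intervals(1)[OF F1(1) F1' F1(3)] by linarith
  qed
  have L2: "?L F2 \<ge> e - 2 * d"
  proof -
    define B where "B = (\<Union>I\<in>F1. I - interior I)"
    have "I - interior I \<subseteq> {Inf I, Sup I}" if "I \<in> F1" for I using bspec[OF F1' that] by (auto simp: interior_atLeastAtMost_real)
    then have "finite (I - interior I)" if "I \<in> F1" for I by (meson that finite.emptyI finite_insert finite_subset)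
    then have "finite B" unfolding B_def using F1(1) by auto
    then have nB: "negligible B" by (rule negligible_finite)
    have "E \<subseteq> (H1 \<union> B) \<union> (H2 \<union> \<Union>F2)"
    proof
      fix x assume x: "x \<in> E"
      show "x \<in> (H1 \<union> B) \<union> (H2 \<union> \<Union>F2)"
      proof (cases "x \<in> (\<Union>I\<in>F1. interior I)")
        case True
        then show ?thesis using x H2(3) by blast
      next
        case False
        then have "x \<in> B" if "x \<in> \<Union>F1" using that by (auto simp: B_def)
        then show ?thesis using x H1(3) by blast
      qed
    qed
    moreover have mm: "H1 \<union> B \<in> lmeasurable" "H2 \<union> \<Union>F2 \<in> lmeasurable"
      using H1 H2 negligible_imp_measurable[OF nB] measure_disjoint_intervals(2)[OF F2(1) F2' F2(3)] by auto
    ultimately have "e \<le> ?m ((H1 \<union> B) \<union> (H2 \<union> \<Union>F2))" by (intro elow) auto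
    also have "\<dots> \<le> ?m (H1 \<union> B) + ?m (H2 \<union> \<Union>F2)"
      using mm by (intro measure_Un_le) auto
    also have "\<dots> \<le> (?m H1 + ?m B) + (?m H2 + ?m (\<Union>F2))"
      using H1 H2 negligible_imp_measurable[OF nB] measure_disjoint_intervals(2)[OF F2(1) F2' F2(3)]
      by (intro add_mono measure_Un_le) auto
    finally show ?thesis using H1 H2 negligible_imp_measure0[OF nB] measure_disjoint_intervals(1)[OF F2(1) F2' F2(3)] by linarith
  qed
  obtain D where D: "finite D" "\<And>K. K \<in> D \<Longrightarrow> (\<exists>I\<in>F1. K \<subseteq> I) \<and> (\<exists>u v. u \<le> v \<and> K = {u..v})"
    "\<And>K K'. K \<in> D \<Longrightarrow> K' \<in> D \<Longrightarrow> K \<noteq> K' \<Longrightarrow> interior K \<inter> interior K' = {}"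
    and Dsum: "\<And>h :: real \<Rightarrow> real. (\<Sum>K\<in>D. h (Sup K) - h (Inf K)) =
       (\<Sum>K\<in>F1. h (Sup K) - h (Inf K)) - (\<Sum>K\<in>F2. h (Sup K) - h (Inf K))"
    using telescope_gaps[OF F1(1) F1' F1(3) F2(1) F2' F2(3) sub] by blast
  have DL: "?L D = ?L F1 - ?L F2" using Dsum[of "\<lambda>x. x"] .
  have "(\<Sum>K\<in>D. \<bar>f (Sup K) - f (Inf K)\<bar>) < (q - p) * e / 4"
  proof (rule AC\<delta>[rule_format], intro conjI)
    show "?L D < \<delta>" using DL L1 L2 d\<delta>(1) \<delta> by linarith
    show "D division_of \<Union>D" by (rule division_of_Union_intervalsI[OF D(1)]) (use D(2,3) in auto)
    show "\<Union>D \<subseteq> {a..b}" using D(2) F1(2) by fastforce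
  qed
  moreover have "- (\<Sum>K\<in>D. f (Sup K) - f (Inf K)) \<le> (\<Sum>K\<in>D. \<bar>f (Sup K) - f (Inf K)\<bar>)"
    unfolding sum_negf[symmetric] by (intro sum_mono) simp
  moreover have "(\<Sum>K\<in>F1. f (Sup K) - f (Inf K)) \<le> p * ?L F1"
    unfolding sum_distrib_left using F1(2) by (intro sum_mono) force
  moreover have "q * ?L F2 \<le> (\<Sum>K\<in>F2. f (Sup K) - f (Inf K))"
    unfolding sum_distrib_left using F2(2) by (intro sum_mono) force
  ultimately have "q * ?L F2 - p * ?L F1 < (q - p) * e / 4" using Dsum[of f] by linarith
  then have 1: "(q - p) * ?L F2 - p * ?L D < (q - p) * e / 4" by (simp add: DL algebra_simps)
  have "0 \<le> ?L D" using D(2) by (intro sum_nonneg) force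
  then have "p * ?L D \<le> (\<bar>p\<bar> + 1) * (3 * d)"
    using DL L1 L2 by (intro mult_mono) auto
  also have "\<dots> \<le> (\<bar>p\<bar> + 1) * (3 * ((q - p) * e / (12 * (\<bar>p\<bar> + 1))))"
    using d\<delta>(3) by (intro mult_left_mono) auto
  also have "\<dots> = (q - p) * e / 4" by (simp add: field_simps)
  finally have 2: "p * ?L D \<le> (q - p) * e / 4" .
  have "(q - p) * (e / 2) \<le> (q - p) * ?L F2" using L2 d\<delta>(2) \<open>p < q\<close> by (intro mult_left_mono) auto
  with 1 2 have "(q - p) * e / 2 < (q - p) * e / 2" by simp
  then show False by simp
qed

text \<open>
  On a piece of length below the \<open>\<delta>\<close> that absolute continuity assigns to \<open>1\<close>, disjoint intervals of
  absolute slope at least \<open>M\<close> have total length at most \<open>1 / M\<close>.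
\<close>

lemma negligible_infinite_slope:
  assumes AC: "absolutely_continuous_path_on {a..b} f"
    and E: "E \<subseteq> {a<..<b}"
    and steep: "\<And>x d M. x \<in> E \<Longrightarrow> d > 0 \<Longrightarrow> \<exists>u v. u < v \<and> u \<le> x \<and> x \<le> v \<and> v - u < d \<and> M * (v - u) \<le> \<bar>f v - f u\<bar>"
  shows "negligible E"
proof -
  obtain \<delta> where \<delta>: "\<delta> > 0" and AC\<delta>: "\<forall>D. D division_of \<Union>D \<and> \<Union>D \<subseteq> {a..b} \<and> (\<Sum>K\<in>D. Sup K - Inf K) < \<delta> \<longrightarrow>
        (\<Sum>K\<in>D. \<bar>f (Sup K) - f (Inf K)\<bar>) < 1"
    using AC unfolding absolutely_continuous_path_on_def using zero_less_one by blast
  have "negligible (E \<inter> ball z (\<delta>/4))" for z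
    unfolding negligible_outer
  proof (intro allI impI)
    fix e :: real assume e: "e > 0"
    define B where "B = ball z (\<delta>/4) \<inter> {a<..<b}"
    \<comment> \<open>intervals of absolute slope at least \<open>M\<close> will have total length below \<open>e / 4\<close>\<close>
    define M where "M = 4 / e"
    obtain F H where F: "finite F" "\<And>K. K \<in> F \<Longrightarrow> \<exists>u v. u < v \<and> ({u..v} \<subseteq> B \<and> M * (v - u) \<le> \<bar>f v - f u\<bar>) \<and> K = {u..v}"
      "disjoint F" and H: "H \<in> lmeasurable" "measure lebesgue H < e/2" "E \<inter> ball z (\<delta>/4) \<subseteq> H \<union> \<Union>F"
    proof (rule vitali_real_intervals[of "E \<inter> ball z (\<delta>/4)" "\<lambda>u v. {u..v} \<subseteq> B \<and> M * (v - u) \<le> \<bar>f v - f u\<bar>" a b "e/2"])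
      fix x d' :: real assume x: "x \<in> E \<inter> ball z (\<delta>/4)" "d' > 0"
      have "open B" "x \<in> B" using x E by (auto simp: B_def)
      then obtain r where r: "r > 0" "ball x r \<subseteq> B" using open_contains_ball by blast
      obtain u v where uv: "u < v" "u \<le> x" "x \<le> v" "v - u < min d' r" "M * (v - u) \<le> \<bar>f v - f u\<bar>"
        using steep[of x "min d' r" M] x r by auto
      have "{u..v} \<subseteq> ball x r" using uv by (auto simp: dist_real_def)
      also have "\<dots> \<subseteq> B" by (rule r)
      finally show "\<exists>u v. u < v \<and> u \<le> x \<and> x \<le> v \<and> v - u < d' \<and> {u..v} \<subseteq> B \<and> M * (v - u) \<le> \<bar>f v - f u\<bar>"
        using uv by auto
    qed (use e in \<open>auto simp: B_def\<close>)
    have F': "\<forall>K\<in>F. \<exists>u v. u < v \<and> K = {u..v}" using F(2) by blast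
    note mF = measure_disjoint_intervals[OF F(1) F' F(3)]
    have "measure lebesgue (\<Union>F) \<le> measure lebesgue (ball z (\<delta>/4))"
    proof (rule measure_mono_fmeasurable)
      show "\<Union>F \<subseteq> ball z (\<delta>/4)" using F(2) by (force simp: B_def)
    qed (use mF(2) in auto)
    also have "\<dots> = \<delta>/2" using \<delta> by (simp add: ball_eq_greaterThanLessThan)
    finally have small: "(\<Sum>K\<in>F. Sup K - Inf K) < \<delta>" using mF(1) \<delta> by linarith
    have "(\<Sum>K\<in>F. \<bar>f (Sup K) - f (Inf K)\<bar>) < 1"
    proof (rule AC\<delta>[rule_format], intro conjI small)
      show "\<Union>F \<subseteq> {a..b}" using F(2) by (force simp: B_def)
      show "F division_of \<Union>F"
      proof (rule division_of_Union_intervalsI[OF F(1)])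
        show "\<exists>u v. u \<le> v \<and> K = {u..v}" if "K \<in> F" for K using bspec[OF F' that] less_imp_le by blast
        show "interior K \<inter> interior K' = {}" if "K \<in> F" "K' \<in> F" "K \<noteq> K'" for K K'
        proof -
          have "K \<inter> K' = {}" using F(3) that unfolding pairwise_def disjnt_def by blast
          then show ?thesis using interior_subset[of K] interior_subset[of K'] by blast
        qed
      qed
    qed
    moreover have "M * (\<Sum>K\<in>F. Sup K - Inf K) \<le> (\<Sum>K\<in>F. \<bar>f (Sup K) - f (Inf K)\<bar>)"
      unfolding sum_distrib_left using F(2) by (intro sum_mono) force
    ultimately have "M * measure lebesgue (\<Union>F) < 1" using mF(1) by simp
    then have "measure lebesgue (\<Union>F) < e / 2" using e by (simp add: M_def field_simps)
    then have "measure lebesgue (H \<union> \<Union>F) < e"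
      using measure_Un_le[of H lebesgue "\<Union>F"] H mF(2) by auto
    then show "\<exists>T. E \<inter> ball z (\<delta>/4) \<subseteq> T \<and> T \<in> lmeasurable \<and> measure lebesgue T < e"
      using H mF(2) by (intro exI[of _ "H \<union> \<Union>F"]) auto
  qed
  then have neg: "negligible (E \<inter> ball x (\<delta>/4))" for x by blast
  have "\<exists>U. openin (top_of_set E) U \<and> x \<in> U \<and> negligible U" if "x \<in> E" for x
  proof (intro exI conjI)
    show "openin (top_of_set E) (E \<inter> ball x (\<delta>/4))" by (rule openin_open_Int) simp
    show "x \<in> E \<inter> ball x (\<delta>/4)" using that \<delta> by simp
  qed (rule neg)
  then show ?thesis using locally_negligible_alt by blast
qed

text \<open>
  At a point without derivative the difference quotient is either unbounded, or for some rational
  \<open>p < q\<close> it takes values up to \<open>p\<close> and values from \<open>q\<close> arbitrarily close to the point.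
\<close>

lemma absolutely_continuous_differentiable_ae:
  assumes AC: "absolutely_continuous_path_on {a..b} f"
  obtains S where "negligible S" "\<And>x. x \<in> {a..b} - S \<Longrightarrow> (f has_real_derivative deriv f x) (at x)"
proof -
  define Q where "Q x y = (f y - f x) / (y - x)" for x y
  define Einf where "Einf = {x\<in>{a<..<b}. \<forall>M. \<exists>\<^sub>F y in at x. M \<le> \<bar>Q x y\<bar>}"
  define E where "E p q = {x\<in>{a<..<b}. (\<exists>\<^sub>F y in at x. Q x y \<le> p) \<and> (\<exists>\<^sub>F y in at x. q \<le> Q x y)}" for p q
  have nearby: "\<exists>u v. u < v \<and> u \<le> x \<and> x \<le> v \<and> v - u < d \<and> P ((f v - f u) / (v - u))"
    if "\<exists>\<^sub>F y in at x. P (Q x y)" "d > 0" for x d P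
  proof -
    have "\<not> (\<forall>y. y \<noteq> x \<and> dist y x < d \<longrightarrow> \<not> P (Q x y))"
      using that unfolding frequently_def eventually_at by auto
    then obtain y where y: "y \<noteq> x" "\<bar>y - x\<bar> < d" "P (Q x y)" by (auto simp: dist_real_def)
    have "(f (max x y) - f (min x y)) / (max x y - min x y) = Q x y"
      using y(1) minus_divide_divide[of "f y - f x" "y - x"] by (auto simp: Q_def max_def min_def)
    moreover have "min x y < max x y \<and> min x y \<le> x \<and> x \<le> max x y \<and> max x y - min x y < d"
      using y by linarith
    ultimately show ?thesis using y(3) by metis
  qed
  have "negligible Einf"
  proof (rule negligible_infinite_slope[OF AC])
    fix x d M :: real assume x: "x \<in> Einf" "d > 0"
    then obtain u v where "u < v \<and> u \<le> x \<and> x \<le> v \<and> v - u < d \<and> M \<le> \<bar>(f v - f u) / (v - u)\<bar>"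
      using nearby[where x=x and P="\<lambda>r. M \<le> \<bar>r\<bar>" and d=d] by (auto simp: Einf_def)
    then have "u < v \<and> u \<le> x \<and> x \<le> v \<and> v - u < d \<and> M * (v - u) \<le> \<bar>f v - f u\<bar>"
      by (auto simp: abs_divide pos_le_divide_eq)
    then show "\<exists>u v. u < v \<and> u \<le> x \<and> x \<le> v \<and> v - u < d \<and> M * (v - u) \<le> \<bar>f v - f u\<bar>"
      by blast
  qed (auto simp: Einf_def)
  moreover have "negligible (E p q)" if "p < q" for p q
  proof (rule negligible_two_slopes[OF AC that])
    fix x d :: real assume x: "x \<in> E p q" "d > 0"
    then obtain u v where "u < v \<and> u \<le> x \<and> x \<le> v \<and> v - u < d \<and> (f v - f u) / (v - u) \<le> p"
      using nearby[where x=x and P="\<lambda>r. r \<le> p" and d=d] by (auto simp: E_def)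
    then have "u < v \<and> u \<le> x \<and> x \<le> v \<and> v - u < d \<and> f v - f u \<le> p * (v - u)"
      by (auto simp: pos_divide_le_eq)
    then show "\<exists>u v. u < v \<and> u \<le> x \<and> x \<le> v \<and> v - u < d \<and> f v - f u \<le> p * (v - u)"
      by blast
    from x obtain u v where "u < v \<and> u \<le> x \<and> x \<le> v \<and> v - u < d \<and> q \<le> (f v - f u) / (v - u)"
      using nearby[where x=x and P="\<lambda>r. q \<le> r" and d=d] by (auto simp: E_def)
    then have "u < v \<and> u \<le> x \<and> x \<le> v \<and> v - u < d \<and> q * (v - u) \<le> f v - f u"
      by (auto simp: pos_le_divide_eq)
    then show "\<exists>u v. u < v \<and> u \<le> x \<and> x \<le> v \<and> v - u < d \<and> q * (v - u) \<le> f v - f u"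
      by blast
  qed (auto simp: E_def)
  ultimately have neg: "negligible ({a, b} \<union> Einf \<union> (\<Union>(p,q)\<in>{(p,q). p \<in> \<rat> \<and> q \<in> \<rat> \<and> p < q}. E p q))"
  proof (intro negligible_Un negligible_countable_Union)
    have "countable (\<rat> \<times> \<rat> :: (real \<times> real) set)" by (intro countable_SIGMA countable_rat)
    then show "countable ((\<lambda>(p,q). E p q) ` {(p,q). p \<in> \<rat> \<and> q \<in> \<rat> \<and> p < q})"
      by (intro countable_image) (rule countable_subset, auto)
  qed auto
  show thesis
  proof (rule that[OF neg])
    fix x assume x: "x \<in> {a..b} - ({a, b} \<union> Einf \<union> (\<Union>(p,q)\<in>{(p,q). p \<in> \<rat> \<and> q \<in> \<rat> \<and> p < q}. E p q))"
    then have xin: "x \<in> {a<..<b}" by auto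
    obtain M where M: "\<forall>\<^sub>F y in at x. \<bar>Q x y\<bar> < M"
      using x xin by (auto simp: Einf_def frequently_def not_le)
    have dich: "(\<forall>\<^sub>F y in at x. p < Q x y) \<or> (\<forall>\<^sub>F y in at x. Q x y < q)" if "p \<in> \<rat>" "q \<in> \<rat>" "p < q" for p q
      using x xin that by (auto simp: E_def frequently_def not_le)
    define L where "L = {p. \<forall>\<^sub>F y in at x. p < Q x y}"
    have ub: "p \<le> M" if "p \<in> L" for p
    proof -
      have "\<forall>\<^sub>F y in at x. p < M"
        using that M unfolding L_def mem_Collect_eq by eventually_elim linarith
      then show ?thesis by simp
    qed
    have ne: "-M \<in> L" unfolding L_def using M by (auto elim!: eventually_mono)
    have "(Q x \<longlongrightarrow> Sup L) (at x)"
    proof (rule order_tendstoI)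
      fix l assume "l < Sup L"
      then obtain p where "p \<in> L" "l < p" using less_cSupD[of L l] ne by blast
      then show "\<forall>\<^sub>F y in at x. l < Q x y" unfolding L_def by (auto elim: eventually_mono)
    next
      fix l assume "Sup L < l"
      then obtain p where p: "p \<in> \<rat>" "Sup L < p" "p < l" using Rats_dense_in_real by blast
      obtain q where q: "q \<in> \<rat>" "p < q" "q < l" using Rats_dense_in_real[OF p(3)] by blast
      have "bdd_above L" using ub by (rule bdd_aboveI)
      then have "p \<notin> L" using cSup_upper[of p L] p(2) by auto
      then have "\<forall>\<^sub>F y in at x. Q x y < q" using dich[OF p(1) q(1,2)] by (auto simp: L_def)
      then show "\<forall>\<^sub>F y in at x. Q x y < l" by eventually_elim (use q in simp)
    qed
    then have "(f has_real_derivative Sup L) (at x)"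
      unfolding has_field_derivative_iff Q_def .
    then show "(f has_real_derivative deriv f x) (at x)"
      by (metis DERIV_imp_deriv)
  qed
qed

text \<open>
  In a Henstock--Kurzweil sum the intervals tagged outside the exceptional null set are controlled by
  differentiability. The gauge forces those tagged inside it into an open set of small measure, where
  absolute continuity controls the increments.
\<close>

lemma absolutely_continuous_has_integral_deriv:
  assumes AC: "absolutely_continuous_path_on {a..b} f" and ab: "a \<le> b"
  shows "(deriv f has_integral f b - f a) {a..b}"
proof -
  obtain S where S: "negligible S" and der: "\<And>x. x \<in> {a..b} - S \<Longrightarrow> (f has_real_derivative deriv f x) (at x)"
    using absolutely_continuous_differentiable_ae[OF AC] by metis
  define f' where "f' x = (if x \<in> S then 0 else deriv f x)" for x
  have "(f' has_integral f b - f a) (cbox a b)"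
    unfolding has_integral
  proof (intro allI impI)
    fix e :: real assume e: "e > 0"
    define c where "c = e / (4 * (b - a + 1))"
    have c0: "c > 0" using e ab by (simp add: c_def)
    have "e / 2 > 0" using e by simp
    then obtain \<delta> where \<delta>: "\<delta> > 0" and AC\<delta>: "\<forall>D. D division_of \<Union>D \<and> \<Union>D \<subseteq> {a..b} \<and> (\<Sum>K\<in>D. Sup K - Inf K) < \<delta> \<longrightarrow>
        (\<Sum>K\<in>D. \<bar>f (Sup K) - f (Inf K)\<bar>) < e / 2"
      using AC unfolding absolutely_continuous_path_on_def by blast
    obtain H where H: "open H" "S \<subseteq> H" "H \<in> lmeasurable" "measure lebesgue H < \<delta>"
      using lmeasurable_open_superset[OF negligible_imp_measurable[OF S] \<delta>] negligible_imp_measure0[OF S] by auto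
    have "\<exists>d>0. \<forall>y. \<bar>y - x\<bar> < d \<longrightarrow> \<bar>f y - f x - (y - x) * deriv f x\<bar> \<le> c * \<bar>y - x\<bar>" if "x \<in> {a..b} - S" for x
      using der[OF that] c0 unfolding has_field_derivative_def has_derivative_within_alt
      by (force simp: mult.commute)
    then obtain d where d: "\<And>x. x \<in> {a..b} - S \<Longrightarrow> d x > 0"
       "\<And>x y. x \<in> {a..b} - S \<Longrightarrow> \<bar>y - x\<bar> < d x \<Longrightarrow> \<bar>f y - f x - (y - x) * deriv f x\<bar> \<le> c * \<bar>y - x\<bar>"
      by metis
    define \<gamma> where "\<gamma> x = (if x \<in> S then H else ball x (if x \<in> {a..b} then d x else 1))" for x
    show "\<exists>\<gamma>. gauge \<gamma> \<and> (\<forall>\<D>. \<D> tagged_division_of (cbox a b) \<and> \<gamma> fine \<D> \<longrightarrow>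
       norm ((\<Sum>(x,k)\<in>\<D>. measure lborel k *\<^sub>R f' x) - (f b - f a)) < e)"
    proof (intro exI conjI allI impI)
      show "gauge \<gamma>" unfolding gauge_def \<gamma>_def using H d(1) by auto
      fix p assume p: "p tagged_division_of (cbox a b) \<and> \<gamma> fine p"
      then have pt: "p tagged_division_of {a..b}" and fine: "\<gamma> fine p" by auto
      note pD = tagged_division_ofD[OF pt]
      define err where "err = (\<lambda>(x::real,K). \<bar>(f (Sup K) - f (Inf K)) - measure lborel K *\<^sub>R f' x\<bar>)"
      have form: "\<exists>u v. u \<le> v \<and> K = {u..v} \<and> u \<le> x \<and> x \<le> v \<and> a \<le> u \<and> v \<le> b" if xK: "(x,K) \<in> p" for x K
      proof -
        obtain u v where "K = {u..v}" using pD(4)[OF xK] by auto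
        then have "u \<le> v \<and> K = {u..v} \<and> u \<le> x \<and> x \<le> v \<and> a \<le> u \<and> v \<le> b"
          using pD(2,3)[OF xK] by auto
        then show ?thesis by blast
      qed
      define pS where "pS = {xK\<in>p. fst xK \<in> S}"
      define pN where "pN = {xK\<in>p. fst xK \<notin> S}"
      have fin: "finite p" "finite pS" "finite pN" using pD(1) by (auto simp: pS_def pN_def)
      have "sum err pN \<le> (\<Sum>(x,K)\<in>pN. 2 * c * measure lborel K)"
      proof (rule sum_mono, clarify)
        fix x K assume xK: "(x,K) \<in> pN"
        then have "(x,K) \<in> p" "x \<notin> S" by (auto simp: pN_def)
        obtain u v where uv: "u \<le> v" "K = {u..v}" "u \<le> x" "x \<le> v" "a \<le> u" "v \<le> b" using form[OF \<open>(x,K) \<in> p\<close>] by blast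
        have x: "x \<in> {a..b} - S" using uv \<open>x \<notin> S\<close> by auto
        have "K \<subseteq> ball x (d x)" using fineD[OF fine \<open>(x,K) \<in> p\<close>] x by (auto simp: \<gamma>_def)
        then have "u \<in> ball x (d x)" "v \<in> ball x (d x)" using uv by (auto simp del: mem_ball)
        then have "\<bar>u - x\<bar> < d x" "\<bar>v - x\<bar> < d x" by (auto simp: dist_real_def)
        then have 1: "\<bar>f u - f x - (u - x) * deriv f x\<bar> \<le> c * \<bar>u - x\<bar>" "\<bar>f v - f x - (v - x) * deriv f x\<bar> \<le> c * \<bar>v - x\<bar>"
          using d(2)[OF x] by auto
        have "f v - f u - (v - u) * deriv f x = (f v - f x - (v - x) * deriv f x) - (f u - f x - (u - x) * deriv f x)"
          by (simp add: algebra_simps)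
        then have "\<bar>f v - f u - (v - u) * deriv f x\<bar> \<le> c * \<bar>u - x\<bar> + c * \<bar>v - x\<bar>" using 1 by linarith
        also have "\<dots> \<le> c * (v - u) + c * (v - u)" using uv c0 by (intro add_mono mult_left_mono) auto
        finally show "err (x,K) \<le> 2 * c * measure lborel K" using uv x by (simp add: err_def f'_def)
      qed
      also have "\<dots> \<le> (\<Sum>(x,K)\<in>p. 2 * c * measure lborel K)"
        using fin c0 by (intro sum_mono2) (auto simp: pN_def)
      also have "\<dots> = 2 * c * (\<Sum>(x,K)\<in>p. measure lborel K)" by (simp add: sum_distrib_left case_prod_unfold)
      also have "(\<Sum>(x,K)\<in>p. measure lborel K) = b - a"
        using additive_content_tagged_division[of p a b] pt ab by simp
      also have "2 * c * (b - a) < e / 2" using e ab by (simp add: c_def field_simps)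
      finally have N: "sum err pN < e / 2" .
      have inj: "inj_on snd pS"
      proof (rule inj_onI, rule ccontr)
        fix y z assume yz: "y \<in> pS" "z \<in> pS" "snd y = snd z" "y \<noteq> z"
        obtain x K where y: "y = (x,K)" by (cases y)
        obtain x' where z: "z = (x',K)" using yz y by (cases z) auto
        have yp: "(x,K) \<in> p" "(x',K) \<in> p" using yz y z by (auto simp: pS_def)
        have "interior K = {}" using pD(5)[OF yp] yz(4) y z by auto
        moreover obtain u v where "u \<le> v" "K = {u..v}" "u \<le> x" "x \<le> v" using form[OF yp(1)] by blast
        moreover have "x' \<in> K" using pD(2)[OF yp(2)] .
        ultimately have "x = x'" by auto
        then show False using yz(4) y z by simp
      qed
      define D where "D = snd ` pS"
      have DK: "\<exists>x\<in>S. (x,K) \<in> p" if "K \<in> D" for K using that by (auto simp: D_def pS_def)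
      have Ddiv: "D division_of \<Union>D"
      proof (rule division_of_Union_intervalsI)
        show "finite D" using fin by (simp add: D_def)
        show "\<exists>u v. u \<le> v \<and> K = {u..v}" if "K \<in> D" for K using DK[OF that] form by blast
        show "interior K \<inter> interior K' = {}" if "K \<in> D" "K' \<in> D" "K \<noteq> K'" for K K'
          using DK[OF that(1)] DK[OF that(2)] pD(5) that(3) by blast
      qed
      have "(\<Sum>K\<in>D. Sup K - Inf K) = measure lebesgue (\<Union>D)"
        using measure_Union_division(1)[OF Ddiv] by simp
      also have "\<dots> \<le> measure lebesgue H"
      proof (rule measure_mono_fmeasurable)
        show "\<Union>D \<subseteq> H"
        proof (rule Union_least)
          fix K assume "K \<in> D"
          then obtain x where x: "x \<in> S" "(x,K) \<in> p" using DK by blast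
          then show "K \<subseteq> H" using fineD[OF fine x(2)] by (auto simp: \<gamma>_def)
        qed
        show "\<Union>D \<in> sets lebesgue" using measure_Union_division(2)[OF Ddiv] by auto
      qed (use H in auto)
      finally have small: "(\<Sum>K\<in>D. Sup K - Inf K) < \<delta>" using H by linarith
      have Dab: "\<Union>D \<subseteq> {a..b}" using DK pD(3) by blast
      have "sum err pS = (\<Sum>(x,K)\<in>pS. \<bar>f (Sup K) - f (Inf K)\<bar>)"
        by (rule sum.cong) (auto simp: err_def f'_def pS_def)
      also have "\<dots> = (\<Sum>K\<in>D. \<bar>f (Sup K) - f (Inf K)\<bar>)"
        unfolding D_def by (subst sum.reindex[OF inj]) (simp add: case_prod_unfold)
      also have "\<dots> < e / 2" using AC\<delta>[rule_format, of D] Ddiv Dab small by simp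
      finally have Sm: "sum err pS < e / 2" .
      have "p = pS \<union> pN" "pS \<inter> pN = {}" by (auto simp: pS_def pN_def)
      then have "sum err p < e" using sum.union_disjoint[OF fin(2,3), of err] N Sm by simp
      have "(\<Sum>(x,k)\<in>p. measure lborel k *\<^sub>R f' x) - (f b - f a)
         = - (\<Sum>(x,K)\<in>p. (f (Sup K) - f (Inf K)) - measure lborel K *\<^sub>R f' x)"
        using additive_tagged_division_1[OF ab pt, of f]
        by (simp add: case_prod_unfold sum_subtractf)
      also have "norm \<dots> \<le> (\<Sum>xK\<in>p. norm (case xK of (x,K) \<Rightarrow> (f (Sup K) - f (Inf K)) - measure lborel K *\<^sub>R f' x))"
        unfolding norm_minus_cancel by (rule norm_sum)
      also have "\<dots> = sum err p" by (rule sum.cong) (auto simp: err_def)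
      also note \<open>sum err p < e\<close>
      finally show "norm ((\<Sum>(x,k)\<in>p. measure lborel k *\<^sub>R f' x) - (f b - f a)) < e" .
    qed
  qed
  then have "(f' has_integral f b - f a) {a..b}" by simp
  then show ?thesis
    by (rule has_integral_spike[OF S, rotated]) (auto simp: f'_def)
qed

section \<open>Divisions with vanishing mesh\<close>

lemma division_nonempty_IccE:
  assumes "D division_of {a..b::real}" "K \<in> D"
  obtains "Inf K \<le> Sup K" "K = {Inf K..Sup K}" "a \<le> Inf K" "Sup K \<le> b"
proof -
  obtain u v where "u \<le> v" "K = {u..v}" "a \<le> u" "v \<le> b" using division_of_IccD[OF assms] .
  then show thesis using that by simp
qed

text \<open>
  A point cuts at most one interval of a division. Hence truncating the summands of a Follmer sum at
  a time \<open>c\<close> alters a single summand, which tends to zero with the mesh.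
\<close>

lemma division_straddle_unique:
  assumes D: "D division_of {a..b::real}" and "K \<in> D" "K' \<in> D"
    and "Inf K \<le> c" "c < Sup K" "Inf K' \<le> c" "c < Sup K'"
  shows "K = K'"
proof (rule ccontr)
  assume "K \<noteq> K'"
  then have disj: "interior K \<inter> interior K' = {}" using division_ofD(5)[OF D assms(2,3)] by simp
  have K: "K = {Inf K..Sup K}" "K' = {Inf K'..Sup K'}"
    using division_nonempty_IccE[OF D assms(2)] division_nonempty_IccE[OF D assms(3)] by metis+
  have "interior K = {Inf K<..<Sup K}" "interior K' = {Inf K'<..<Sup K'}"
    using K interior_atLeastAtMost_real by metis+
  moreover obtain x where "c < x" "x < min (Sup K) (Sup K')" using dense[of c "min (Sup K) (Sup K')"] assms by auto
  ultimately have "x \<in> interior K \<inter> interior K'" using assms by auto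
  with disj show False by simp
qed

lemma sum_division_straddle_le:
  assumes D: "D division_of {a..b::real}" and "0 \<le> B"
    and zero: "\<And>K. K \<in> D \<Longrightarrow> \<not> (Inf K \<le> c \<and> c < Sup K) \<Longrightarrow> g K = 0"
    and bd: "\<And>K. K \<in> D \<Longrightarrow> Inf K \<le> c \<Longrightarrow> c < Sup K \<Longrightarrow> \<bar>g K\<bar> \<le> B"
  shows "\<bar>sum g D\<bar> \<le> (B::real)"
proof (cases "\<exists>K\<in>D. Inf K \<le> c \<and> c < Sup K")
  case True
  then obtain K where K: "K \<in> D" "Inf K \<le> c" "c < Sup K" by blast
  have "sum g D = sum g {K}"
  proof (rule sum.mono_neutral_right)
    show "finite D" using division_ofD(1)[OF D] .
    show "\<forall>i\<in>D - {K}. g i = 0" using zero division_straddle_unique[OF D K(1) _ K(2,3)] by blast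
  qed (use K in auto)
  then show ?thesis using bd[OF K] by simp
next
  case False
  then have "sum g D = 0" using zero by (intro sum.neutral) blast
  then show ?thesis using \<open>0 \<le> B\<close> by simp
qed

definition vanishing_mesh :: "(nat \<Rightarrow> real set set) \<Rightarrow> bool" where
  "vanishing_mesh D \<longleftrightarrow> (\<forall>\<delta>>0. \<forall>\<^sub>F n in sequentially. \<forall>K\<in>D n. Sup K - Inf K < \<delta>)"

lemma partition_sequence_vanishing_mesh:
  assumes "partition_sequence T \<pi>"
  shows "vanishing_mesh \<pi>"
  unfolding vanishing_mesh_def
proof (intro allI impI)
  fix \<delta> :: real assume "\<delta> > 0"
  have div: "\<pi> n division_of {0..T}" for n using assms by (simp add: partition_sequence_def)
  have "\<forall>\<^sub>F n in sequentially. Max ((\<lambda>K. Sup K - Inf K) ` \<pi> n) < \<delta>"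
    using assms \<open>\<delta> > 0\<close> unfolding partition_sequence_def by (blast dest: order_tendstoD(2))
  then show "\<forall>\<^sub>F n in sequentially. \<forall>K\<in>\<pi> n. Sup K - Inf K < \<delta>"
  proof eventually_elim
    case (elim n)
    have "finite (\<pi> n)" using division_ofD(1)[OF div] .
    then have "Sup K - Inf K \<le> Max ((\<lambda>K. Sup K - Inf K) ` \<pi> n)" if "K \<in> \<pi> n" for K
      using that by (intro Max_ge) auto
    then show ?case using elim by fastforce
  qed
qed

lemma null_sequenceI:
  fixes f :: "nat \<Rightarrow> real"
  assumes "\<And>e. 0 < e \<Longrightarrow> \<forall>\<^sub>F n in sequentially. \<bar>f n\<bar> < e"
  shows "f \<longlonglongrightarrow> 0"
  using assms by (simp add: tendsto_iff dist_real_def)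

lemma vanishing_oscillation:
  fixes f :: "real \<Rightarrow> 'a::metric_space"
  assumes div: "\<And>n. D n division_of {a..b}" and mesh: "vanishing_mesh D"
    and cont: "continuous_on {a..b} f" and "\<epsilon> > 0"
  shows "\<forall>\<^sub>F n in sequentially. \<forall>K\<in>D n. \<forall>u\<in>K. \<forall>v\<in>K. dist (f u) (f v) < \<epsilon>"
proof -
  have "uniformly_continuous_on {a..b} f" using cont compact_uniformly_continuous by blast
  then obtain \<delta> where \<delta>: "\<delta> > 0" "\<And>u v. u \<in> {a..b} \<Longrightarrow> v \<in> {a..b} \<Longrightarrow> dist v u < \<delta> \<Longrightarrow> dist (f v) (f u) < \<epsilon>"
    using \<open>\<epsilon> > 0\<close> unfolding uniformly_continuous_on_def by metis
  have "\<forall>\<^sub>F n in sequentially. \<forall>K\<in>D n. Sup K - Inf K < \<delta>"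
    using mesh \<delta>(1) by (simp add: vanishing_mesh_def)
  then show ?thesis
  proof (eventually_elim, intro ballI)
    fix n K u v assume n: "\<forall>K\<in>D n. Sup K - Inf K < \<delta>" and K: "K \<in> D n" "u \<in> K" "v \<in> K"
    obtain "K = {Inf K..Sup K}" "a \<le> Inf K" "Sup K \<le> b" using division_nonempty_IccE[OF div K(1)] .
    then have "Inf K \<le> u" "u \<le> Sup K" "Inf K \<le> v" "v \<le> Sup K" "a \<le> Inf K" "Sup K \<le> b"
      using K by (metis atLeastAtMost_iff)+
    moreover have "Sup K - Inf K < \<delta>" using n K by blast
    ultimately have "u \<in> {a..b}" "v \<in> {a..b}" "dist u v < \<delta>" by (auto simp: dist_real_def)
    then show "dist (f u) (f v) < \<epsilon>" using \<delta>(2) by blast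
  qed
qed

section \<open>Time reversal of partitions and brackets\<close>

lemma sum_reverse_partition:
  assumes D: "D division_of {0..T}"
  shows "(\<Sum>K\<in>reverse_partition t D. h (Inf K) (Sup K)) =
    (\<Sum>K\<in>{K\<in>D. Inf K < t}. h (t - min (Sup K) t) (t - Inf K))"
proof -
  have le: "Inf K \<le> Sup K" if "K \<in> D" for K using division_nonempty_IccE[OF D that] .
  have "inj_on (\<lambda>K. {t - min (Sup K) t .. t - Inf K}) {K\<in>D. Inf K < t}"
  proof (rule inj_onI)
    fix K K' assume K: "K \<in> {K\<in>D. Inf K < t}" "K' \<in> {K\<in>D. Inf K < t}"
      and eq: "{t - min (Sup K) t..t - Inf K} = {t - min (Sup K') t..t - Inf K'}"
    have "Inf K \<le> min (Sup K) t" using K le by auto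
    then have "t - min (Sup K) t \<le> t - Inf K" by simp
    then have e: "Inf K = Inf K'" "min (Sup K) t = min (Sup K') t" using eq by (auto simp: Icc_eq_Icc)
    show "K = K'"
    proof (cases "Sup K = Sup K'")
      case True
      have "K = {Inf K..Sup K}" "K' = {Inf K'..Sup K'}"
        using K division_nonempty_IccE[OF D] by blast+
      then show ?thesis using e True by metis
    next
      case False
      then have "t \<le> Sup K" "t \<le> Sup K'" using e(2) by (auto simp: min_def split: if_splits)
      then show ?thesis using division_straddle_unique[OF D, of K K' "Inf K"] K e(1) by auto
    qed
  qed
  moreover have "t - min (Sup K) t \<le> t - Inf K" if "K \<in> D" "Inf K < t" for K using that le[OF that(1)] by auto
  ultimately show ?thesis unfolding reverse_partition_def by (subst sum.reindex) (auto intro!: sum.cong)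
qed

text \<open>
  The point \<open>0\<close> of \<open>[0, t]\<close> is covered because a finite union of closed intervals that contains
  \<open>(0, t]\<close> is closed. For \<open>t = 0\<close> the reverse partition is empty, hence the assumption \<open>0 < t\<close>.
\<close>

lemma reverse_partition_division:
  assumes D: "D division_of {0..T}" and t: "0 < t" "t \<le> T"
  shows "reverse_partition t D division_of {0..t}"
proof -
  define R where "R = reverse_partition t D"
  have Dform: "Inf K \<le> Sup K \<and> K = {Inf K..Sup K} \<and> 0 \<le> Inf K \<and> Sup K \<le> T" if "K \<in> D" for K
    using division_nonempty_IccE[OF D that] by metis
  have finD: "finite D" using division_ofD(1)[OF D] .
  have RE: "\<exists>K\<in>D. Inf K < t \<and> J = {t - min (Sup K) t .. t - Inf K}" if "J \<in> R" for J
    using that by (auto simp: R_def reverse_partition_def)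
  have RJ: "\<exists>u v. u \<le> v \<and> J = {u..v}" if "J \<in> R" for J
  proof -
    obtain K where K: "K \<in> D" "Inf K < t" "J = {t - min (Sup K) t .. t - Inf K}" using RE[OF \<open>J \<in> R\<close>] by blast
    then have "t - min (Sup K) t \<le> t - Inf K" using Dform[OF K(1)] by auto
    then show ?thesis using K(3) by blast
  qed
  have finR: "finite R" using finD by (simp add: R_def reverse_partition_def)
  have "R division_of \<Union>R"
  proof (rule division_of_Union_intervalsI[OF finR RJ])
    fix J J' assume J: "J \<in> R" "J' \<in> R" "J \<noteq> J'"
    obtain K where K: "K \<in> D" "Inf K < t" "J = {t - min (Sup K) t .. t - Inf K}" using RE[OF J(1)] by blast
    obtain K' where K': "K' \<in> D" "Inf K' < t" "J' = {t - min (Sup K') t .. t - Inf K'}" using RE[OF J(2)] by blast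
    have int: "interior K \<inter> interior K' = {}" using division_ofD(5)[OF D K(1) K'(1)] J(3) K(3) K'(3) by blast
    have ik: "interior K = {Inf K<..<Sup K}" "interior K' = {Inf K'<..<Sup K'}"
      using Dform[OF K(1)] Dform[OF K'(1)] interior_atLeastAtMost_real by metis+
    show "interior J \<inter> interior J' = {}"
    proof (rule ccontr)
      assume "interior J \<inter> interior J' \<noteq> {}"
      then obtain x where x: "x \<in> {t - min (Sup K) t <..< t - Inf K}" "x \<in> {t - min (Sup K') t <..< t - Inf K'}"
        using K(3) K'(3) interior_atLeastAtMost_real by blast
      then have "t - x \<in> interior K \<inter> interior K'" unfolding ik by auto
      then show False using int by blast
    qed
  qed
  moreover have "\<Union>R = {0..t}"
  proof
    show "\<Union>R \<subseteq> {0..t}" using RE Dform by fastforce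
    have "{0<..t} \<subseteq> \<Union>R"
    proof
      fix s assume s: "s \<in> {0<..t}"
      then have "t - s \<in> \<Union>D" using division_ofD(6)[OF D] t by auto
      then obtain K where K: "K \<in> D" "t - s \<in> K" by blast
      then have k: "Inf K \<le> t - s" "t - s \<le> Sup K" using Dform[OF K(1)] by (metis atLeastAtMost_iff)+
      then have "s \<in> {t - min (Sup K) t .. t - Inf K}" "Inf K < t" using s by auto
      then show "s \<in> \<Union>R" using K(1) unfolding R_def reverse_partition_def by blast
    qed
    moreover have "closed (\<Union>R)" using finR RJ by (intro closed_Union) auto
    ultimately have "closure {0<..t} \<subseteq> \<Union>R" by (rule closure_minimal)
    then show "{0..t} \<subseteq> \<Union>R" using t by simp
  qed
  ultimately show ?thesis by (simp add: R_def)
qed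

lemma reverse_partition_mesh:
  assumes "\<And>n. D n division_of {0..T}" "vanishing_mesh D"
  shows "vanishing_mesh (\<lambda>n. reverse_partition t (D n))"
  unfolding vanishing_mesh_def
proof (intro allI impI)
  fix \<delta> :: real assume "\<delta> > 0"
  then have "\<forall>\<^sub>F n in sequentially. \<forall>K\<in>D n. Sup K - Inf K < \<delta>" using assms(2) by (simp add: vanishing_mesh_def)
  then show "\<forall>\<^sub>F n in sequentially. \<forall>K\<in>reverse_partition t (D n). Sup K - Inf K < \<delta>"
  proof (eventually_elim, intro ballI)
    fix n J assume n: "\<forall>K\<in>D n. Sup K - Inf K < \<delta>" and "J \<in> reverse_partition t (D n)"
    then obtain K where K: "K \<in> D n" "Inf K < t" "J = {t - min (Sup K) t .. t - Inf K}"
      by (auto simp: reverse_partition_def)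
    have "Inf K \<le> Sup K" using division_nonempty_IccE[OF assms(1) K(1)] .
    then have "Sup J - Inf J \<le> Sup K - Inf K" using K by (subst K(3), subst K(3)) simp
    also have "\<dots> < \<delta>" using n K by blast
    finally show "Sup J - Inf J < \<delta>" .
  qed
qed

text \<open>
  Reversing time turns the sums of squares over \<open>[t - s, t]\<close> into those over \<open>[0, s]\<close>. The interval
  cut by \<open>t - s\<close> is the only one on which the two sums differ.
\<close>

lemma reverse_path_qsum_tendsto:
  assumes div: "\<And>n. D n division_of {0..T}" and mesh: "vanishing_mesh D"
    and cont: "continuous_on {0..T} U"
    and conv: "\<And>s. s \<in> {0..T} \<Longrightarrow> (\<lambda>n. follmer_qsum (D n) U s) \<longlonglongrightarrow> Q s"
    and t: "t \<in> {0..T}" and s: "s \<in> {0..t}"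
  shows "(\<lambda>n. follmer_qsum (reverse_partition t (D n)) (reverse_path t U) s) \<longlonglongrightarrow> Q t - Q (t - s)"
proof -
  define c where "c = t - s"
  have c: "0 \<le> c" "c \<le> t" "t \<le> T" using s t by (auto simp: c_def)
  let ?V = "\<lambda>x. U (max (min x t) c)"
  define g where "g K = (?V (Sup K) - ?V (Inf K))\<^sup>2
      - (U (min (Sup K) t) - U (min (Inf K) t))\<^sup>2 + (U (min (Sup K) c) - U (min (Inf K) c))\<^sup>2" for K
  have eq: "follmer_qsum (reverse_partition t (D n)) (reverse_path t U) s
     = follmer_qsum (D n) U t - follmer_qsum (D n) U c + sum g (D n)" for n
  proof -
    have fin: "finite (D n)" using division_ofD(1)[OF div] .
    have "follmer_qsum (reverse_partition t (D n)) (reverse_path t U) s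
      = (\<Sum>K\<in>{K\<in>D n. Inf K < t}. (reverse_path t U (min (t - Inf K) s) - reverse_path t U (min (t - min (Sup K) t) s))\<^sup>2)"
      unfolding follmer_qsum_def by (rule sum_reverse_partition[OF div])
    also have "\<dots> = (\<Sum>K\<in>{K\<in>D n. Inf K < t}. (?V (Sup K) - ?V (Inf K))\<^sup>2)"
    proof (rule sum.cong)
      fix K assume K: "K \<in> {K\<in>D n. Inf K < t}"
      have "t - min (t - Inf K) s = max (min (Inf K) t) c" "t - min (t - min (Sup K) t) s = max (min (Sup K) t) c"
        using K by (auto simp: c_def)
      then show "(reverse_path t U (min (t - Inf K) s) - reverse_path t U (min (t - min (Sup K) t) s))\<^sup>2 =
         (?V (Sup K) - ?V (Inf K))\<^sup>2" by (simp add: reverse_path_def)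
    qed simp
    also have "\<dots> = (\<Sum>K\<in>D n. (?V (Sup K) - ?V (Inf K))\<^sup>2)"
    proof (rule sum.mono_neutral_left[OF fin])
      show "\<forall>K\<in>D n - {K \<in> D n. Inf K < t}. (?V (Sup K) - ?V (Inf K))\<^sup>2 = 0"
      proof
        fix K assume K: "K \<in> D n - {K \<in> D n. Inf K < t}"
        then have "Inf K \<le> Sup K" using division_nonempty_IccE[OF div] by blast
        then have "min (Sup K) t = t" "min (Inf K) t = t" using K by auto
        then show "(?V (Sup K) - ?V (Inf K))\<^sup>2 = 0" by simp
      qed
    qed auto
    finally show ?thesis
      by (simp add: follmer_qsum_def g_def sum.distrib sum_subtractf)
  qed
  have "(\<lambda>n. sum g (D n)) \<longlonglongrightarrow> 0"
  proof (rule null_sequenceI)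
    fix e :: real assume e: "e > 0"
    define \<eta> where "\<eta> = min 1 (e / 4)"
    have \<eta>: "0 < \<eta>" "\<eta> \<le> 1" "\<eta> \<le> e / 4" using e by (auto simp: \<eta>_def)
    show "\<forall>\<^sub>F n in sequentially. \<bar>sum g (D n)\<bar> < e"
      using vanishing_oscillation[OF div mesh cont \<eta>(1)]
    proof eventually_elim
      case (elim n)
      have "\<bar>sum g (D n)\<bar> \<le> 3 * \<eta>"
      proof (rule sum_division_straddle_le[OF div, where c=c])
        fix K assume K: "K \<in> D n" "\<not> (Inf K \<le> c \<and> c < Sup K)"
        have "Inf K \<le> Sup K" using division_nonempty_IccE[OF div K(1)] .
        then consider "c < Inf K" "c < Sup K" | "Sup K \<le> c" "Inf K \<le> c" using K by linarith
        then show "g K = 0"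
        proof cases
          case 1
          then have "max (min (Sup K) t) c = min (Sup K) t" "max (min (Inf K) t) c = min (Inf K) t"
             "min (Sup K) c = c" "min (Inf K) c = c" using c by auto
          then show ?thesis by (simp add: g_def)
        next
          case 2
          then have "max (min (Sup K) t) c = c" "max (min (Inf K) t) c = c"
             "min (Sup K) c = Sup K" "min (Inf K) c = Inf K" "min (Sup K) t = Sup K" "min (Inf K) t = Inf K" using c by auto
          then show ?thesis by (simp add: g_def)
        qed
      next
        fix K assume K: "K \<in> D n" "Inf K \<le> c" "c < Sup K"
        obtain KI: "K = {Inf K..Sup K}" using division_nonempty_IccE[OF div K(1)] .
        have inK: "x \<in> K" if "Inf K \<le> x" "x \<le> Sup K" for x using that by (subst KI) simp
        have sq: "(U x - U y)\<^sup>2 \<le> \<eta>" if "x \<in> K" "y \<in> K" for x y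
        proof -
          have "\<bar>U x - U y\<bar> < \<eta>" using elim K(1) that by (force simp: dist_real_def)
          then have "(U x - U y)\<^sup>2 \<le> \<eta>\<^sup>2" using power_mono[of "\<bar>U x - U y\<bar>" \<eta> 2] by simp
          also have "\<dots> \<le> \<eta>" using \<eta> by (simp add: power2_eq_square mult_left_le)
          finally show ?thesis .
        qed
        have bound: "\<bar>p - q + r\<bar> \<le> 3 * \<eta>"
          if "0 \<le> p" "p \<le> \<eta>" "0 \<le> q" "q \<le> \<eta>" "0 \<le> r" "r \<le> \<eta>" for p q r
          using that by linarith
        show "\<bar>g K\<bar> \<le> 3 * \<eta>" unfolding g_def
          by (intro bound zero_le_power2 sq inK) (use K c in auto)
      qed (use \<eta> in simp)
      then show ?case using \<eta> by linarith
    qed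
  qed
  then have "(\<lambda>n. follmer_qsum (D n) U t - follmer_qsum (D n) U c + sum g (D n)) \<longlonglongrightarrow> Q t - Q c + 0"
    using c by (intro tendsto_intros conv) auto
  then show ?thesis unfolding eq c_def by simp
qed

text \<open>
  Subtracting a continuous path of bounded variation does not change the bracket: the cross terms are
  bounded by the oscillation on the partition intervals times the variation \<open>V s - V 0\<close>.
\<close>

lemma qsum_perturb_bounded_variation:
  assumes div: "\<And>n. D n division_of {0..t}" and mesh: "vanishing_mesh D"
    and contX: "continuous_on {0..t} X" and contA: "continuous_on {0..t} A"
    and V: "\<And>u v. 0 \<le> u \<Longrightarrow> u \<le> v \<Longrightarrow> v \<le> t \<Longrightarrow> \<bar>A v - A u\<bar> \<le> V v - V u"
    and s: "s \<in> {0..t}"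
    and conv: "(\<lambda>n. follmer_qsum (D n) X s) \<longlonglongrightarrow> q"
  shows "(\<lambda>n. follmer_qsum (D n) (\<lambda>r. X r - A r) s) \<longlonglongrightarrow> q"
proof -
  have "(\<lambda>n. follmer_qsum (D n) (\<lambda>r. X r - A r) s - follmer_qsum (D n) X s) \<longlonglongrightarrow> 0"
  proof (rule null_sequenceI)
    fix e :: real assume e: "e > 0"
    have V0: "0 \<le> V s - V 0" using V[of 0 s] s by auto
    define \<eta> where "\<eta> = e / (3 * (V s - V 0 + 1))"
    have \<eta>: "0 < \<eta>" "3 * \<eta> * (V s - V 0) < e" using e V0 by (auto simp: \<eta>_def field_simps)
    show "\<forall>\<^sub>F n in sequentially. \<bar>follmer_qsum (D n) (\<lambda>r. X r - A r) s - follmer_qsum (D n) X s\<bar> < e"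
      using vanishing_oscillation[OF div mesh contX \<eta>(1)] vanishing_oscillation[OF div mesh contA \<eta>(1)]
    proof eventually_elim
      case (elim n)
      let ?x = "\<lambda>K. X (min (Sup K) s) - X (min (Inf K) s)" and ?a = "\<lambda>K. A (min (Sup K) s) - A (min (Inf K) s)"
      have "\<bar>follmer_qsum (D n) (\<lambda>r. X r - A r) s - follmer_qsum (D n) X s\<bar>
         = \<bar>\<Sum>K\<in>D n. (?x K - ?a K)\<^sup>2 - (?x K)\<^sup>2\<bar>"
        by (simp add: follmer_qsum_def sum_subtractf algebra_simps)
      also have "\<dots> \<le> (\<Sum>K\<in>D n. \<bar>(?x K - ?a K)\<^sup>2 - (?x K)\<^sup>2\<bar>)" by (rule sum_abs)
      also have "\<dots> \<le> (\<Sum>K\<in>D n. 3 * \<eta> * (V (min (Sup K) s) - V (min (Inf K) s)))"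
      proof (rule sum_mono)
        fix K assume K: "K \<in> D n"
        obtain KI: "Inf K \<le> Sup K" "K = {Inf K..Sup K}" "0 \<le> Inf K" "Sup K \<le> t" using division_nonempty_IccE[OF div K] .
        have aV: "\<bar>?a K\<bar> \<le> V (min (Sup K) s) - V (min (Inf K) s)" using KI s by (intro V) auto
        have "\<bar>?x K\<bar> \<le> \<eta> \<and> \<bar>?a K\<bar> \<le> \<eta>"
        proof (cases "Inf K \<le> s")
          case True
          then have "min (Sup K) s \<in> {Inf K..Sup K}" "min (Inf K) s \<in> {Inf K..Sup K}" using KI(1) by auto
          then have "min (Sup K) s \<in> K" "min (Inf K) s \<in> K" using KI(2) by metis+
          then show ?thesis using elim K unfolding dist_real_def by (meson less_imp_le)
        next
          case False
          then have "min (Sup K) s = s" "min (Inf K) s = s" using KI by auto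
          then show ?thesis using \<eta> by simp
        qed
        moreover have "\<bar>q - 2 * p\<bar> \<le> 3 * \<eta>" if "\<bar>p\<bar> \<le> \<eta> \<and> \<bar>q\<bar> \<le> \<eta>" for p q
          using that by linarith
        ultimately have "\<bar>?a K - 2 * ?x K\<bar> \<le> 3 * \<eta>" by blast
        then have "\<bar>?a K\<bar> * \<bar>?a K - 2 * ?x K\<bar> \<le> (V (min (Sup K) s) - V (min (Inf K) s)) * (3 * \<eta>)"
          using aV order_trans[OF abs_ge_zero aV] by (intro mult_mono) auto
        moreover have "(?x K - ?a K)\<^sup>2 - (?x K)\<^sup>2 = ?a K * (?a K - 2 * ?x K)" by (simp add: power2_eq_square algebra_simps)
        ultimately show "\<bar>(?x K - ?a K)\<^sup>2 - (?x K)\<^sup>2\<bar> \<le> 3 * \<eta> * (V (min (Sup K) s) - V (min (Inf K) s))"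
          by (simp only: abs_mult mult.commute)
      qed
      also have "\<dots> = 3 * \<eta> * (V s - V 0)"
        using division_telescope[OF div, of "\<lambda>r. V (min r s)"] s by (simp add: sum_distrib_left[symmetric])
      also have "\<dots> < e" by (rule \<eta>)
      finally show ?case .
    qed
  qed
  from tendsto_add[OF this conv] show ?thesis by simp
qed

section \<open>Cameron--Martin paths\<close>

lemma absolutely_continuous_path_on_subset:
  assumes "absolutely_continuous_path_on S f" "S' \<subseteq> S"
  shows "absolutely_continuous_path_on S' f"
  using assms unfolding absolutely_continuous_path_on_def by (meson subset_trans)

text \<open>
  Connects the norm, defined through the pointwise derivative, with the increments of the path.
\<close>

lemma cameron_martin_increment:
  assumes "A \<in> cameron_martin t" "0 \<le> u" "u \<le> v" "v \<le> t"
  shows "(deriv A has_integral A v - A u) {u..v}"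
proof -
  have "absolutely_continuous_path_on {u..v} A"
    by (rule absolutely_continuous_path_on_subset[of "{0..t}"]) (use assms in \<open>auto simp: cameron_martin_def\<close>)
  then show ?thesis using assms by (intro absolutely_continuous_has_integral_deriv) auto
qed

lemma cameron_martin_deriv_absolutely_integrable:
  assumes A: "A \<in> cameron_martin t" and t: "0 \<le> t"
  shows "deriv A absolutely_integrable_on {0..t}"
proof (rule measurable_bounded_by_integrable_imp_absolutely_integrable)
  have "deriv A integrable_on {0..t}"
    using cameron_martin_increment[OF A order_refl t order_refl] by blast
  then show "deriv A \<in> borel_measurable (lebesgue_on {0..t})" by (rule integrable_imp_measurable)
  have "(\<lambda>s. (deriv A s)\<^sup>2) integrable_on {0..t}"
    using A set_lebesgue_integral_eq_integral(1) unfolding cameron_martin_def by blast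
  then show "(\<lambda>s. 1 + (deriv A s)\<^sup>2) integrable_on {0..t}" by (intro integrable_add) auto
  show "norm (deriv A s) \<le> 1 + (deriv A s)\<^sup>2" for s
  proof (cases "\<bar>deriv A s\<bar> \<le> 1")
    case False
    then have "\<bar>deriv A s\<bar> * 1 \<le> \<bar>deriv A s\<bar> * \<bar>deriv A s\<bar>" by (intro mult_left_mono) auto
    then show ?thesis by (simp add: power2_eq_square)
  qed (simp add: add_increasing2)
qed simp

lemma cameron_martin_variation:
  assumes A: "A \<in> cameron_martin t" and uv: "0 \<le> u" "u \<le> v" "v \<le> t"
  shows "\<bar>A v - A u\<bar> \<le> integral {0..v} (\<lambda>r. \<bar>deriv A r\<bar>) - integral {0..u} (\<lambda>r. \<bar>deriv A r\<bar>)"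
    "integral {u..v} (\<lambda>r. \<bar>deriv A r\<bar>) = integral {0..v} (\<lambda>r. \<bar>deriv A r\<bar>) - integral {0..u} (\<lambda>r. \<bar>deriv A r\<bar>)"
    "(\<lambda>r. \<bar>deriv A r\<bar>) integrable_on {u..v}"
proof -
  have t: "0 \<le> t" using uv by simp
  have "(\<lambda>r. \<bar>deriv A r\<bar>) absolutely_integrable_on {0..t}"
    using absolutely_integrable_norm[OF cameron_martin_deriv_absolutely_integrable[OF A t]] by (simp add: o_def)
  then have int: "(\<lambda>r. \<bar>deriv A r\<bar>) integrable_on {0..t}" using set_lebesgue_integral_eq_integral(1) by blast
  have i: "(\<lambda>r. \<bar>deriv A r\<bar>) integrable_on {a..b}" if "0 \<le> a" "b \<le> t" for a b
    by (rule integrable_on_subinterval[OF int]) (use that in auto)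
  show iuv: "(\<lambda>r. \<bar>deriv A r\<bar>) integrable_on {u..v}" using i uv by simp
  show eq: "integral {u..v} (\<lambda>r. \<bar>deriv A r\<bar>) = integral {0..v} (\<lambda>r. \<bar>deriv A r\<bar>) - integral {0..u} (\<lambda>r. \<bar>deriv A r\<bar>)"
    using Henstock_Kurzweil_Integration.integral_combine[OF uv(1,2) i[of 0 v]] uv by simp
  have "(deriv A has_integral A v - A u) {u..v}" using cameron_martin_increment[OF A uv] .
  then have "deriv A integrable_on {u..v}" "integral {u..v} (deriv A) = A v - A u" by (auto simp: has_integral_iff)
  then have "norm (A v - A u) \<le> integral {u..v} (\<lambda>r. \<bar>deriv A r\<bar>)"
    using integral_norm_bound_integral[of "deriv A" "{u..v}" "\<lambda>r. \<bar>deriv A r\<bar>"] iuv by simp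
  then show "\<bar>A v - A u\<bar> \<le> integral {0..v} (\<lambda>r. \<bar>deriv A r\<bar>) - integral {0..u} (\<lambda>r. \<bar>deriv A r\<bar>)" using eq by simp
qed

lemma cameron_martin_continuous:
  assumes A: "A \<in> cameron_martin t" and t: "0 \<le> t"
  shows "continuous_on {0..t} A"
proof -
  have int: "deriv A integrable_on {0..t}"
    using cameron_martin_increment[OF A order_refl t order_refl] by blast
  have "continuous_on {0..t} (\<lambda>x. A 0 + integral {0..x} (deriv A))"
    by (intro continuous_intros indefinite_integral_continuous_1 int)
  moreover have "A 0 + integral {0..x} (deriv A) = A x" if "x \<in> {0..t}" for x
    using cameron_martin_increment[OF A, of 0 x] that by (simp add: has_integral_iff)
  ultimately show ?thesis by (rule continuous_on_eq)
qed

lemma product_deriv_integrable: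
  assumes A: "A \<in> cameron_martin t" and t: "0 \<le> t" and G: "continuous_on {0..t} G"
  shows "(\<lambda>r. G r * deriv A r) integrable_on {0..t}"
proof -
  have "(\<lambda>r. G r * deriv A r) absolutely_integrable_on {0..t}"
  proof (rule absolutely_integrable_bounded_measurable_product_real)
    show "G \<in> borel_measurable (lebesgue_on {0..t})"
      using G by (intro continuous_imp_measurable_on_sets_lebesgue) auto
    show "bounded (G ` {0..t})" using compact_imp_bounded[OF compact_continuous_image[OF G compact_Icc]] .
    show "deriv A absolutely_integrable_on {0..t}" by (rule cameron_martin_deriv_absolutely_integrable[OF A t])
  qed simp
  then show ?thesis using set_lebesgue_integral_eq_integral(1) by blast
qed

text \<open>
  Against an absolutely continuous path the Follmer integral is an ordinary integral: freezing \<open>G\<close> at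
  the left endpoint costs its oscillation times \<open>\<integral> |A'|\<close>.
\<close>

lemma follmer_sum_cameron_martin:
  assumes A: "A \<in> cameron_martin t" and t: "0 \<le> t" and G: "continuous_on {0..t} G"
    and div: "\<And>n. D n division_of {0..t}" and mesh: "vanishing_mesh D" and s: "s \<in> {0..t}"
  shows "(\<lambda>n. follmer_sum (D n) G A s) \<longlonglongrightarrow> integral {0..s} (\<lambda>r. G r * deriv A r)"
proof -
  define V where "V x = integral {0..x} (\<lambda>r. \<bar>deriv A r\<bar>)" for x
  define H where "H x = integral {0..x} (\<lambda>r. G r * deriv A r)" for x
  have int: "(\<lambda>r. G r * deriv A r) integrable_on {0..t}" by (rule product_deriv_integrable[OF A t G])
  define e where "e K = G (Inf K) * (A (min (Sup K) s) - A (min (Inf K) s)) - (H (min (Sup K) s) - H (min (Inf K) s))" for K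
  have tele: "(\<Sum>K\<in>D n. f (min (Sup K) s) - f (min (Inf K) s)) = f s - f 0" for f :: "real \<Rightarrow> real" and n
    using division_telescope[OF div t, of "\<lambda>r. f (min r s)"] s by simp
  have sum: "follmer_sum (D n) G A s = sum e (D n) + H s" for n
  proof -
    have "sum e (D n) = follmer_sum (D n) G A s - (\<Sum>K\<in>D n. H (min (Sup K) s) - H (min (Inf K) s))"
      unfolding follmer_sum_def e_def by (rule sum_subtractf)
    then show ?thesis unfolding tele by (simp add: H_def)
  qed
  have V0: "0 \<le> V s - V 0" using order_trans[OF abs_ge_zero cameron_martin_variation(1)[OF A, of 0 s]] s by (simp add: V_def)
  have "(\<lambda>n. sum e (D n)) \<longlonglongrightarrow> 0"
  proof (rule null_sequenceI)
    fix \<epsilon> :: real assume \<epsilon>: "0 < \<epsilon>"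
    define \<omega> where "\<omega> = \<epsilon> / (V s - V 0 + 1)"
    have \<omega>: "0 < \<omega>" "\<omega> * (V s - V 0) < \<epsilon>" using \<epsilon> V0 by (auto simp: \<omega>_def field_simps)
    show "\<forall>\<^sub>F n in sequentially. \<bar>sum e (D n)\<bar> < \<epsilon>"
      using vanishing_oscillation[OF div mesh G \<omega>(1)]
    proof eventually_elim
      case (elim n)
      have "\<bar>sum e (D n)\<bar> \<le> (\<Sum>K\<in>D n. \<bar>e K\<bar>)" by (rule sum_abs)
      also have "\<dots> \<le> (\<Sum>K\<in>D n. \<omega> * (V (min (Sup K) s) - V (min (Inf K) s)))"
      proof (rule sum_mono)
        fix K assume K: "K \<in> D n"
        obtain KI: "Inf K \<le> Sup K" "K = {Inf K..Sup K}" "0 \<le> Inf K" "Sup K \<le> t" using division_nonempty_IccE[OF div K] .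
        show "\<bar>e K\<bar> \<le> \<omega> * (V (min (Sup K) s) - V (min (Inf K) s))"
        proof (cases "Inf K \<le> s")
          case False
          then have "min (Sup K) s = s" "min (Inf K) s = s" using KI by auto
          then show ?thesis by (simp add: e_def)
        next
          case True
          define u v where "u = Inf K" and "v = min (Sup K) s"
          have uv: "u \<le> v" "0 \<le> u" "v \<le> t" using True KI by (auto simp: u_def v_def)
          have mu: "min (Inf K) s = u" "min u s = u" using True by (simp_all add: u_def)
          have "{u..v} \<subseteq> {Inf K..Sup K}" by (auto simp: u_def v_def)
          then have inK: "r \<in> K" if "r \<in> {u..v}" for r using that KI(2) by blast
          have i: "(\<lambda>r. G r * deriv A r) integrable_on {a..b}" if "0 \<le> a" "b \<le> t" for a b
            by (rule integrable_on_subinterval[OF int]) (use that in auto)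
          have dA: "(deriv A has_integral A v - A u) {u..v}" using cameron_martin_increment[OF A uv(2,1,3)] .
          have "H u + integral {u..v} (\<lambda>r. G r * deriv A r) = H v"
            unfolding H_def using uv i by (intro Henstock_Kurzweil_Integration.integral_combine) auto
          then have "((\<lambda>r. G r * deriv A r) has_integral H v - H u) {u..v}"
            using integrable_integral[OF i[of u v]] uv by (metis add_diff_cancel_left')
          from has_integral_diff[OF has_integral_mult_right[OF dA, of "G u"] this]
          have d: "((\<lambda>r. G u * deriv A r - G r * deriv A r) has_integral G u * (A v - A u) - (H v - H u)) {u..v}" .
          have ai: "(\<lambda>r. \<bar>deriv A r\<bar>) integrable_on {u..v}" "integral {u..v} (\<lambda>r. \<bar>deriv A r\<bar>) = V v - V u"
            using cameron_martin_variation(2,3)[OF A uv(2,1,3)] by (auto simp: V_def)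
          have "norm (integral {u..v} (\<lambda>r. G u * deriv A r - G r * deriv A r)) \<le> integral {u..v} (\<lambda>r. \<omega> * \<bar>deriv A r\<bar>)"
          proof (rule integral_norm_bound_integral)
            show "(\<lambda>r. G u * deriv A r - G r * deriv A r) integrable_on {u..v}" using d by blast
            show "(\<lambda>r. \<omega> * \<bar>deriv A r\<bar>) integrable_on {u..v}" using ai by (intro integrable_on_mult_right)
            fix r assume "r \<in> {u..v}"
            then have "\<bar>G u - G r\<bar> \<le> \<omega>" using elim K inK[of u] inK[of r] uv by (auto simp: dist_real_def intro!: less_imp_le)
            then have "\<bar>G u - G r\<bar> * \<bar>deriv A r\<bar> \<le> \<omega> * \<bar>deriv A r\<bar>" by (rule mult_right_mono) simp
            then show "norm (G u * deriv A r - G r * deriv A r) \<le> \<omega> * \<bar>deriv A r\<bar>"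
              by (simp add: left_diff_distrib[symmetric] abs_mult)
          qed
          then have "\<bar>G u * (A v - A u) - (H v - H u)\<bar> \<le> \<omega> * (V v - V u)"
            using ai by (simp add: integral_unique[OF d])
          then show ?thesis by (simp add: e_def mu v_def[symmetric] u_def[symmetric])
        qed
      qed
      also have "\<dots> = \<omega> * (V s - V 0)" by (simp only: sum_distrib_left[symmetric] tele)
      finally show ?case using \<omega> by linarith
    qed
  qed
  from tendsto_add[OF this tendsto_const[of "H s"]] show ?thesis by (simp add: sum H_def)
qed

text \<open>
  Complete the square pointwise: \<open>\<epsilon> (G - A' / (2 \<epsilon>))\<^sup>2 \<ge> 0\<close>.
\<close>

lemma cameron_martin_young:
  assumes A: "A \<in> cameron_martin t" and t: "0 \<le> t" and G: "continuous_on {0..t} G" and \<epsilon>: "0 < \<epsilon>"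
  shows "integral {0..t} (\<lambda>r. G r * deriv A r)
    \<le> \<epsilon> * integral {0..t} (\<lambda>r. (G r)\<^sup>2) + 1 / (4 * \<epsilon>) * (cameron_martin_norm t A)\<^sup>2"
proof -
  have a: "(\<lambda>s. (deriv A s)\<^sup>2) absolutely_integrable_on {0..t}" using A unfolding cameron_martin_def by blast
  note ai = set_lebesgue_integral_eq_integral[OF a]
  have G2: "(\<lambda>r. (G r)\<^sup>2) integrable_on {0..t}" by (intro integrable_continuous_real continuous_intros G)
  have norm: "(cameron_martin_norm t A)\<^sup>2 = integral {0..t} (\<lambda>s. (deriv A s)\<^sup>2)"
  proof -
    have "0 \<le> integral {0..t} (\<lambda>s. (deriv A s)\<^sup>2)" using ai(1) by (rule Henstock_Kurzweil_Integration.integral_nonneg) simp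
    then show ?thesis unfolding cameron_martin_norm_def ai(2) by simp
  qed
  have "integral {0..t} (\<lambda>r. G r * deriv A r) \<le> integral {0..t} (\<lambda>r. \<epsilon> * (G r)\<^sup>2 + 1 / (4 * \<epsilon>) * (deriv A r)\<^sup>2)"
  proof (rule integral_le)
    show "(\<lambda>r. \<epsilon> * (G r)\<^sup>2 + 1 / (4 * \<epsilon>) * (deriv A r)\<^sup>2) integrable_on {0..t}"
      using G2 ai(1) by (intro integrable_add integrable_on_mult_right)
    fix r
    have "0 \<le> \<epsilon> * (G r - deriv A r / (2 * \<epsilon>))\<^sup>2" using \<epsilon> by simp
    also have "\<dots> = \<epsilon> * (G r)\<^sup>2 + 1 / (4 * \<epsilon>) * (deriv A r)\<^sup>2 - G r * deriv A r"
      using \<epsilon> by (simp add: power2_eq_square field_simps)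
    finally show "G r * deriv A r \<le> \<epsilon> * (G r)\<^sup>2 + 1 / (4 * \<epsilon>) * (deriv A r)\<^sup>2" by simp
  qed (rule product_deriv_integrable[OF A t G])
  also have "\<dots> = integral {0..t} (\<lambda>r. \<epsilon> * (G r)\<^sup>2) + integral {0..t} (\<lambda>r. 1 / (4 * \<epsilon>) * (deriv A r)\<^sup>2)"
    using G2 ai(1) by (intro Henstock_Kurzweil_Integration.integral_add integrable_on_mult_right)
  also have "\<dots> = \<epsilon> * integral {0..t} (\<lambda>r. (G r)\<^sup>2) + 1 / (4 * \<epsilon>) * integral {0..t} (\<lambda>r. (deriv A r)\<^sup>2)"
    by (simp only: integral_mult_right)
  finally show ?thesis by (simp add: norm)
qed

section \<open>The bracket as a measure\<close>

text \<open>
  The step function that jumps by the increments of \<open>\<phi>\<close> at the left endpoints is written as a combination of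
  indicators of half-lines, because brackets are given by their distribution functions.
\<close>

lemma step_function_approximation:
  assumes D: "D division_of {0..t::real}"
    and osc: "\<forall>K\<in>D. \<forall>u\<in>K. \<forall>v\<in>K. dist (\<phi> u) (\<phi> v) < \<eta>" and "0 < \<eta>" and x: "x \<in> {0..t}"
  shows "\<bar>\<phi> x - (\<phi> t - (\<Sum>K\<in>D. (\<phi> (Sup K) - \<phi> (Inf K)) * indicator {..Inf K} x))\<bar> \<le> (\<eta>::real)"
proof -
  define g where "g K = \<phi> (max (Sup K) x) - \<phi> (max (Inf K) x) - (\<phi> (Sup K) - \<phi> (Inf K)) * indicator {..Inf K} x" for K
  have "(\<Sum>K\<in>D. \<phi> (max (Sup K) x) - \<phi> (max (Inf K) x)) = \<phi> (max t x) - \<phi> (max 0 x)"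
    using division_telescope[OF D, of "\<lambda>y. \<phi> (max y x)"] x by auto
  then have "sum g D = \<phi> t - \<phi> x - (\<Sum>K\<in>D. (\<phi> (Sup K) - \<phi> (Inf K)) * indicator {..Inf K} x)"
    using x by (simp add: g_def sum_subtractf)
  moreover have "\<bar>sum g D\<bar> \<le> \<eta>"
  proof (rule sum_division_straddle_le[OF D, where c=x])
    fix K assume K: "K \<in> D" "\<not> (Inf K \<le> x \<and> x < Sup K)"
    have "Inf K \<le> Sup K" using division_nonempty_IccE[OF D K(1)] .
    then consider "x < Inf K" "x < Sup K" | "Inf K < x" "Sup K \<le> x" | "Inf K = Sup K" using K by linarith
    then show "g K = 0"
    proof cases
      case 1 then show ?thesis by (simp add: g_def max_def)
    next
      case 2 then have "max (Sup K) x = x" "max (Inf K) x = x" by auto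
      then show ?thesis using 2 by (simp add: g_def)
    qed (simp add: g_def)
  next
    fix K assume K: "K \<in> D" "Inf K \<le> x" "x < Sup K"
    obtain KI: "K = {Inf K..Sup K}" using division_nonempty_IccE[OF D K(1)] .
    have inK: "Sup K \<in> K" "x \<in> K" using K by (metis KI atLeastAtMost_iff less_imp_le order.refl order_trans)+
    have mx: "max (Sup K) x = Sup K" "max (Inf K) x = x" using K by auto
    show "\<bar>g K\<bar> \<le> \<eta>"
    proof (cases "Inf K = x")
      case True
      then show ?thesis using mx \<open>0 < \<eta>\<close> by (simp add: g_def)
    next
      case False
      then have "g K = \<phi> (Sup K) - \<phi> x" using mx K by (simp add: g_def)
      then show ?thesis using osc K(1) inK by (metis dist_real_def less_imp_le)
    qed
  qed (use \<open>0 < \<eta>\<close> in simp)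
  ultimately show ?thesis by linarith
qed

context
  fixes F :: "real \<Rightarrow> real" and t :: real
  assumes F_mono: "\<And>x y. x \<le> y \<Longrightarrow> F x \<le> F y" and F_cont: "continuous_on UNIV F"
    and F_0: "F 0 = 0" and t_nonneg: "0 \<le> t"
begin

lemma has_bochner_integral_interval_measure:
  assumes "0 \<le> c"
  shows "has_bochner_integral (interval_measure F) (indicator {0..c}) (F c)"
proof -
  have "emeasure (interval_measure F) {0..c} = F c - F 0"
    by (rule emeasure_interval_measure_Icc) (use assms F_mono F_cont in auto)
  moreover have "0 \<le> F c" using F_mono[OF assms] F_0 by simp
  ultimately have "emeasure (interval_measure F) {0..c} < \<infinity>" "measure (interval_measure F) {0..c} = F c"
    by (simp_all add: F_0 measure_def)
  then show ?thesis
    using has_bochner_integral_real_indicator[of "{0..c}" "interval_measure F"] by simp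
qed

lemma set_integrable_interval_measure:
  fixes \<phi> :: "real \<Rightarrow> real"
  assumes "continuous_on {0..t} \<phi>"
  shows "integrable (interval_measure F) (\<lambda>x. indicator {0..t} x *\<^sub>R \<phi> x)"
proof -
  obtain B where B: "\<forall>x\<in>{0..t}. \<bar>\<phi> x\<bar> \<le> B"
    using compact_imp_bounded[OF compact_continuous_image[OF assms compact_Icc]]
    by (auto simp: bounded_iff)
  show ?thesis
  proof (rule Bochner_Integration.integrable_bound)
    show "integrable (interval_measure F) (\<lambda>x. B * indicator {0..t} x)"
      using has_bochner_integral_interval_measure[OF t_nonneg] by (auto simp: has_bochner_integral_iff)
    have "(\<lambda>x. indicator {0..t} x *\<^sub>R \<phi> x) \<in> borel_measurable borel"
      using assms by (intro borel_measurable_continuous_on_indicator) auto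
    then show "(\<lambda>x. indicator {0..t} x *\<^sub>R \<phi> x) \<in> borel_measurable (interval_measure F)" by simp
    show "AE x in interval_measure F. norm (indicator {0..t} x *\<^sub>R \<phi> x) \<le> norm (B * indicator {0..t} x)"
      using B by (intro AE_I2) (force simp: indicator_def)
  qed
qed

lemma interval_measure_step_error:
  fixes \<phi> :: "real \<Rightarrow> real"
  assumes cont: "continuous_on {0..t} \<phi>" and D: "D division_of {0..t}"
    and osc: "\<forall>K\<in>D. \<forall>u\<in>K. \<forall>v\<in>K. dist (\<phi> u) (\<phi> v) < \<eta>" and "0 < \<eta>"
  shows "\<bar>(LINT x:{0..t}|interval_measure F. \<phi> x) - (\<phi> t * F t - (\<Sum>K\<in>D. (\<phi> (Sup K) - \<phi> (Inf K)) * F (Inf K)))\<bar> \<le> \<eta> * F t"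
proof -
  let ?M = "interval_measure F"
  define h where "h x = \<phi> t * indicator {0..t} x - (\<Sum>K\<in>D. (\<phi> (Sup K) - \<phi> (Inf K)) * indicator {0..Inf K} x)" for x :: real
  define f where "f x = indicator {0..t} x *\<^sub>R \<phi> x" for x
  have DI: "0 \<le> Inf K" "Inf K \<le> t" if "K \<in> D" for K
    using division_nonempty_IccE[OF D that] by (metis, metis order_trans)
  have h: "has_bochner_integral ?M h (\<phi> t * F t - (\<Sum>K\<in>D. (\<phi> (Sup K) - \<phi> (Inf K)) * F (Inf K)))"
    unfolding h_def using DI t_nonneg
    by (intro has_bochner_integral_diff has_bochner_integral_sum has_bochner_integral_mult_right has_bochner_integral_interval_measure)
  have f: "integrable ?M f" unfolding f_def by (rule set_integrable_interval_measure[OF cont])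
  have bd: "\<bar>f x - h x\<bar> \<le> \<eta> * indicator {0..t} x" for x
  proof (cases "x \<in> {0..t}")
    case True
    have "h x = \<phi> t - (\<Sum>K\<in>D. (\<phi> (Sup K) - \<phi> (Inf K)) * indicator {..Inf K} x)"
      using True by (auto simp: h_def indicator_def intro!: sum.cong)
    then show ?thesis using step_function_approximation[OF D osc \<open>0 < \<eta>\<close> True] True by (simp add: f_def)
  next
    case False
    then have "indicator {0..Inf K} x = (0::real)" if "K \<in> D" for K using DI[OF that] by (auto simp: indicator_def)
    then show ?thesis using False by (simp add: f_def h_def)
  qed
  have int: "integrable ?M (\<lambda>x. f x - h x)" "integrable ?M h" using f h by (auto simp: has_bochner_integral_iff)
  have "\<bar>\<integral>x. f x - h x \<partial>?M\<bar> \<le> (\<integral>x. \<bar>f x - h x\<bar> \<partial>?M)" by (rule integral_abs_bound)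
  also have "\<dots> \<le> (\<integral>x. \<eta> * indicator {0..t} x \<partial>?M)"
    using bd int has_bochner_integral_interval_measure[OF t_nonneg]
    by (intro integral_mono) (auto simp: has_bochner_integral_iff)
  also have "\<dots> = \<eta> * F t" using has_bochner_integral_interval_measure[OF t_nonneg] by (simp add: has_bochner_integral_iff)
  finally have "\<bar>(\<integral>x. f x \<partial>?M) - (\<integral>x. h x \<partial>?M)\<bar> \<le> \<eta> * F t"
    using f int by simp
  then show ?thesis using h by (simp add: has_bochner_integral_iff set_lebesgue_integral_def f_def)
qed

text \<open>
  Weak convergence of the discrete measures that put mass \<open>(X (Sup K) - X (Inf K))\<^sup>2\<close> at \<open>Inf K\<close> to the
  Stieltjes measure of the bracket. For indicators of half-lines this is the definition of the
  bracket, up to the one interval that is cut. Continuous functions are uniform limits of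
  combinations of such indicators, and the total masses are bounded.
\<close>

lemma weighted_square_sums_tendsto:
  assumes div: "\<And>n. D n division_of {0..t}" and mesh: "vanishing_mesh D"
    and X: "continuous_on {0..t} X"
    and conv: "\<And>c. c \<in> {0..t} \<Longrightarrow> (\<lambda>n. follmer_qsum (D n) X c) \<longlonglongrightarrow> F c"
    and \<phi>: "continuous_on {0..t} \<phi>"
  shows "(\<lambda>n. \<Sum>K\<in>D n. \<phi> (Inf K) * (X (Sup K) - X (Inf K))\<^sup>2) \<longlonglongrightarrow> (LINT x:{0..t}|interval_measure F. \<phi> x)"
proof -
  define I where "I = (LINT x:{0..t}|interval_measure F. \<phi> x)"
  define S where "S n \<psi> = (\<Sum>K\<in>D n. \<psi> (Inf K) * (X (Sup K) - X (Inf K))\<^sup>2)" for n and \<psi> :: "real \<Rightarrow> real"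
  have DI: "0 \<le> Inf K \<and> Inf K \<le> Sup K \<and> Sup K \<le> t \<and> K = {Inf K..Sup K}" if "K \<in> D n" for K n
    using division_nonempty_IccE[OF div that] by metis
  have Sind: "(\<lambda>n. S n (indicator {..c})) \<longlonglongrightarrow> F c" if c: "c \<in> {0..t}" for c
  proof -
    have "(\<lambda>n. S n (indicator {..c}) - follmer_qsum (D n) X c) \<longlonglongrightarrow> 0"
    proof (rule null_sequenceI)
      fix e :: real assume e: "e > 0"
      define \<eta> where "\<eta> = min 1 (e / 2)"
      have \<eta>: "0 < \<eta>" "\<eta> \<le> 1" "\<eta> < e" using e by (auto simp: \<eta>_def)
      show "\<forall>\<^sub>F n in sequentially. \<bar>S n (indicator {..c}) - follmer_qsum (D n) X c\<bar> < e"
        using vanishing_oscillation[OF div mesh X \<eta>(1)]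
      proof eventually_elim
        case (elim n)
        let ?g = "\<lambda>K. indicator {..c} (Inf K) * (X (Sup K) - X (Inf K))\<^sup>2 - (X (min (Sup K) c) - X (min (Inf K) c))\<^sup>2"
        have "\<bar>sum ?g (D n)\<bar> \<le> \<eta>"
        proof (rule sum_division_straddle_le[OF div, where c=c])
          fix K assume K: "K \<in> D n" "\<not> (Inf K \<le> c \<and> c < Sup K)"
          then consider "c < Inf K" "c < Sup K" | "Sup K \<le> c" "Inf K \<le> c" using DI[OF K(1)] by linarith
          then show "?g K = 0" by cases (auto simp: min_def)
        next
          fix K assume K: "K \<in> D n" "Inf K \<le> c" "c < Sup K"
          have inK: "Sup K \<in> K" "Inf K \<in> K" "c \<in> K"
            using K DI[OF K(1)] by (metis atLeastAtMost_iff less_imp_le order.refl)+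
          have sq: "(X x - X y)\<^sup>2 \<le> \<eta>" if "x \<in> K" "y \<in> K" for x y
          proof -
            have "\<bar>X x - X y\<bar> < \<eta>" using elim K(1) that by (force simp: dist_real_def)
            then have "(X x - X y)\<^sup>2 \<le> \<eta>\<^sup>2" using power_mono[of "\<bar>X x - X y\<bar>" \<eta> 2] by simp
            also have "\<dots> \<le> \<eta>" using \<eta> by (simp add: power2_eq_square mult_left_le)
            finally show ?thesis .
          qed
          have "?g K = (X (Sup K) - X (Inf K))\<^sup>2 - (X c - X (Inf K))\<^sup>2" using K by (simp add: min_def)
          moreover have "\<bar>p - q\<bar> \<le> \<eta>" if "0 \<le> p" "p \<le> \<eta>" "0 \<le> q" "q \<le> \<eta>" for p q using that by linarith
          ultimately show "\<bar>?g K\<bar> \<le> \<eta>" using sq inK by simp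
        qed (use \<eta> in simp)
        then show ?case using \<eta> by (simp add: S_def follmer_qsum_def sum_subtractf)
      qed
    qed
    from tendsto_add[OF this conv[OF c]] show ?thesis by simp
  qed
  have qt: "follmer_qsum (D n) X t = (\<Sum>K\<in>D n. (X (Sup K) - X (Inf K))\<^sup>2)" for n
    unfolding follmer_qsum_def
  proof (rule sum.cong)
    fix K assume "K \<in> D n"
    then have "min (Sup K) t = Sup K" "min (Inf K) t = Inf K" using DI by fastforce+
    then show "(X (min (Sup K) t) - X (min (Inf K) t))\<^sup>2 = (X (Sup K) - X (Inf K))\<^sup>2" by simp
  qed simp
  have Ft: "0 \<le> F t" using F_mono[OF t_nonneg] F_0 by simp
  have "(\<lambda>n. S n \<phi>) \<longlonglongrightarrow> I"
  proof (rule LIMSEQ_I)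
    fix e :: real assume e: "e > 0"
    define \<eta> where "\<eta> = e / (4 * (F t + 1))"
    have "0 < F t + 1" using Ft by simp
    then have \<eta>: "0 < \<eta>" "\<eta> * (F t + 1) = e / 4" using e by (simp add: \<eta>_def, simp add: \<eta>_def divide_simps)
    obtain m where m: "\<forall>K\<in>D m. \<forall>u\<in>K. \<forall>v\<in>K. dist (\<phi> u) (\<phi> v) < \<eta>"
      using vanishing_oscillation[OF div mesh \<phi> \<eta>(1)] by (auto simp: eventually_sequentially)
    define h where "h x = \<phi> t - (\<Sum>K\<in>D m. (\<phi> (Sup K) - \<phi> (Inf K)) * indicator {..Inf K} x)" for x
    define Ih where "Ih = \<phi> t * F t - (\<Sum>K\<in>D m. (\<phi> (Sup K) - \<phi> (Inf K)) * F (Inf K))"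
    let ?T = "\<lambda>J K. (\<phi> (Sup K) - \<phi> (Inf K)) * (indicator {..Inf K} (Inf J) * (X (Sup J) - X (Inf J))\<^sup>2)"
    have Sh: "S n h = \<phi> t * follmer_qsum (D n) X t - (\<Sum>K\<in>D m. (\<phi> (Sup K) - \<phi> (Inf K)) * S n (indicator {..Inf K}))" for n
    proof -
      have "S n h = (\<Sum>J\<in>D n. \<phi> t * (X (Sup J) - X (Inf J))\<^sup>2 - (\<Sum>K\<in>D m. ?T J K))"
        unfolding S_def h_def by (intro sum.cong) (simp_all add: left_diff_distrib sum_distrib_right mult.assoc)
      also have "\<dots> = \<phi> t * follmer_qsum (D n) X t - (\<Sum>J\<in>D n. \<Sum>K\<in>D m. ?T J K)"
        by (simp add: sum_subtractf qt sum_distrib_left)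
      also have "(\<Sum>J\<in>D n. \<Sum>K\<in>D m. ?T J K)
         = (\<Sum>K\<in>D m. \<Sum>J\<in>D n. ?T J K)"
        by (rule sum.swap)
      finally show ?thesis by (simp add: S_def sum_distrib_left)
    qed
    have "(\<lambda>n. S n h) \<longlonglongrightarrow> Ih"
      unfolding Sh Ih_def
    proof (intro tendsto_diff tendsto_sum tendsto_mult tendsto_const)
      show "(\<lambda>n. follmer_qsum (D n) X t) \<longlonglongrightarrow> F t" using t_nonneg by (intro conv) simp
      show "(\<lambda>n. S n (indicator {..Inf K})) \<longlonglongrightarrow> F (Inf K)" if "K \<in> D m" for K
        using DI[OF that] by (intro Sind) auto
    qed
    then have "\<forall>\<^sub>F n in sequentially. dist (S n h) Ih < e / 4" using e by (intro tendstoD) auto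
    moreover have "\<forall>\<^sub>F n in sequentially. follmer_qsum (D n) X t < F t + 1"
      using conv[of t] t_nonneg by (intro order_tendstoD(2)) auto
    ultimately have "\<forall>\<^sub>F n in sequentially. \<bar>S n \<phi> - I\<bar> < e"
    proof eventually_elim
      case (elim n)
      have "\<bar>S n \<phi> - S n h\<bar> = \<bar>\<Sum>K\<in>D n. (\<phi> (Inf K) - h (Inf K)) * (X (Sup K) - X (Inf K))\<^sup>2\<bar>"
        unfolding S_def by (simp add: sum_subtractf left_diff_distrib)
      also have "\<dots> \<le> (\<Sum>K\<in>D n. \<bar>(\<phi> (Inf K) - h (Inf K)) * (X (Sup K) - X (Inf K))\<^sup>2\<bar>)" by (rule sum_abs)
      also have "\<dots> \<le> (\<Sum>K\<in>D n. \<eta> * (X (Sup K) - X (Inf K))\<^sup>2)"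
      proof (rule sum_mono)
        fix K assume "K \<in> D n"
        then have "Inf K \<in> {0..t}" using DI by fastforce
        then have "\<bar>\<phi> (Inf K) - h (Inf K)\<bar> \<le> \<eta>" unfolding h_def
          by (rule step_function_approximation[OF div m \<eta>(1)])
        then show "\<bar>(\<phi> (Inf K) - h (Inf K)) * (X (Sup K) - X (Inf K))\<^sup>2\<bar> \<le> \<eta> * (X (Sup K) - X (Inf K))\<^sup>2"
          by (simp add: abs_mult mult_right_mono)
      qed
      also have "\<dots> = \<eta> * follmer_qsum (D n) X t" by (simp add: qt sum_distrib_left)
      also have "\<dots> \<le> \<eta> * (F t + 1)" using elim \<eta> by (intro mult_left_mono) auto
      finally have "\<bar>S n \<phi> - S n h\<bar> \<le> e / 4" using \<eta> by simp
      moreover have "\<bar>I - Ih\<bar> \<le> \<eta> * F t" unfolding I_def Ih_def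
        by (rule interval_measure_step_error[OF \<phi> div m \<eta>(1)])
      moreover have "\<eta> * F t \<le> e / 4" using \<eta> by (simp add: distrib_left)
      ultimately show ?case using elim(1) e unfolding dist_real_def by linarith
    qed
    then show "\<exists>no. \<forall>n\<ge>no. norm (S n \<phi> - I) < e" by (simp add: eventually_sequentially)
  qed
  then show ?thesis by (simp add: S_def I_def)
qed

text \<open>
  A distribution function with slopes at most \<open>\<kappa>\<close> has a measure below \<open>\<kappa>\<close> times Lebesgue measure. Abel
  summation turns the integral of the approximating step function into the Riemann--Stieltjes sum
  \<open>\<Sum> \<phi> (Sup K) (F (Sup K) - F (Inf K))\<close>, where the slope bound applies term by term.
\<close>

lemma interval_measure_integral_le:
  assumes div: "\<And>n. D n division_of {0..t}" and mesh: "vanishing_mesh D"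
    and \<phi>: "continuous_on {0..t} \<phi>" and pos: "\<And>x. x \<in> {0..t} \<Longrightarrow> 0 \<le> \<phi> x"
    and lip: "\<And>u v. 0 \<le> u \<Longrightarrow> u \<le> v \<Longrightarrow> v \<le> t \<Longrightarrow> F v - F u \<le> \<kappa> * (v - u)" and \<kappa>: "0 \<le> \<kappa>"
  shows "(LINT x:{0..t}|interval_measure F. \<phi> x) \<le> \<kappa> * integral {0..t} \<phi>"
proof (rule field_le_epsilon)
  fix e :: real assume e: "e > 0"
  have Ft: "0 \<le> F t" using F_mono[OF t_nonneg] F_0 by simp
  define \<eta> where "\<eta> = e / (F t + \<kappa> * t + 1)"
  have den: "0 < F t + \<kappa> * t + 1" using Ft \<kappa> t_nonneg by (simp add: add_nonneg_pos)
  have \<eta>: "0 < \<eta>" "\<eta> * (F t + \<kappa> * t + 1) = e" using e den by (auto simp: \<eta>_def)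
  obtain m where m: "\<forall>K\<in>D m. \<forall>u\<in>K. \<forall>v\<in>K. dist (\<phi> u) (\<phi> v) < \<eta>"
    using vanishing_oscillation[OF div mesh \<phi> \<eta>(1)] by (auto simp: eventually_sequentially)
  have DI: "0 \<le> Inf K \<and> Inf K \<le> Sup K \<and> Sup K \<le> t \<and> K = {Inf K..Sup K}" if "K \<in> D m" for K
    using division_nonempty_IccE[OF div that] by metis
  have int: "\<phi> integrable_on {0..t}" using \<phi> by (rule integrable_continuous_real)
  have "(\<Sum>K\<in>D m. \<phi> (Sup K) * F (Sup K) - \<phi> (Inf K) * F (Inf K)) = \<phi> t * F t"
    using division_telescope[OF div t_nonneg, of "\<lambda>x. \<phi> x * F x"] F_0 by simp
  then have "\<phi> t * F t - (\<Sum>K\<in>D m. (\<phi> (Sup K) - \<phi> (Inf K)) * F (Inf K))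
     = (\<Sum>K\<in>D m. (\<phi> (Sup K) * F (Sup K) - \<phi> (Inf K) * F (Inf K)) - (\<phi> (Sup K) - \<phi> (Inf K)) * F (Inf K))"
    by (simp only: sum_subtractf)
  also have "\<dots> = (\<Sum>K\<in>D m. \<phi> (Sup K) * (F (Sup K) - F (Inf K)))"
    by (intro sum.cong) (simp_all add: algebra_simps)
  also have "\<dots> \<le> (\<Sum>K\<in>D m. \<kappa> * (integral K \<phi> + \<eta> * (Sup K - Inf K)))"
  proof (rule sum_mono)
    fix K assume K: "K \<in> D m"
    note k = DI[OF K]
    have const: "((\<lambda>x. c) has_integral c * (v - u)) {u..v}" if "u \<le> v" for c u v :: real
      using has_integral_const_real[of c u v] that by (simp add: mult.commute)
    have "((\<lambda>x. \<phi> (Sup K) - \<eta>) has_integral (\<phi> (Sup K) - \<eta>) * (Sup K - Inf K)) {Inf K..Sup K}"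
      using k by (intro const) auto
    moreover have "(\<phi> has_integral integral {Inf K..Sup K} \<phi>) {Inf K..Sup K}"
    proof (intro integrable_integral integrable_on_subinterval[OF int])
      show "{Inf K..Sup K} \<subseteq> {0..t}" using k by (intro atLeastatMost_subset_iff[THEN iffD2]) blast
    qed
    moreover have "\<phi> (Sup K) - \<eta> \<le> \<phi> x" if x: "x \<in> {Inf K..Sup K}" for x
    proof -
      have "Sup K \<in> K" "x \<in> K" using x k by (metis atLeastAtMost_iff order.refl)+
      then have "\<bar>\<phi> (Sup K) - \<phi> x\<bar> < \<eta>" using m K unfolding dist_real_def by blast
      then show ?thesis by linarith
    qed
    ultimately have "(\<phi> (Sup K) - \<eta>) * (Sup K - Inf K) \<le> integral {Inf K..Sup K} \<phi>"
      by (rule has_integral_le)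
    also have "{Inf K..Sup K} = K" using k by metis
    finally have 1: "\<phi> (Sup K) * (Sup K - Inf K) \<le> integral K \<phi> + \<eta> * (Sup K - Inf K)"
      by (simp add: algebra_simps)
    have "\<phi> (Sup K) * (F (Sup K) - F (Inf K)) \<le> \<phi> (Sup K) * (\<kappa> * (Sup K - Inf K))"
      using k by (intro mult_left_mono lip pos) auto
    also have "\<dots> = \<kappa> * (\<phi> (Sup K) * (Sup K - Inf K))" by simp
    also have "\<dots> \<le> \<kappa> * (integral K \<phi> + \<eta> * (Sup K - Inf K))" using 1 \<kappa> by (rule mult_left_mono)
    finally show "\<phi> (Sup K) * (F (Sup K) - F (Inf K)) \<le> \<kappa> * (integral K \<phi> + \<eta> * (Sup K - Inf K))" .
  qed
  also have "\<dots> = \<kappa> * ((\<Sum>K\<in>D m. integral K \<phi>) + \<eta> * (\<Sum>K\<in>D m. Sup K - Inf K))"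
    by (simp only: sum_distrib_left[symmetric] sum.distrib)
  also have "(\<Sum>K\<in>D m. integral K \<phi>) = integral {0..t} \<phi>"
    using integral_combine_division_topdown[OF int div] by simp
  also have "(\<Sum>K\<in>D m. Sup K - Inf K) = t"
    using division_telescope[OF div t_nonneg, of "\<lambda>x. x"] by simp
  finally have 1: "\<phi> t * F t - (\<Sum>K\<in>D m. (\<phi> (Sup K) - \<phi> (Inf K)) * F (Inf K)) \<le> \<kappa> * (integral {0..t} \<phi> + \<eta> * t)" .
  have "\<bar>(LINT x:{0..t}|interval_measure F. \<phi> x) - (\<phi> t * F t - (\<Sum>K\<in>D m. (\<phi> (Sup K) - \<phi> (Inf K)) * F (Inf K)))\<bar> \<le> \<eta> * F t"
    by (rule interval_measure_step_error[OF \<phi> div m \<eta>(1)])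
  then have "(LINT x:{0..t}|interval_measure F. \<phi> x) \<le> \<kappa> * (integral {0..t} \<phi> + \<eta> * t) + \<eta> * F t" using 1 by linarith
  also have "\<dots> = \<kappa> * integral {0..t} \<phi> + \<eta> * (F t + \<kappa> * t + 1) - \<eta>" by (simp add: algebra_simps)
  also have "\<dots> \<le> \<kappa> * integral {0..t} \<phi> + e" using \<eta> by simp
  finally show "(LINT x:{0..t}|interval_measure F. \<phi> x) \<le> \<kappa> * integral {0..t} \<phi> + e" .
qed

end

section \<open>The reverse Loewner flow\<close>

text \<open>
  Picard iteration for a globally Lipschitz equation. In terms of \<open>exp (- 2 L s) * k s\<close> the integral
  operator is a contraction with factor \<open>1/2\<close> on the whole interval, however long it is.
\<close>

lemma global_ode_solution:
  fixes F :: "real \<Rightarrow> 'a::banach \<Rightarrow> 'a"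
  assumes t: "0 \<le> t" and L: "0 < L"
    and lip: "\<And>s w w'. s \<in> {0..t} \<Longrightarrow> norm (F s w - F s w') \<le> L * norm (w - w')"
    and cont: "\<And>u. continuous_on {0..t} u \<Longrightarrow> continuous_on {0..t} (\<lambda>s. F s (u s))"
  obtains k where "k 0 = z" "\<And>s. s \<in> {0..t} \<Longrightarrow> (k has_vector_derivative F s (k s)) (at s within {0..t})"
proof -
  \<comment> \<open>twice the Lipschitz constant, which gives the contraction factor \<open>1/2\<close>\<close>
  define \<mu> where "\<mu> = 2 * L"
  \<comment> \<open>clamping to \<open>[0, t]\<close> turns functions on the interval into bounded continuous functions on the line\<close>
  define cl where "cl s = max 0 (min s t)" for s :: real
  define w where "w u r = exp (\<mu> * r) *\<^sub>R u r" for u :: "real \<Rightarrow> 'a" and r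
  define Pf where "Pf u s = exp (- \<mu> * s) *\<^sub>R (z + integral {0..s} (\<lambda>r. F r (w u r)))" for u s
  have cl: "cl s \<in> {0..t}" for s using t by (auto simp: cl_def)
  have clid: "cl s = s" if "s \<in> {0..t}" for s using that by (auto simp: cl_def)
  have contF: "continuous_on {0..t} (\<lambda>r. F r (w u r))" if "continuous_on {0..t} u" for u
    using that unfolding w_def by (intro cont continuous_intros)
  have contP: "continuous_on {0..t} (Pf u)" if "continuous_on {0..t} u" for u
    unfolding Pf_def
    by (intro continuous_intros indefinite_integral_continuous_1 integrable_continuous_real contF that)
  have bc: "(\<lambda>s. Pf u (cl s)) \<in> bcontfun" if u: "continuous_on {0..t} u" for u
  proof -
    have "continuous_on UNIV (\<lambda>s. Pf u (cl s))"
    proof (rule continuous_on_compose2[OF contP[OF u]])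
      show "continuous_on UNIV cl" unfolding cl_def by (intro continuous_intros)
    qed (use cl in auto)
    moreover have "bounded (range (\<lambda>s. Pf u (cl s)))"
      by (rule bounded_subset[OF compact_imp_bounded[OF compact_continuous_image[OF contP[OF u] compact_Icc]]])
         (use cl in auto)
    ultimately show ?thesis by (simp add: bcontfun_def)
  qed
  define P where "P u = Bcontfun (\<lambda>s. Pf (apply_bcontfun u) (cl s))" for u :: "real \<Rightarrow>\<^sub>C 'a"
  have cu: "continuous_on S (apply_bcontfun u)" for S and u :: "real \<Rightarrow>\<^sub>C 'a" by simp
  let ?f = "apply_bcontfun :: (real \<Rightarrow>\<^sub>C 'a) \<Rightarrow> _"
  have Papp: "?f (P u) s = Pf (?f u) (cl s)" for u s
    unfolding P_def using bc[OF cu] by (simp add: Bcontfun_inverse)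
  have "\<exists>!u. u \<in> UNIV \<and> P u = u"
  proof (rule Banach_fix[of UNIV "1/2" P])
    show "dist (P u) (P v) \<le> 1/2 * dist u v" for u v
    proof -
      define d where "d = dist u v"
      have d: "norm (?f u r - ?f v r) \<le> d" "0 \<le> d" for r
        unfolding d_def dist_norm[symmetric] by (auto intro: dist_bounded)
      show "dist (P u) (P v) \<le> 1/2 * dist u v"
      proof (rule dist_bound)
        fix s :: real
        define x where "x = cl s"
        have x: "0 \<le> x" "x \<le> t" using cl[of s] by (auto simp: x_def)
        have sub: "{0..x} \<subseteq> {0..t}" using x by auto
        have i1: "(\<lambda>r. F r (w (?f u) r)) integrable_on {0..x}" for u
          by (intro integrable_continuous_real continuous_on_subset[OF contF[OF cu] sub])
        have i2: "((\<lambda>r. L * d * exp (\<mu> * r)) has_integral (d/2 * exp (\<mu> * x) - d/2 * exp (\<mu> * 0))) {0..x}"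
        proof (rule fundamental_theorem_of_calculus[OF x(1)])
          fix r assume "r \<in> {0..x}"
          show "((\<lambda>r. d/2 * exp (\<mu> * r)) has_vector_derivative L * d * exp (\<mu> * r)) (at r within {0..x})"
            unfolding has_real_derivative_iff_has_vector_derivative[symmetric]
            by (auto intro!: derivative_eq_intros simp: \<mu>_def)
        qed
        have "norm (integral {0..x} (\<lambda>r. F r (w (?f u) r) - F r (w (?f v) r))) \<le> integral {0..x} (\<lambda>r. L * d * exp (\<mu> * r))"
        proof (rule integral_norm_bound_integral)
          fix r assume r: "r \<in> {0..x}"
          have "norm (F r (w (?f u) r) - F r (w (?f v) r)) \<le> L * norm (w (?f u) r - w (?f v) r)"
            using r sub by (intro lip) auto
          also have "norm (w (?f u) r - w (?f v) r) = exp (\<mu> * r) * norm (?f u r - ?f v r)"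
            by (simp add: w_def scaleR_diff_right[symmetric])
          also have "L * \<dots> \<le> L * (exp (\<mu> * r) * d)" using d L by (intro mult_left_mono) auto
          finally show "norm (F r (w (?f u) r) - F r (w (?f v) r)) \<le> L * d * exp (\<mu> * r)"
            by (simp add: mult_ac)
        qed (use i1 i2 in \<open>auto intro!: integrable_diff\<close>)
        also have "\<dots> \<le> d/2 * exp (\<mu> * x)" unfolding integral_unique[OF i2] using d(2) by simp
        finally have ib: "norm (integral {0..x} (\<lambda>r. F r (w (?f u) r)) - integral {0..x} (\<lambda>r. F r (w (?f v) r))) \<le> d/2 * exp (\<mu> * x)"
          using i1 by (simp add: integral_diff)
        have "Pf (?f u) x - Pf (?f v) x = exp (- \<mu> * x) *\<^sub>R (integral {0..x} (\<lambda>r. F r (w (?f u) r)) - integral {0..x} (\<lambda>r. F r (w (?f v) r)))"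
          by (simp add: Pf_def scaleR_diff_right[symmetric])
        then have "norm (Pf (?f u) x - Pf (?f v) x) \<le> exp (- \<mu> * x) * (d/2 * exp (\<mu> * x))"
          using ib by (simp add: mult_left_mono)
        also have "\<dots> = d / 2" by (simp add: exp_minus field_simps)
        finally show "dist (?f (P u) s) (?f (P v) s) \<le> 1/2 * dist u v"
          unfolding Papp x_def[symmetric] d_def[symmetric] by (simp add: dist_norm)
      qed
    qed
  qed (auto simp: complete_UNIV)
  then obtain u where u: "P u = u" by auto
  define k where "k s = exp (\<mu> * s) *\<^sub>R ?f u s" for s
  have keq: "k s = z + integral {0..s} (\<lambda>r. F r (k r))" if "s \<in> {0..t}" for s
  proof -
    have "?f u s = Pf (?f u) s" using Papp[of u s] u clid[OF that] by simp
    then show ?thesis by (simp add: k_def Pf_def w_def exp_minus)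
  qed
  have contk: "continuous_on {0..t} (\<lambda>r. F r (k r))"
    unfolding k_def by (intro cont continuous_intros cu)
  show thesis
  proof
    show "k 0 = z" using keq[of 0] t by simp
    fix s assume s: "s \<in> {0..t}"
    have "((\<lambda>s. z + integral {0..s} (\<lambda>r. F r (k r))) has_vector_derivative F s (k s)) (at s within {0..t})"
      using integral_has_vector_derivative[OF contk s] by (auto intro!: derivative_eq_intros)
    then show "(k has_vector_derivative F s (k s)) (at s within {0..t})"
      by (rule has_vector_derivative_transform[OF s, rotated]) (use keq in auto)
  qed
qed

lemma vector_derivative_imp_continuous_on:
  assumes "\<And>s. s \<in> S \<Longrightarrow> (g has_vector_derivative g' s) (at s within S)"
  shows "continuous_on S g"
  unfolding continuous_on_eq_continuous_within
  using assms has_vector_derivative_continuous by blast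

lemma linear_ode_solution:
  fixes k c :: "real \<Rightarrow> complex"
  assumes c: "continuous_on {0..t} c"
    and k: "\<And>s. s \<in> {0..t} \<Longrightarrow> (k has_vector_derivative c s * k s) (at s within {0..t})"
    and s: "s \<in> {0..t}"
  shows "k s = k 0 * exp (integral {0..s} c)"
proof -
  define C where "C s = integral {0..s} c" for s
  have C: "(C has_vector_derivative c r) (at r within {0..t})" if "r \<in> {0..t}" for r
    unfolding C_def using integral_has_vector_derivative[OF c that] .
  have E: "((\<lambda>r. exp (- C r)) has_vector_derivative - c r * exp (- C r)) (at r within {0..t})" if "r \<in> {0..t}" for r
  proof -
    have "((\<lambda>r. - C r) has_vector_derivative - c r) (at r within {0..t})" using C[OF that] by (auto intro!: derivative_eq_intros)
    from field_vector_diff_chain_within[OF this DERIV_subset[OF DERIV_exp subset_UNIV]]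
    show ?thesis by (simp add: o_def)
  qed
  have "((\<lambda>r. k r * exp (- C r)) has_vector_derivative 0) (at r within {0..t})" if "r \<in> {0..t}" for r
    using has_vector_derivative_mult[OF k[OF that] E[OF that]] by (simp add: algebra_simps)
  then obtain d where d: "\<And>r. r \<in> {0..t} \<Longrightarrow> k r * exp (- C r) = d"
    using has_vector_derivative_zero_constant[of "{0..t}" "\<lambda>r. k r * exp (- C r)"] by (metis convex_real_interval(5))
  have "0 \<in> {0..t}" using s by auto
  from d[OF this] have "d = k 0" by (simp add: C_def)
  then have "k s * exp (- C s) = k 0" using d[OF s] by simp
  then show ?thesis unfolding C_def[symmetric] by (simp add: exp_minus field_simps)
qed

text \<open>
  The flow is driven by \<open>k + \<beta>\<close>, so \<open>k\<close> itself is continuously differentiable while \<open>k + \<beta>\<close> is as rough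
  as \<open>\<beta>\<close>. The reverse flow moves points upwards; recording this in the definition keeps \<open>k + \<beta>\<close> at
  distance at least \<open>Im z\<close> from the singularity.
\<close>

definition reverse_flow :: "(real \<Rightarrow> real) \<Rightarrow> real \<Rightarrow> complex \<Rightarrow> (real \<Rightarrow> complex) \<Rightarrow> bool" where
  "reverse_flow \<beta> t z k \<longleftrightarrow> k 0 = z \<and>
     (\<forall>s\<in>{0..t}. Im z \<le> Im (k s) \<and>
        (k has_vector_derivative - 2 / (k s + of_real (\<beta> s))) (at s within {0..t}))"

text \<open>
  Replacing \<open>Im w\<close> by \<open>max (Im w) y\<close> makes the vector field globally Lipschitz. The solution of the
  modified equation moves upwards, so it never meets the modification.
\<close>

lemma reverse_flow_exists:
  assumes t: "0 \<le> t" and \<beta>: "continuous_on {0..t} \<beta>" and z: "0 < Im z"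
  shows "\<exists>k. reverse_flow \<beta> t z k"
proof -
  define y where "y = Im z"
  define cp where "cp w = Complex (Re w) (max (Im w) y)" for w
  have y: "0 < y" using z by (simp add: y_def)
  have cpn: "y \<le> norm (cp w)" for w
    using abs_Im_le_cmod[of "cp w"] by (simp add: cp_def)
  then have cp0: "cp w \<noteq> 0" for w using y by (metis norm_zero not_le)
  have cplip: "norm (cp w - cp w') \<le> norm (w - w')" for w w'
  proof -
    have "\<bar>max (Im w) y - max (Im w') y\<bar> \<le> \<bar>Im w - Im w'\<bar>" by linarith
    then have "(max (Im w) y - max (Im w') y)\<^sup>2 \<le> (Im w - Im w')\<^sup>2" by (simp add: abs_le_square_iff)
    then show ?thesis by (simp add: cmod_def cp_def)
  qed
  have cpcont: "continuous_on UNIV cp"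
    unfolding cp_def Complex_eq by (intro continuous_intros)
  define F where "F s k = - 2 / cp (k + of_real (\<beta> s))" for s k
  obtain k where k: "k 0 = z" "\<And>s. s \<in> {0..t} \<Longrightarrow> (k has_vector_derivative F s (k s)) (at s within {0..t})"
  proof (rule global_ode_solution[OF t, of "2 / y\<^sup>2" F z])
    show "0 < 2 / y\<^sup>2" using y by simp
    fix s w w'
    let ?p = "cp (w + of_real (\<beta> s))" and ?q = "cp (w' + of_real (\<beta> s))"
    have "F s w - F s w' = 2 * (?p - ?q) / (?p * ?q)" using cp0 by (simp add: F_def field_simps)
    then have "norm (F s w - F s w') = 2 * norm (?p - ?q) / (norm ?p * norm ?q)" by (simp only: norm_mult norm_divide norm_numeral)
    also have "\<dots> \<le> 2 * norm (w - w') / (y * y)"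
      using cplip[of "w + of_real (\<beta> s)" "w' + of_real (\<beta> s)"] cpn y by (intro frac_le mult_mono) auto
    finally show "norm (F s w - F s w') \<le> 2 / y\<^sup>2 * norm (w - w')" by (simp add: power2_eq_square)
  next
    fix u :: "real \<Rightarrow> complex" assume u: "continuous_on {0..t} u"
    have "continuous_on {0..t} (\<lambda>s. cp (u s + of_real (\<beta> s)))"
      by (rule continuous_on_compose2[OF cpcont]) (auto intro!: continuous_intros u \<beta>)
    then show "continuous_on {0..t} (\<lambda>s. F s (u s))" unfolding F_def using cp0 by (intro continuous_intros) auto
  qed metis
  have Im: "y \<le> Im (k s)" if s: "s \<in> {0..t}" for s
  proof -
    have "((\<lambda>r. F r (k r)) has_integral k s - k 0) {0..s}"
    proof (rule fundamental_theorem_of_calculus)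
      show "(k has_vector_derivative F r (k r)) (at r within {0..s})" if "r \<in> {0..s}" for r
        using k(2)[of r] that s by (auto intro: has_vector_derivative_within_subset)
    qed (use s in auto)
    from has_integral_linear[OF this bounded_linear_Im]
    have "((\<lambda>r. Im (F r (k r))) has_integral Im (k s - k 0)) {0..s}" by (simp add: o_def)
    moreover have "0 \<le> Im (F r (k r))" for r
      using y by (simp add: F_def cp_def Im_divide)
    ultimately have "0 \<le> Im (k s - k 0)" by (rule has_integral_nonneg)
    then show ?thesis using k(1) by (simp add: y_def)
  qed
  have "F s (k s) = - 2 / (k s + of_real (\<beta> s))" if "s \<in> {0..t}" for s
  proof -
    have "cp (k s + of_real (\<beta> s)) = k s + of_real (\<beta> s)"
      using Im[OF that] by (simp add: cp_def complex_eq_iff)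
    then show ?thesis by (simp add: F_def)
  qed
  then show ?thesis unfolding reverse_flow_def using k Im by (metis y_def)
qed

text \<open>
  The difference of two solutions of \<open>g' = a / (g + V)\<close> solves the linear equation with coefficient
  \<open>- a / ((g + V) (g' + V))\<close>. This covers the forward equation (\<open>a = 2\<close>, \<open>V = - U\<close>) and the reverse one
  (\<open>a = - 2\<close>, \<open>V = \<beta>\<close>), and it yields uniqueness, injectivity and the derivative in the initial
  value alike.
\<close>

lemma solution_difference:
  fixes g g' :: "real \<Rightarrow> complex"
  assumes V: "continuous_on {0..t} V"
    and g: "\<And>s. s \<in> {0..t} \<Longrightarrow> g s + V s \<noteq> 0 \<and> (g has_vector_derivative a / (g s + V s)) (at s within {0..t})"
    and g': "\<And>s. s \<in> {0..t} \<Longrightarrow> g' s + V s \<noteq> 0 \<and> (g' has_vector_derivative a / (g' s + V s)) (at s within {0..t})"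
    and s: "s \<in> {0..t}"
  shows "g s - g' s = (g 0 - g' 0) * exp (integral {0..s} (\<lambda>r. - a / ((g r + V r) * (g' r + V r))))"
proof (rule linear_ode_solution[where k="\<lambda>s. g s - g' s", OF _ _ s])
  have "continuous_on {0..t} g" "continuous_on {0..t} g'"
    using vector_derivative_imp_continuous_on[of "{0..t}" g "\<lambda>s. a / (g s + V s)"] g
      vector_derivative_imp_continuous_on[of "{0..t}" g' "\<lambda>s. a / (g' s + V s)"] g' by blast+
  then show "continuous_on {0..t} (\<lambda>r. - a / ((g r + V r) * (g' r + V r)))"
    using V g g' by (intro continuous_intros) auto
next
  fix r assume r: "r \<in> {0..t}"
  have "((\<lambda>s. g s - g' s) has_vector_derivative a / (g r + V r) - a / (g' r + V r)) (at r within {0..t})"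
    using g[OF r] g'[OF r] by (intro has_vector_derivative_diff) auto
  moreover have "a / (g r + V r) - a / (g' r + V r) = - a / ((g r + V r) * (g' r + V r)) * (g r - g' r)"
  proof -
    have "- a / (p * q) * (p - q) = a / p - a / q" if "p \<noteq> 0" "q \<noteq> 0" for p q :: complex
    proof -
      have "- a / (p * q) * (p - q) = (a * q - a * p) / (p * q)" by (simp add: algebra_simps diff_divide_distrib)
      also have "\<dots> = a / p - a / q" using that by (simp add: diff_divide_distrib)
      finally show ?thesis .
    qed
    from this[of "g r + V r" "g' r + V r"] show ?thesis using g[OF r] g'[OF r] by simp
  qed
  ultimately show "((\<lambda>s. g s - g' s) has_vector_derivative - a / ((g r + V r) * (g' r + V r)) * (g r - g' r)) (at r within {0..t})"
    by simp
qed

lemma reverse_flow_nonzero: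
  assumes "reverse_flow \<beta> t z k" "0 < Im z" "s \<in> {0..t}"
  shows "Im z \<le> norm (k s + of_real (\<beta> s))" "k s + of_real (\<beta> s) \<noteq> 0"
proof -
  have "Im z \<le> Im (k s + of_real (\<beta> s))" using assms by (simp add: reverse_flow_def)
  also have "\<dots> \<le> norm (k s + of_real (\<beta> s))" using abs_Im_le_cmod[of "k s + of_real (\<beta> s)"] by linarith
  finally show "Im z \<le> norm (k s + of_real (\<beta> s))" .
  then show "k s + of_real (\<beta> s) \<noteq> 0" using assms(2) by (metis norm_zero not_le)
qed

lemma reverse_flow_continuous:
  assumes "reverse_flow \<beta> t z k"
  shows "continuous_on {0..t} k"
  using assms vector_derivative_imp_continuous_on[of "{0..t}" k "\<lambda>s. - 2 / (k s + of_real (\<beta> s))"]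
  unfolding reverse_flow_def by blast

text \<open>
  The reverse flow run backwards is a forward solution ending at \<open>w\<close>.
\<close>

lemma loewner_f_eq_reverse_flow:
  assumes t: "0 \<le> t" and U: "continuous_on {0..t} U" and w: "0 < Im w"
    and k: "reverse_flow (reverse_path t U) t (w - of_real (U t)) k"
  shows "loewner_f U t w = k t + of_real (U t)"
proof -
  have V: "continuous_on {0..t} (\<lambda>s. - complex_of_real (U s))" using U by (intro continuous_intros)
  have diff: "g s - g' s = (g 0 - g' 0) * exp (integral {0..s} (\<lambda>r. - 2 / ((g r + - of_real (U r)) * (g' r + - of_real (U r)))))"
    if "loewner_solution U t z g" "loewner_solution U t z' g'" "s \<in> {0..t}" for g g' z z' s
    by (rule solution_difference[OF V _ _ that(3)]) (use that in \<open>auto simp: loewner_solution_def\<close>)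
  have tt: "t \<in> {0..t}" using t by simp
  have gval: "loewner_g U t z = g t" if "loewner_solution U t z g" for z g
    unfolding loewner_g_def
  proof (rule the_equality)
    fix v assume "\<exists>g. loewner_solution U t z g \<and> v = g t"
    then obtain g' where g': "loewner_solution U t z g'" "v = g' t" by blast
    have "g' 0 - g 0 = 0" using that g' by (simp add: loewner_solution_def)
    then show "v = g t" using diff[OF g'(1) that tt] g'(2) by simp
  qed (use that in blast)
  have inj: "inj_on (loewner_g U t) (loewner_domain U t)"
  proof (rule inj_onI)
    fix z z' assume z: "z \<in> loewner_domain U t" "z' \<in> loewner_domain U t" "loewner_g U t z = loewner_g U t z'"
    then obtain g g' where g: "loewner_solution U t z g" "loewner_solution U t z' g'" by (auto simp: loewner_domain_def)
    have "g t - g' t = 0" using gval[OF g(1)] gval[OF g(2)] z(3) by simp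
    then have "g 0 - g' 0 = 0" using diff[OF g tt] by simp
    then show "z = z'" using g by (simp add: loewner_solution_def)
  qed
  have kprop: "k 0 = w - of_real (U t)" "\<And>s. s \<in> {0..t} \<Longrightarrow> Im w \<le> Im (k s)"
    "\<And>s. s \<in> {0..t} \<Longrightarrow> (k has_vector_derivative - 2 / (k s + of_real (reverse_path t U s))) (at s within {0..t})"
    using k by (auto simp: reverse_flow_def)
  define z where "z = k t + of_real (U t)"
  define g where "g s = k (t - s) + of_real (U t)" for s
  have sol: "loewner_solution U t z g"
    unfolding loewner_solution_def
  proof (intro conjI ballI)
    show "g 0 = z" by (simp add: g_def z_def)
    fix s assume s: "s \<in> {0..t}"
    then have ts: "t - s \<in> {0..t}" by auto
    have "Im (g s) > 0" using kprop(2)[OF ts] w by (simp add: g_def)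
    then show "g s \<noteq> of_real (U s)" by (metis Im_complex_of_real less_irrefl)
    have "(k has_vector_derivative - 2 / (k (t - s) + of_real (reverse_path t U (t - s)))) (at (t - s) within (\<lambda>s. t - s) ` {0..t})"
      using kprop(3)[OF ts] by simp
    moreover have "((\<lambda>s. t - s) has_vector_derivative - 1) (at s within {0..t})"
      by (auto intro!: derivative_eq_intros)
    ultimately have "((k \<circ> (\<lambda>s. t - s)) has_vector_derivative (- 1) *\<^sub>R (- 2 / (k (t - s) + of_real (reverse_path t U (t - s))))) (at s within {0..t})"
      by (rule vector_diff_chain_within[rotated])
    then have "((\<lambda>s. k (t - s) + of_real (U t)) has_vector_derivative 2 / (k (t - s) + of_real (reverse_path t U (t - s)))) (at s within {0..t})"
      by (auto simp: o_def intro!: derivative_eq_intros)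
    then show "(g has_vector_derivative 2 / (g s - of_real (U s))) (at s within {0..t})"
      by (simp add: g_def[abs_def] reverse_path_def algebra_simps)
  qed
  have "0 < Im z" using kprop(2)[OF tt] w by (simp add: z_def)
  then have zd: "z \<in> loewner_domain U t" using sol by (auto simp: loewner_domain_def)
  have "loewner_g U t z = w" using gval[OF sol] kprop(1) by (simp add: g_def)
  then have "loewner_f U t w = z" unfolding loewner_f_def using inv_into_f_eq[OF inj zd] by blast
  then show ?thesis by (simp add: z_def)
qed

text \<open>
  By \<open>solution_difference\<close> the difference quotient at \<open>w\<close> is the exponential of
  \<open>I w t = \<integral> 2 / (Z_w Z) dr\<close>, and \<open>Z_w - Z\<close> is at most a constant times \<open>|w - w0|\<close>, so \<open>I w t\<close> tends to
  \<open>\<integral> 2 / Z\<^sup>2 dr\<close>.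
\<close>

lemma deriv_loewner_f:
  assumes t: "0 \<le> t" and U: "continuous_on {0..t} U" and y: "0 < y"
    and k: "reverse_flow (reverse_path t U) t (\<i> * of_real y) k"
  shows "deriv (loewner_f U t) (\<i> * of_real y + of_real (U t))
     = exp (integral {0..t} (\<lambda>s. 2 / (k s + of_real (reverse_path t U s))\<^sup>2))"
proof -
  define \<beta> where "\<beta> = reverse_path t U"
  define w0 where "w0 = \<i> * of_real y + of_real (U t)"
  have \<beta>: "continuous_on {0..t} \<beta>" unfolding \<beta>_def reverse_path_def[abs_def]
    by (intro continuous_intros continuous_on_compose2[OF U]) auto
  have k': "reverse_flow \<beta> t (w0 - of_real (U t)) k" using k by (simp add: \<beta>_def w0_def)
  define kk where "kk w = (SOME k. reverse_flow \<beta> t (w - of_real (U t)) k)" for w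
  have kk: "reverse_flow \<beta> t (w - of_real (U t)) (kk w)" if "0 < Im w" for w
  proof -
    have "\<exists>k. reverse_flow \<beta> t (w - of_real (U t)) k" using reverse_flow_exists[OF t \<beta>] that by simp
    from someI_ex[OF this] show ?thesis unfolding kk_def .
  qed
  have Imw0: "Im w0 = y" by (simp add: w0_def)
  let ?Z = "\<lambda>w s. kk w s + of_real (\<beta> s)" and ?Y = "\<lambda>s. k s + of_real (\<beta> s)"
  have tt: "t \<in> {0..t}" using t by simp
  have nz: "Im w \<le> norm (?Z w s)" "?Z w s \<noteq> 0" if "0 < Im w" "s \<in> {0..t}" for w s
    using reverse_flow_nonzero[OF kk[OF that(1)] _ that(2)] that(1) by auto
  have nz0: "y \<le> norm (?Y s)" "?Y s \<noteq> 0" if "s \<in> {0..t}" for s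
    using reverse_flow_nonzero[OF k' _ that] y by (auto simp: w0_def)
  define I where "I w s = integral {0..s} (\<lambda>r. 2 / (?Z w r * ?Y r))" for w s
  have V: "continuous_on {0..t} (\<lambda>s. complex_of_real (\<beta> s))" using \<beta> by (intro continuous_intros)
  have contk: "continuous_on {0..t} k" using reverse_flow_continuous[OF k'] .
  have contkk: "continuous_on {0..t} (kk w)" if "0 < Im w" for w
    using reverse_flow_continuous[OF kk[OF that]] .
  have diff: "kk w s - k s = (w - w0) * exp (I w s)" if "0 < Im w" "s \<in> {0..t}" for w s
  proof -
    have "kk w s - k s = (kk w 0 - k 0) * exp (integral {0..s} (\<lambda>r. - (- 2) / ((kk w r + of_real (\<beta> r)) * (k r + of_real (\<beta> r)))))"
      by (rule solution_difference[OF V _ _ that(2)])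
         (use kk[OF that(1)] k' nz[OF that(1)] nz0 in \<open>auto simp: reverse_flow_def\<close>)
    moreover have "kk w 0 - k 0 = w - w0" using kk[OF that(1)] k' by (simp add: reverse_flow_def)
    ultimately show ?thesis by (simp add: I_def)
  qed
  have contI: "continuous_on {0..t} (\<lambda>r. 2 / (?Z w r * ?Y r))" if "0 < Im w" for w
    using nz[OF that] nz0 by (intro continuous_intros contk contkk[OF that] V) auto
  have contI0: "continuous_on {0..t} (\<lambda>r. 2 / (?Y r)\<^sup>2)"
    using nz0 by (intro continuous_intros contk V) auto
  have near: "norm (I w s) \<le> 4 * t / y\<^sup>2" if w: "y / 2 < Im w" and s: "s \<in> {0..t}" for w s
  proof -
    have w0: "0 < Im w" using w y by simp
    have "norm (I w s) \<le> 4 / y\<^sup>2 * (s - 0)" unfolding I_def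
    proof (rule integral_bound)
      show "continuous_on {0..s} (\<lambda>r. 2 / (?Z w r * ?Y r))"
        by (rule continuous_on_subset[OF contI[OF w0]]) (use s in auto)
      fix r assume "r \<in> {0..s}"
      then have r: "r \<in> {0..t}" using s by auto
      have "norm (2 / (?Z w r * ?Y r)) = 2 / (norm (?Z w r) * norm (?Y r))" by (simp add: norm_divide norm_mult)
      also have "\<dots> \<le> 2 / (y / 2 * y)"
        using nz(1)[OF w0 r] nz0(1)[OF r] w y by (intro divide_left_mono mult_mono mult_pos_pos) auto
      finally show "norm (2 / (?Z w r * ?Y r)) \<le> 4 / y\<^sup>2" by (simp add: power2_eq_square)
    qed (use s in auto)
    also have "\<dots> \<le> 4 / y\<^sup>2 * t" using s by (intro mult_left_mono) auto
    finally show ?thesis by simp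
  qed
  define I0 where "I0 = integral {0..t} (\<lambda>r. 2 / (?Y r)\<^sup>2)"
  define C where "C = 4 * exp (4 * t / y\<^sup>2) / y ^ 3 * t"
  have Idiff: "norm (I w t - I0) \<le> C * norm (w - w0)" if w: "y / 2 < Im w" for w
  proof -
    have w0: "0 < Im w" using w y by simp
    have "I w t - I0 = integral {0..t} (\<lambda>r. 2 / (?Z w r * ?Y r) - 2 / (?Y r)\<^sup>2)"
      unfolding I_def I0_def by (intro integral_diff[symmetric] integrable_continuous_real contI[OF w0] contI0)
    also have "norm \<dots> \<le> 4 * exp (4 * t / y\<^sup>2) / y ^ 3 * norm (w - w0) * (t - 0)"
    proof (rule integral_bound[OF t])
      show "continuous_on {0..t} (\<lambda>r. 2 / (?Z w r * ?Y r) - 2 / (?Y r)\<^sup>2)"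
        by (intro continuous_on_diff contI[OF w0] contI0)
      fix r assume r: "r \<in> {0..t}"
      have "norm (exp (I w r)) \<le> exp (4 * t / y\<^sup>2)" using norm_exp[of "I w r"] near[OF w r] by (meson exp_le_cancel_iff order_trans)
      then have kd: "norm (kk w r - k r) \<le> norm (w - w0) * exp (4 * t / y\<^sup>2)"
        unfolding diff[OF w0 r] norm_mult by (intro mult_left_mono) auto
      have "2 / (?Z w r * ?Y r) - 2 / (?Y r)\<^sup>2 = - 2 * (kk w r - k r) / (?Z w r * (?Y r)\<^sup>2)"
        using nz(2)[OF w0 r] nz0(2)[OF r] by (simp add: divide_simps power2_eq_square)
      then have "norm (2 / (?Z w r * ?Y r) - 2 / (?Y r)\<^sup>2) = 2 * norm (kk w r - k r) / (norm (?Z w r) * (norm (?Y r))\<^sup>2)"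
        by (simp only: norm_divide norm_mult norm_power norm_minus_cancel norm_numeral)
      also have "\<dots> \<le> 2 * (norm (w - w0) * exp (4 * t / y\<^sup>2)) / (y / 2 * y\<^sup>2)"
        using nz(1)[OF w0 r] nz0(1)[OF r] w y kd by (intro frac_le mult_mono power_mono) auto
      finally show "norm (2 / (?Z w r * ?Y r) - 2 / (?Y r)\<^sup>2) \<le> 4 * exp (4 * t / y\<^sup>2) / y ^ 3 * norm (w - w0)"
        using y by (simp add: field_simps power2_eq_square power3_eq_cube)
    qed
    finally show ?thesis by (simp add: C_def mult_ac)
  qed
  have ev: "\<forall>\<^sub>F w in at w0. y / 2 < Im w"
  proof -
    have "open {w. y / 2 < Im w}" by (rule open_halfspace_Im_gt)
    moreover have "w0 \<in> {w. y / 2 < Im w}" using y Imw0 by simp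
    ultimately show ?thesis by (metis (mono_tags, lifting) eventually_at_topological mem_Collect_eq)
  qed
  have fval: "loewner_f U t w = kk w t + of_real (U t)" if "0 < Im w" for w
    using loewner_f_eq_reverse_flow[OF t U that] kk[OF that] by (simp add: \<beta>_def)
  have fval0: "loewner_f U t w0 = k t + of_real (U t)"
    using loewner_f_eq_reverse_flow[OF t U] k' Imw0 y by (simp add: \<beta>_def)
  have "((\<lambda>w. I w t - I0) \<longlongrightarrow> 0) (at w0)"
  proof (rule Lim_null_comparison)
    show "\<forall>\<^sub>F w in at w0. norm (I w t - I0) \<le> C * norm (w - w0)" using ev by eventually_elim (rule Idiff)
    have "((\<lambda>w. C * norm (w - w0)) \<longlongrightarrow> C * norm (w0 - w0)) (at w0)" by (intro tendsto_intros)
    then show "((\<lambda>w. C * norm (w - w0)) \<longlongrightarrow> 0) (at w0)" by simp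
  qed
  then have "((\<lambda>w. I w t) \<longlongrightarrow> I0) (at w0)" by (simp add: LIM_zero_iff)
  then have "((\<lambda>w. exp (I w t)) \<longlongrightarrow> exp I0) (at w0)" by (intro tendsto_intros)
  moreover have "\<forall>\<^sub>F w in at w0. exp (I w t) = (loewner_f U t w - loewner_f U t w0) / (w - w0)"
    using ev eventually_neq_at_within[of w0]
  proof eventually_elim
    case (elim w)
    have w0: "0 < Im w" using elim y by simp
    show ?case using elim diff[OF w0 tt] fval[OF w0] fval0 by (simp add: field_simps)
  qed
  ultimately have "((\<lambda>w. (loewner_f U t w - loewner_f U t w0) / (w - w0)) \<longlongrightarrow> exp I0) (at w0)"
    by (rule Lim_transform_eventually)
  then have "(loewner_f U t has_field_derivative exp I0) (at w0)" by (simp add: has_field_derivative_iff)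
  then show ?thesis unfolding w0_def I0_def \<beta>_def by (rule DERIV_imp_deriv)
qed

text \<open>
  The growth of the imaginary part is what pays for all the error terms in the final estimate.
\<close>

lemma reverse_flow_log_Im:
  assumes t: "0 \<le> t" and k: "reverse_flow \<beta> t z k" and z: "0 < Im z" and \<beta>: "continuous_on {0..t} \<beta>"
  shows "ln (Im (k t)) = ln (Im z) + 2 * integral {0..t} (\<lambda>r. 1 / (norm (k r + of_real (\<beta> r)))\<^sup>2)"
proof -
  have "((\<lambda>r. 2 * (1 / (norm (k r + of_real (\<beta> r)))\<^sup>2)) has_integral ln (Im (k t)) - ln (Im (k 0))) {0..t}"
  proof (rule fundamental_theorem_of_calculus[OF t])
    fix r assume r: "r \<in> {0..t}"
    let ?Z = "k r + of_real (\<beta> r)"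
    have Im: "0 < Im (k r)" using k r z unfolding reverse_flow_def by fastforce
    have "(k has_vector_derivative - 2 / ?Z) (at r within {0..t})" using k r unfolding reverse_flow_def by blast
    from bounded_linear.has_vector_derivative[OF bounded_linear_Im this]
    have "((\<lambda>r. Im (k r)) has_real_derivative Im (- 2 / ?Z)) (at r within {0..t})"
      by (simp add: has_real_derivative_iff_has_vector_derivative)
    then have "((\<lambda>r. ln (Im (k r))) has_real_derivative 1 / Im (k r) * Im (- 2 / ?Z)) (at r within {0..t})"
      by (rule DERIV_chain2[where f=ln and g="\<lambda>r. Im (k r)" and x=r, OF DERIV_ln_divide[OF Im]])
    moreover have "Im (- 2 / ?Z) = 2 * Im (k r) / (norm ?Z)\<^sup>2"
      by (simp add: Im_divide cmod_power2)
    then have "1 / Im (k r) * Im (- 2 / ?Z) = 2 * (1 / (norm ?Z)\<^sup>2)" using Im by simp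
    ultimately show "((\<lambda>r. ln (Im (k r))) has_vector_derivative 2 * (1 / (norm ?Z)\<^sup>2)) (at r within {0..t})"
      by (simp add: has_real_derivative_iff_has_vector_derivative)
  qed
  then have "integral {0..t} (\<lambda>r. 2 * (1 / (norm (k r + of_real (\<beta> r)))\<^sup>2)) = ln (Im (k t)) - ln (Im z)"
    using k by (simp add: integral_unique reverse_flow_def)
  then show ?thesis by (simp only: integral_mult_right)
qed

section \<open>Follmer's Ito formula along the reverse flow\<close>

text \<open>
  \<open>Ln (1 + z) - z + z\<^sup>2 / 2\<close> vanishes at \<open>0\<close> and has derivative \<open>z\<^sup>2 / (1 + z)\<close>.
\<close>

lemma ln_norm_taylor:
  fixes x :: complex
  assumes x: "norm x \<le> 1/2"
  shows "\<bar>ln (norm (1 + x)) - Re x + Re (x\<^sup>2) / 2\<bar> \<le> 2 * norm x ^ 3"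
proof -
  let ?f = "\<lambda>z::complex. Ln (1 + z) - z + z\<^sup>2 / 2"
  have Re: "1/2 \<le> Re (1 + z)" if "z \<in> cball 0 (norm x)" for z :: complex
  proof -
    have "norm z \<le> 1/2" using that x by simp
    then show ?thesis using abs_Re_le_cmod[of z] by simp
  qed
  have ne: "1 + z \<noteq> 0" if "z \<in> cball 0 (norm x)" for z :: complex
  proof
    assume "1 + z = 0"
    then have "Re (1 + z) = 0" by (simp only: zero_complex.simps)
    then show False using Re[OF that] by linarith
  qed
  have "norm (?f x - ?f 0) \<le> 2 * norm x ^ 2 * norm (x - 0)"
  proof (rule field_differentiable_bound[of "cball 0 (norm x)"])
    fix z :: complex assume z: "z \<in> cball 0 (norm x)"
    have z0: "1 + z \<noteq> 0" by (rule ne[OF z])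
    have z1: "1 + z \<notin> \<real>\<^sub>\<le>\<^sub>0" using Re[OF z] by (auto simp: complex_nonpos_Reals_iff)
    have "(?f has_field_derivative (1 / (1 + z) - 1 + z)) (at z within cball 0 (norm x))"
      using z0 z1 by (auto intro!: derivative_eq_intros simp: inverse_eq_divide)
    moreover have "1 / (1 + z) - 1 + z = z\<^sup>2 / (1 + z)" using z0 by (simp add: field_simps power2_eq_square)
    ultimately show "(?f has_field_derivative z\<^sup>2 / (1 + z)) (at z within cball 0 (norm x))" by simp
    have "1/2 \<le> norm (1 + z)" using Re[OF z] complex_Re_le_cmod[of "1 + z"] by linarith
    moreover have "norm z ^ 2 \<le> norm x ^ 2" using z by (intro power_mono) auto
    ultimately have "norm z ^ 2 / norm (1 + z) \<le> norm x ^ 2 / (1/2)" by (intro frac_le) auto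
    then show "norm (z\<^sup>2 / (1 + z)) \<le> 2 * norm x ^ 2" by (simp add: norm_divide norm_power)
  qed auto
  then have "norm (?f x) \<le> 2 * norm x ^ 3" by (simp add: power2_eq_square power3_eq_cube)
  moreover have "Re (?f x) = ln (norm (1 + x)) - Re x + Re (x\<^sup>2) / 2"
  proof -
    have "1 + x \<noteq> 0" using ne[of x] by simp
    then show ?thesis by simp
  qed
  ultimately show ?thesis using abs_Re_le_cmod[of "?f x"] by simp
qed

text \<open>
  Second-order expansion of \<open>log |Z|\<close> over one interval of length \<open>h\<close>, for an increment made of a rough real part
  \<open>db\<close> and a smooth part \<open>dk\<close> of order \<open>h\<close>. The error is a small factor \<open>\<omega>\<close> times \<open>db\<^sup>2 + h\<close>; sums of the
  latter stay bounded, so the errors disappear in the limit.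
\<close>

lemma ito_increment:
  fixes Zu Zv dk :: complex
  assumes y: "0 < y" "y \<le> norm Zu" and \<omega>: "\<omega> \<le> y / 2"
    and eq: "Zv - Zu = of_real db + dk"
    and small: "\<bar>db\<bar> \<le> \<omega>" "norm (Zv - Zu) \<le> \<omega>"
    and dk: "norm dk \<le> 2 / y * h"
  shows "\<bar>ln (norm Zv) - ln (norm Zu) - Re (1 / Zu) * db - Re (dk / Zu) + Re (1 / Zu\<^sup>2) * db\<^sup>2 / 2\<bar>
     \<le> 12 * \<omega> / y ^ 3 * (db\<^sup>2 + h)"
proof -
  have Zu: "Zu \<noteq> 0" using y by auto
  have \<omega>0: "0 \<le> \<omega>" using small by linarith
  have h0: "0 \<le> h" using order_trans[OF norm_ge_zero dk] y by (simp add: zero_le_mult_iff zero_le_divide_iff)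
  define x where "x = (Zv - Zu) / Zu"
  have nx: "norm x \<le> \<omega> / y" unfolding x_def norm_divide using small y \<omega>0 by (intro frac_le) auto
  also have "\<dots> \<le> 1/2" using \<omega> y by (simp add: field_simps)
  finally have nx2: "norm x \<le> 1/2" .
  have Zv: "Zv = Zu * (1 + x)" using Zu by (simp add: x_def field_simps)
  have x0: "1 + x \<noteq> 0"
  proof
    assume "1 + x = 0"
    then have "x = - 1" by (simp add: eq_neg_iff_add_eq_0 add.commute)
    then show False using nx2 by simp
  qed
  have ln: "ln (norm Zv) - ln (norm Zu) = ln (norm (1 + x))"
    using Zu x0 by (simp add: Zv norm_mult ln_mult)
  have dk2: "norm dk \<le> 2 * \<omega>"
  proof -
    have "dk = (Zv - Zu) - of_real db" using eq by simp
    then have "norm dk \<le> norm (Zv - Zu) + norm (of_real db :: complex)" by (metis norm_triangle_ineq4)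
    then show ?thesis using small by simp
  qed
  have dkdk: "norm dk ^ 2 \<le> 2 * h"
  proof -
    have "norm dk ^ 2 \<le> (2 * \<omega>) * (2 / y * h)" unfolding power2_eq_square using dk dk2 \<omega>0 by (intro mult_mono) auto
    also have "\<dots> \<le> y * (2 / y * h)" using \<omega> h0 y by (intro mult_right_mono) auto
    also have "\<dots> = 2 * h" using y by simp
    finally show ?thesis .
  qed
  have E1: "2 * norm x ^ 3 \<le> 4 * \<omega> / y ^ 3 * (db\<^sup>2 + 2 * h)"
  proof -
    have "norm x ^ 2 = norm (of_real db + dk) ^ 2 / norm Zu ^ 2" by (simp add: x_def eq norm_divide power_divide)
    also have "\<dots> \<le> (\<bar>db\<bar> + norm dk)\<^sup>2 / y\<^sup>2"
      using y norm_triangle_ineq[of "of_real db" dk] by (intro frac_le power_mono) auto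
    also have "(\<bar>db\<bar> + norm dk)\<^sup>2 \<le> 2 * db\<^sup>2 + 2 * norm dk ^ 2"
      using sum_squares_bound[of "\<bar>db\<bar>" "norm dk"] by (simp add: power2_sum)
    finally have "norm x ^ 2 \<le> (2 * db\<^sup>2 + 2 * norm dk ^ 2) / y\<^sup>2" using y by (simp add: divide_right_mono)
    also have "\<dots> \<le> (2 * db\<^sup>2 + 4 * h) / y\<^sup>2" using dkdk by (intro divide_right_mono) auto
    finally have "norm x ^ 2 \<le> (2 * db\<^sup>2 + 4 * h) / y\<^sup>2" .
    then have "norm x * norm x ^ 2 \<le> \<omega> / y * ((2 * db\<^sup>2 + 4 * h) / y\<^sup>2)"
      using nx h0 \<omega>0 y by (intro mult_mono) auto
    then have "2 * (norm x * norm x ^ 2) \<le> 2 * (\<omega> / y * ((2 * db\<^sup>2 + 4 * h) / y\<^sup>2))" by (rule mult_left_mono) simp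
    also have "\<dots> = 4 * \<omega> / y ^ 3 * (db\<^sup>2 + 2 * h)" using y by (simp add: power2_eq_square power3_eq_cube field_simps)
    finally show ?thesis by (simp add: power2_eq_square power3_eq_cube)
  qed
  have E2: "\<bar>Re (x\<^sup>2) / 2 - Re (1 / Zu\<^sup>2) * db\<^sup>2 / 2\<bar> \<le> 4 * \<omega> * h / y ^ 3"
  proof -
    have "x\<^sup>2 = of_real (db\<^sup>2) * (1 / Zu\<^sup>2) + (2 * of_real db * dk + dk\<^sup>2) / Zu\<^sup>2"
      by (simp add: x_def eq power2_eq_square add_divide_distrib algebra_simps)
    then have "Re (x\<^sup>2) - Re (1 / Zu\<^sup>2) * db\<^sup>2 = Re ((2 * of_real db * dk + dk\<^sup>2) / Zu\<^sup>2)"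
      by (simp only: Re_complex_of_real plus_complex.simps Re_complex_of_real times_complex.simps Im_complex_of_real) (simp add: mult.commute)
    also have "\<bar>\<dots>\<bar> \<le> norm ((2 * of_real db * dk + dk\<^sup>2) / Zu\<^sup>2)" by (rule abs_Re_le_cmod)
    also have "\<dots> = norm (2 * of_real db * dk + dk\<^sup>2) / norm Zu ^ 2" by (simp add: norm_divide norm_power)
    also have "\<dots> \<le> (2 * \<bar>db\<bar> * norm dk + norm dk ^ 2) / y\<^sup>2"
      using y norm_triangle_ineq[of "2 * of_real db * dk" "dk\<^sup>2"]
      by (intro frac_le power_mono) (auto simp: norm_mult norm_power)
    also have "\<dots> \<le> (4 * \<omega> * (2 / y * h)) / y\<^sup>2"
    proof (intro divide_right_mono)
      have "2 * \<bar>db\<bar> * norm dk \<le> 2 * \<omega> * (2 / y * h)" using small dk \<omega>0 by (intro mult_mono) auto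
      moreover have "norm dk ^ 2 \<le> (2 * \<omega>) * (2 / y * h)" unfolding power2_eq_square using dk dk2 \<omega>0 by (intro mult_mono) auto
      ultimately show "2 * \<bar>db\<bar> * norm dk + norm dk ^ 2 \<le> 4 * \<omega> * (2 / y * h)" by simp
    qed simp
    also have "\<dots> = 2 * (4 * \<omega> * h / y ^ 3)" by (simp add: power2_eq_square power3_eq_cube)
    finally show ?thesis by (simp add: diff_divide_distrib[symmetric])
  qed
  have Rex: "Re x = Re (1 / Zu) * db + Re (dk / Zu)"
  proof -
    have "x = of_real db * (1 / Zu) + dk / Zu" by (simp add: x_def eq add_divide_distrib)
    then have "Re x = Re (of_real db * (1 / Zu)) + Re (dk / Zu)" by (simp only: plus_complex.simps)
    also have "Re (of_real db * (1 / Zu)) = Re (1 / Zu) * db"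
      by (simp only: times_complex.simps Re_complex_of_real Im_complex_of_real) simp
    finally show ?thesis .
  qed
  have "\<bar>ln (norm Zv) - ln (norm Zu) - Re (1 / Zu) * db - Re (dk / Zu) + Re (1 / Zu\<^sup>2) * db\<^sup>2 / 2\<bar>
     \<le> 2 * norm x ^ 3 + 4 * \<omega> * h / y ^ 3"
    using ln_norm_taylor[OF nx2] E2 unfolding ln Rex by linarith
  also have "\<dots> \<le> 4 * \<omega> / y ^ 3 * (db\<^sup>2 + 2 * h) + 4 * \<omega> * h / y ^ 3" using E1 by simp
  also have "\<dots> = 4 * \<omega> / y ^ 3 * (db\<^sup>2 + 3 * h)" by (simp add: algebra_simps add_divide_distrib)
  also have "\<dots> \<le> 4 * \<omega> / y ^ 3 * (3 * (db\<^sup>2 + h))" using \<omega>0 y by (intro mult_left_mono) auto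
  also have "\<dots> = 12 * \<omega> / y ^ 3 * (db\<^sup>2 + h)" by (simp add: algebra_simps add_divide_distrib)
  finally show ?thesis .
qed

text \<open>
  Ito's formula for \<open>log |Z|\<close>, with \<open>w\<close> standing for \<open>\<integral> Re (1 / Z\<^sup>2) d[\<beta>]\<close>. The drift of \<open>k\<close> contributes
  \<open>- \<integral> Re (2 / Z\<^sup>2) dr\<close>; writing this as an increment of \<open>L\<close> lets it telescope exactly.
\<close>

lemma ito_reverse_flow:
  assumes t: "0 \<le> t" and div: "\<And>n. D n division_of {0..t}" and mesh: "vanishing_mesh D"
    and \<beta>: "continuous_on {0..t} \<beta>" and k: "reverse_flow \<beta> t z k" and z: "0 < Im z"
    and s: "s \<in> {0..t}"
    and q: "(\<lambda>n. follmer_qsum (D n) \<beta> s) \<longlonglongrightarrow> q"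
    and w: "(\<lambda>n. \<Sum>K\<in>D n. Re (1 / (k (Inf K) + of_real (\<beta> (Inf K)))\<^sup>2) * (\<beta> (min (Sup K) s) - \<beta> (min (Inf K) s))\<^sup>2) \<longlonglongrightarrow> w"
  shows "(\<lambda>n. follmer_sum (D n) (\<lambda>r. Re (1 / (k r + of_real (\<beta> r)))) \<beta> s)
     \<longlonglongrightarrow> ln (norm (k s + of_real (\<beta> s))) - ln (norm (k 0 + of_real (\<beta> 0)))
          + integral {0..s} (\<lambda>r. Re (2 / (k r + of_real (\<beta> r))\<^sup>2)) + w / 2"
proof -
  define y where "y = Im z"
  define Z where "Z r = k r + of_real (\<beta> r)" for r
  define L where "L x = integral {0..x} (\<lambda>r. Re (2 / (Z r)\<^sup>2))" for x
  define \<Delta> where "\<Delta> f K = f (min (Sup K) s) - f (min (Inf K) s)" for f :: "real \<Rightarrow> real" and K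
  have y: "0 < y" using z by (simp add: y_def)
  have Zy: "y \<le> norm (Z r)" "Z r \<noteq> 0" if "r \<in> {0..t}" for r
    using reverse_flow_nonzero[OF k z that] by (auto simp: Z_def y_def)
  have contk: "continuous_on {0..t} k" by (rule reverse_flow_continuous[OF k])
  have contZ: "continuous_on {0..t} Z" unfolding Z_def by (intro continuous_intros contk \<beta>)
  have contL: "continuous_on {0..t} (\<lambda>r. Re (2 / (Z r)\<^sup>2))" using Zy by (intro continuous_intros contZ) auto
  have contR: "continuous_on {0..t} (\<lambda>r. - 2 / Z r)" using Zy by (intro continuous_intros contZ) auto
  define e where "e K = \<Delta> (\<lambda>r. ln (norm (Z r))) K - Re (1 / Z (Inf K)) * \<Delta> \<beta> K + \<Delta> L K
      + Re (1 / (Z (Inf K))\<^sup>2) * (\<Delta> \<beta> K)\<^sup>2 / 2" for K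
  have incr: "\<bar>e K\<bar> \<le> 14 * \<omega> / y ^ 3 * ((\<Delta> \<beta> K)\<^sup>2 + \<Delta> (\<lambda>r. r) K)"
    if K: "K \<in> D n" and \<omega>: "0 < \<omega>" "\<omega> \<le> y / 2"
      and o1: "\<forall>u\<in>K. \<forall>v\<in>K. dist (\<beta> u) (\<beta> v) < \<omega>" and o2: "\<forall>u\<in>K. \<forall>v\<in>K. dist (Z u) (Z v) < \<omega>" for K n \<omega>
  proof -
    obtain KI: "Inf K \<le> Sup K" "K = {Inf K..Sup K}" "0 \<le> Inf K" "Sup K \<le> t" using division_nonempty_IccE[OF div K] .
    show ?thesis
    proof (cases "Inf K \<le> s")
      case False
      then have "min (Sup K) s = s" "min (Inf K) s = s" using KI by auto
      then show ?thesis by (simp add: e_def \<Delta>_def)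
    next
      case True
      define u v where "u = Inf K" and "v = min (Sup K) s"
      have uv: "u \<le> v" "0 \<le> u" "v \<le> t" using True KI by (auto simp: u_def v_def)
      have mu: "min (Inf K) s = u" "min u s = u" using True by (simp_all add: u_def)
      have sub: "{u..v} \<subseteq> {Inf K..Sup K}" by (auto simp: u_def v_def)
      then have inK: "r \<in> K" if "r \<in> {u..v}" for r using that KI(2) by blast
      have subt: "{u..v} \<subseteq> {0..t}" using uv by auto
      have kuv: "((\<lambda>r. - 2 / Z r) has_integral k v - k u) {u..v}"
      proof (rule fundamental_theorem_of_calculus[OF uv(1)])
        fix r assume "r \<in> {u..v}"
        then show "(k has_vector_derivative - 2 / Z r) (at r within {u..v})"
          using k subt unfolding reverse_flow_def Z_def by (blast intro: has_vector_derivative_within_subset)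
      qed
      have Zin: "norm (Z u - Z r) < \<omega>" if "r \<in> {u..v}" for r
        using o2 inK[OF that] inK[of u] uv by (simp add: dist_norm)
      have ut: "u \<in> {0..t}" using uv by auto
      have bk: "norm (k v - k u) \<le> 2 / y * (v - u)"
      proof -
        have "norm (k v - k u) \<le> 2 / y * measure lborel {u..v}"
        proof (rule has_integral_bound_real[OF _ finite.emptyI kuv])
          show "0 \<le> 2 / y" using y by simp
          fix r assume "r \<in> {u..v} - {}"
          then have "y \<le> norm (Z r)" using Zy subt by blast
          then show "norm (- 2 / Z r) \<le> 2 / y" using y by (simp add: norm_divide frac_le)
        qed
        then show ?thesis using uv by simp
      qed
      have main: "\<bar>ln (norm (Z v)) - ln (norm (Z u)) - Re (1 / Z u) * (\<beta> v - \<beta> u) - Re ((k v - k u) / Z u) + Re (1 / (Z u)\<^sup>2) * (\<beta> v - \<beta> u)\<^sup>2 / 2\<bar>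
         \<le> 12 * \<omega> / y ^ 3 * ((\<beta> v - \<beta> u)\<^sup>2 + (v - u))"
      proof (rule ito_increment[OF y Zy(1)[OF ut] \<omega>(2) _ _ _ bk])
        show "Z v - Z u = of_real (\<beta> v - \<beta> u) + (k v - k u)" by (simp add: Z_def)
        have "u \<in> K" "v \<in> K" using inK uv by auto
        then show "\<bar>\<beta> v - \<beta> u\<bar> \<le> \<omega>" "norm (Z v - Z u) \<le> \<omega>"
          using o1 o2 by (auto simp: dist_real_def dist_norm intro!: less_imp_le)
      qed
      have Luv: "((\<lambda>r. Re (2 / (Z r)\<^sup>2)) has_integral (L v - L u)) {u..v}"
      proof -
        have i: "(\<lambda>r. Re (2 / (Z r)\<^sup>2)) integrable_on {0..v}"
          by (intro integrable_continuous_real continuous_on_subset[OF contL]) (use uv in auto)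
        have "L u + integral {u..v} (\<lambda>r. Re (2 / (Z r)\<^sup>2)) = L v"
          unfolding L_def using uv i by (intro Henstock_Kurzweil_Integration.integral_combine) auto
        moreover have "(\<lambda>r. Re (2 / (Z r)\<^sup>2)) integrable_on {u..v}"
          by (intro integrable_continuous_real continuous_on_subset[OF contL subt])
        ultimately show ?thesis by (metis add_diff_cancel_left' integrable_integral)
      qed
      have "((\<lambda>r. (- 2 / Z r) / Z u) has_integral (k v - k u) / Z u) {u..v}"
        by (rule has_integral_divide[OF kuv])
      from has_integral_linear[OF this bounded_linear_Re]
      have "((\<lambda>r. Re ((- 2 / Z r) / Z u)) has_integral Re ((k v - k u) / Z u)) {u..v}" by (simp add: o_def)
      from has_integral_add[OF this Luv]
      have dd: "((\<lambda>r. Re ((- 2 / Z r) / Z u) + Re (2 / (Z r)\<^sup>2)) has_integral (Re ((k v - k u) / Z u) + (L v - L u))) {u..v}" .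
      have "norm (Re ((k v - k u) / Z u) + (L v - L u)) \<le> 2 * \<omega> / y ^ 3 * measure lborel {u..v}"
      proof (rule has_integral_bound_real[OF _ finite.emptyI dd])
        show "0 \<le> 2 * \<omega> / y ^ 3" using y \<omega> by simp
        fix r assume "r \<in> {u..v} - {}"
        then have r: "r \<in> {u..v}" by simp
        have rt: "r \<in> {0..t}" using r subt by blast
        have "(- 2 / Z r) / Z u + 2 / (Z r)\<^sup>2 = 2 * (Z u - Z r) / ((Z r)\<^sup>2 * Z u)"
          using Zy(2)[OF rt] Zy(2)[OF ut] by (simp add: divide_simps power2_eq_square)
        then have "norm ((- 2 / Z r) / Z u + 2 / (Z r)\<^sup>2) = 2 * norm (Z u - Z r) / (norm (Z r) ^ 2 * norm (Z u))"
          by (simp only: norm_divide norm_mult norm_power norm_numeral)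
        also have "\<dots> \<le> 2 * \<omega> / (y ^ 2 * y)"
          using Zin[OF r] Zy(1)[OF rt] Zy(1)[OF ut] y \<omega> by (intro frac_le mult_mono power_mono) auto
        finally have "norm ((- 2 / Z r) / Z u + 2 / (Z r)\<^sup>2) \<le> 2 * \<omega> / y ^ 3" by (simp add: power2_eq_square power3_eq_cube)
        moreover have "\<bar>Re ((- 2 / Z r) / Z u + 2 / (Z r)\<^sup>2)\<bar> \<le> norm ((- 2 / Z r) / Z u + 2 / (Z r)\<^sup>2)" by (rule abs_Re_le_cmod)
        ultimately show "norm (Re ((- 2 / Z r) / Z u) + Re (2 / (Z r)\<^sup>2)) \<le> 2 * \<omega> / y ^ 3" by simp
      qed
      then have "\<bar>Re ((k v - k u) / Z u) + (L v - L u)\<bar> \<le> 2 * \<omega> / y ^ 3 * (v - u)" using uv by simp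
      also have "\<dots> \<le> 2 * \<omega> / y ^ 3 * ((\<beta> v - \<beta> u)\<^sup>2 + (v - u))" using y \<omega> by (intro mult_left_mono) auto
      finally have dL: "\<bar>Re ((k v - k u) / Z u) + (L v - L u)\<bar> \<le> 2 * \<omega> / y ^ 3 * ((\<beta> v - \<beta> u)\<^sup>2 + (v - u))" .
      have split: "14 * \<omega> / y ^ 3 * X = 12 * \<omega> / y ^ 3 * X + 2 * \<omega> / y ^ 3 * X" for X by (simp add: field_simps)
      have "e K = (ln (norm (Z v)) - ln (norm (Z u)) - Re (1 / Z u) * (\<beta> v - \<beta> u) - Re ((k v - k u) / Z u) + Re (1 / (Z u)\<^sup>2) * (\<beta> v - \<beta> u)\<^sup>2 / 2)
          + (Re ((k v - k u) / Z u) + (L v - L u))"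
        by (simp add: e_def \<Delta>_def mu v_def[symmetric] u_def[symmetric])
      then have "\<bar>e K\<bar> \<le> 14 * \<omega> / y ^ 3 * ((\<beta> v - \<beta> u)\<^sup>2 + (v - u))"
        using main dL unfolding split by linarith
      then show ?thesis by (simp add: \<Delta>_def mu v_def[symmetric])
    qed
  qed
  have tele: "(\<Sum>K\<in>D n. \<Delta> f K) = f s - f 0" for f n
    using division_telescope[OF div t, of "\<lambda>r. f (min r s)"] s by (simp add: \<Delta>_def)
  have qn: "follmer_qsum (D n) \<beta> s = (\<Sum>K\<in>D n. (\<Delta> \<beta> K)\<^sup>2)" for n by (simp add: follmer_qsum_def \<Delta>_def)
  define W where "W n = (\<Sum>K\<in>D n. Re (1 / (Z (Inf K))\<^sup>2) * (\<Delta> \<beta> K)\<^sup>2)" for n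
  have W: "W \<longlonglongrightarrow> w" using w unfolding W_def Z_def \<Delta>_def by simp
  have esum: "follmer_sum (D n) (\<lambda>r. Re (1 / Z r)) \<beta> s = ln (norm (Z s)) - ln (norm (Z 0)) + L s + W n / 2 - sum e (D n)" for n
  proof -
    have "sum e (D n) = (ln (norm (Z s)) - ln (norm (Z 0))) - follmer_sum (D n) (\<lambda>r. Re (1 / Z r)) \<beta> s + (L s - L 0) + W n / 2"
      unfolding e_def sum.distrib sum_subtractf tele W_def
      by (simp add: follmer_sum_def \<Delta>_def sum_divide_distrib)
    then show ?thesis by (simp add: L_def)
  qed
  have q0: "0 \<le> q" using q by (rule LIMSEQ_le_const) (auto simp: qn intro!: sum_nonneg)
  have "(\<lambda>n. sum e (D n)) \<longlonglongrightarrow> 0"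
  proof (rule null_sequenceI)
    fix \<epsilon> :: real assume \<epsilon>: "0 < \<epsilon>"
    define M where "M = 14 / y ^ 3 * (q + 1 + s)"
    have M: "0 < M" using y q0 s by (simp add: M_def add_nonneg_pos)
    define \<omega> where "\<omega> = min (y / 2) (\<epsilon> / (2 * M))"
    have \<omega>: "0 < \<omega>" "\<omega> \<le> y / 2" "\<omega> * M < \<epsilon>"
    proof -
      show "0 < \<omega>" "\<omega> \<le> y / 2" using y \<epsilon> M by (auto simp: \<omega>_def)
      have "\<omega> * M \<le> \<epsilon> / (2 * M) * M" using M by (intro mult_right_mono) (auto simp: \<omega>_def)
      also have "\<dots> < \<epsilon>" using M \<epsilon> by simp
      finally show "\<omega> * M < \<epsilon>" .
    qed
    have "\<forall>\<^sub>F n in sequentially. follmer_qsum (D n) \<beta> s < q + 1" using q by (rule order_tendstoD(2)) simp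
    then show "\<forall>\<^sub>F n in sequentially. \<bar>sum e (D n)\<bar> < \<epsilon>"
      using vanishing_oscillation[OF div mesh \<beta> \<omega>(1)] vanishing_oscillation[OF div mesh contZ \<omega>(1)]
    proof eventually_elim
      case (elim n)
      have "\<bar>sum e (D n)\<bar> \<le> (\<Sum>K\<in>D n. \<bar>e K\<bar>)" by (rule sum_abs)
      also have "\<dots> \<le> (\<Sum>K\<in>D n. 14 * \<omega> / y ^ 3 * ((\<Delta> \<beta> K)\<^sup>2 + \<Delta> (\<lambda>r. r) K))"
        using elim \<omega> by (intro sum_mono incr) auto
      also have "\<dots> = 14 * \<omega> / y ^ 3 * (follmer_qsum (D n) \<beta> s + s)"
        by (simp only: sum_distrib_left[symmetric] sum.distrib qn tele) simp
      also have "\<dots> \<le> 14 * \<omega> / y ^ 3 * (q + 1 + s)" using elim y \<omega> by (intro mult_left_mono) auto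
      also have "\<dots> = \<omega> * M" by (simp add: M_def)
      finally show ?case using \<omega> by linarith
    qed
  qed
  then have "(\<lambda>n. ln (norm (Z s)) - ln (norm (Z 0)) + L s + W n / 2 - sum e (D n)) \<longlonglongrightarrow> ln (norm (Z s)) - ln (norm (Z 0)) + L s + w / 2 - 0"
    using W by (intro tendsto_intros) auto
  then show ?thesis unfolding esum[symmetric] by (simp add: Z_def L_def)
qed

section \<open>The bound on the derivative\<close>

lemma holder_paths_continuous:
  assumes "U \<in> holder_paths \<alpha> T" "0 < \<alpha>"
  shows "continuous_on {0..T} U"
proof -
  obtain C where C: "\<forall>s\<in>{0..T}. \<forall>t\<in>{0..T}. \<bar>U t - U s\<bar> \<le> C * \<bar>t - s\<bar> powr \<alpha>"
    using assms(1) unfolding holder_paths_def by blast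
  show ?thesis unfolding continuous_on_def
  proof
    fix s assume s: "s \<in> {0..T}"
    show "(U \<longlongrightarrow> U s) (at s within {0..T})"
    proof (rule LIM_zero_cancel, rule Lim_null_comparison)
      show "\<forall>\<^sub>F t in at s within {0..T}. norm (U t - U s) \<le> C * \<bar>t - s\<bar> powr \<alpha>"
        using C s by (auto simp: eventually_at_filter)
      have "((\<lambda>t. \<bar>t - s\<bar>) \<longlongrightarrow> \<bar>s - s\<bar>) (at s within {0..T})" by (intro tendsto_intros)
      then have "((\<lambda>t. \<bar>t - s\<bar>) \<longlongrightarrow> 0) (at s within {0..T})" by simp
      then have "((\<lambda>t. \<bar>t - s\<bar> powr \<alpha>) \<longlongrightarrow> 0 powr \<alpha>) (at s within {0..T})"
        by (rule tendsto_powr2) (use assms(2) in \<open>auto intro: tendsto_intros\<close>)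
      then show "((\<lambda>t. C * \<bar>t - s\<bar> powr \<alpha>) \<longlongrightarrow> 0) (at s within {0..T})"
        using tendsto_mult_right_zero by simp blast
    qed
  qed
qed

lemma follmer_qsum_outside:
  assumes "D division_of {0..t}"
  shows "s \<le> 0 \<Longrightarrow> follmer_qsum D X s = 0" "t \<le> s \<Longrightarrow> follmer_qsum D X s = follmer_qsum D X t"
proof -
  have DI: "0 \<le> Inf K \<and> Inf K \<le> Sup K \<and> Sup K \<le> t" if "K \<in> D" for K
    using division_nonempty_IccE[OF assms that] by metis
  show "follmer_qsum D X s = 0" if "s \<le> 0"
    unfolding follmer_qsum_def
  proof (rule sum.neutral, rule ballI)
    fix K assume "K \<in> D"
    then have "min (Sup K) s = s" "min (Inf K) s = s" using DI[of K] that by auto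
    then show "(X (min (Sup K) s) - X (min (Inf K) s))\<^sup>2 = 0" by simp
  qed
  show "follmer_qsum D X s = follmer_qsum D X t" if "t \<le> s"
    unfolding follmer_qsum_def
  proof (rule sum.cong)
    fix K assume "K \<in> D"
    then have "min (Sup K) s = min (Sup K) t" "min (Inf K) s = min (Inf K) t" using DI[of K] that by auto
    then show "(X (min (Sup K) s) - X (min (Inf K) s))\<^sup>2 = (X (min (Sup K) t) - X (min (Inf K) t))\<^sup>2" by simp
  qed simp
qed

text \<open>
  The estimate on the logarithmic scale and divided by \<open>b\<close>, with \<open>p b = 3\<close> and \<open>\<epsilon> = 2 - \<kappa>\<close>.
\<close>

lemma loewner_derivative_moment_bound:
  fixes \<kappa> :: real
  assumes \<kappa>: "\<kappa> < 2" and \<alpha>: "0 < \<alpha>" and part: "partition_sequence T \<pi>"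
    and Uh: "U \<in> holder_paths \<alpha> T" and Uf: "U \<in> follmer_paths T \<pi> \<kappa>"
    and t: "0 < t" "t \<le> T" and A: "A \<in> cameron_martin t" and y: "0 < y"
  defines "N \<equiv> \<lambda>s. reverse_path t U s - A s" and "\<rho> \<equiv> \<lambda>n. reverse_partition t (\<pi> n)"
  shows "\<exists>G. continuous_on {0..t} G \<and> follmer_integrable t \<rho> G N \<and>
     ln (cmod (deriv (loewner_f U t) (\<i> * of_real y + of_real (U t))))
       \<le> follmer_integral t \<rho> G N - 3 / 2 * bracket_integral t \<rho> (\<lambda>r. (G r)\<^sup>2) N
         + 1 / (4 * (2 - \<kappa>)) * (cameron_martin_norm t A)\<^sup>2"
proof -
  let ?C = "1 / (4 * (2 - \<kappa>)) * (cameron_martin_norm t A)\<^sup>2"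
  define \<beta> where "\<beta> = reverse_path t U"
  have t0: "0 \<le> t" and tt: "t \<in> {0..t}" and tT: "t \<in> {0..T}" using t by auto
  have \<pi>: "\<pi> n division_of {0..T}" for n using part by (simp add: partition_sequence_def)
  note mesh\<pi> = partition_sequence_vanishing_mesh[OF part]
  have \<rho>: "\<rho> n division_of {0..t}" for n unfolding \<rho>_def using reverse_partition_division[OF \<pi> t] .
  have mesh: "vanishing_mesh \<rho>" unfolding \<rho>_def using reverse_partition_mesh[OF \<pi> mesh\<pi>] .
  have U: "continuous_on {0..T} U" using holder_paths_continuous[OF Uh \<alpha>] .
  have Ut: "continuous_on {0..t} U" using U by (rule continuous_on_subset) (use t in auto)
  have \<beta>: "continuous_on {0..t} \<beta>" unfolding \<beta>_def reverse_path_def[abs_def]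
    by (intro continuous_intros continuous_on_compose2[OF Ut]) auto
  have \<beta>0: "\<beta> 0 = 0" by (simp add: \<beta>_def reverse_path_def)
  have contA: "continuous_on {0..t} A" using cameron_martin_continuous[OF A t0] .
  define QU where "QU = follmer_bracket \<pi> U"
  have QU: "(\<lambda>n. follmer_qsum (\<pi> n) U s) \<longlonglongrightarrow> QU s" if "s \<in> {0..T}" for s
    using Uf that unfolding follmer_paths_def finite_follmer_qv_def QU_def follmer_bracket_def
    by (auto simp: convergent_LIMSEQ_iff)
  have QUcont: "continuous_on {0..T} QU" using Uf by (simp add: follmer_paths_def finite_follmer_qv_def QU_def)
  have QUlip: "QU v - QU u \<le> \<kappa> * (v - u)" if "0 \<le> u" "u \<le> v" "v \<le> T" for u v
  proof (cases "u = v")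
    case False
    then have "(QU v - QU u) / (v - u) \<le> \<kappa>" using Uf that by (simp add: follmer_paths_def QU_def)
    then show ?thesis using False that by (simp add: pos_divide_le_eq)
  qed simp
  have QUmono: "QU u \<le> QU v" if "0 \<le> u" "u \<le> v" "v \<le> T" for u v
  proof -
    have "(\<lambda>n. follmer_qsum (reverse_partition v (\<pi> n)) (reverse_path v U) (v - u)) \<longlonglongrightarrow> QU v - QU (v - (v - u))"
      by (rule reverse_path_qsum_tendsto[OF \<pi> mesh\<pi> U QU]) (use that in auto)
    then have "0 \<le> QU v - QU (v - (v - u))"
      by (rule LIMSEQ_le_const) (auto simp: follmer_qsum_def intro!: sum_nonneg)
    then show ?thesis by simp
  qed
  have q\<beta>: "(\<lambda>n. follmer_qsum (\<rho> n) \<beta> s) \<longlonglongrightarrow> QU t - QU (t - s)" if "s \<in> {0..t}" for s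
    unfolding \<rho>_def \<beta>_def by (rule reverse_path_qsum_tendsto[OF \<pi> mesh\<pi> U QU tT that])
  have qN: "(\<lambda>n. follmer_qsum (\<rho> n) N s) \<longlonglongrightarrow> QU t - QU (t - s)" if "s \<in> {0..t}" for s
    unfolding N_def \<beta>_def[symmetric]
    by (rule qsum_perturb_bounded_variation[OF \<rho> mesh \<beta> contA cameron_martin_variation(1)[OF A] that q\<beta>[OF that]])
  define F where "F = follmer_bracket \<rho> N"
  \<comment> \<open>the Stieltjes measure lives on the whole line, so the bracket is needed outside \<open>[0, t]\<close> as well\<close>
  define cl where "cl s = max 0 (min s t)" for s :: real
  have cl: "cl s \<in> {0..t}" for s using t by (auto simp: cl_def)
  have Fin: "F s = QU t - QU (t - s)" if "s \<in> {0..t}" for s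
    unfolding F_def follmer_bracket_def by (rule limI[OF qN[OF that]])
  have Feq: "F s = QU t - QU (t - cl s)" for s
  proof -
    have "follmer_qsum (\<rho> n) N s = follmer_qsum (\<rho> n) N (cl s)" for n
      using follmer_qsum_outside[OF \<rho>[of n], of s N] follmer_qsum_outside(1)[OF \<rho>[of n], of 0 N] t
      by (auto simp: cl_def max_def min_def)
    then have "F s = F (cl s)" by (simp add: F_def follmer_bracket_def)
    then show ?thesis using Fin[OF cl] by simp
  qed
  have clid: "cl s = s" if "s \<in> {0..t}" for s using that by (auto simp: cl_def)
  have Fmono: "F u \<le> F v" if "u \<le> v" for u v
    unfolding Feq using that cl[of u] cl[of v] t by (intro diff_left_mono QUmono) (auto simp: cl_def)
  have Fcont: "continuous_on UNIV F"
    unfolding Feq[abs_def]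
  proof (rule continuous_on_diff[OF continuous_on_const continuous_on_compose2[OF QUcont]])
    show "continuous_on UNIV (\<lambda>x. t - cl x)" unfolding cl_def by (intro continuous_intros)
    show "range (\<lambda>x. t - cl x) \<subseteq> {0..T}" using cl t by fastforce
  qed
  have F0: "F 0 = 0" using Fin[of 0] t by simp
  have Flip: "F v - F u \<le> \<kappa> * (v - u)" if "0 \<le> u" "u \<le> v" "v \<le> t" for u v
    using QUlip[of "t - v" "t - u"] Fin[of u] Fin[of v] that t by simp
  have \<kappa>0: "0 \<le> \<kappa>"
  proof -
    have "0 \<le> \<kappa> * t" using Flip[of 0 t] Fmono[of 0 t] t by simp
    then show ?thesis using t by (simp add: zero_le_mult_iff)
  qed
  obtain k where k: "reverse_flow \<beta> t (\<i> * of_real y) k"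
    using reverse_flow_exists[OF t0 \<beta>, of "\<i> * of_real y"] y by auto
  have Imz: "0 < Im (\<i> * of_real y)" using y by simp
  define Z where "Z r = k r + of_real (\<beta> r)" for r
  have contZ: "continuous_on {0..t} Z" unfolding Z_def by (intro continuous_intros reverse_flow_continuous[OF k] \<beta>)
  have Z: "Z r \<noteq> 0" if "r \<in> {0..t}" for r using reverse_flow_nonzero(2)[OF k Imz that] by (simp add: Z_def)
  define G where "G r = Re (1 / Z r)" for r
  define R where "R r = 1 / (norm (Z r))\<^sup>2" for r
  have contG: "continuous_on {0..t} G" unfolding G_def using Z by (intro continuous_intros contZ) auto
  have contR: "continuous_on {0..t} R" unfolding R_def using Z by (intro continuous_intros contZ) auto
  have contZ2: "continuous_on {0..t} (\<lambda>r. Re (1 / (Z r)\<^sup>2))" using Z by (intro continuous_intros contZ) auto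
  have G2R: "(G r)\<^sup>2 \<le> R r" for r
  proof -
    have "\<bar>G r\<bar> \<le> norm (1 / Z r)" unfolding G_def by (rule abs_Re_le_cmod)
    then have "(G r)\<^sup>2 \<le> (norm (1 / Z r))\<^sup>2" by (metis abs_ge_zero power2_abs power_mono)
    then show ?thesis by (simp add: R_def norm_divide power_divide)
  qed
  have ReZ2: "Re (1 / (Z r)\<^sup>2) = 2 * (G r)\<^sup>2 - R r" for r
  proof -
    have "Re (w\<^sup>2) = 2 * (Re w)\<^sup>2 - (norm w)\<^sup>2" for w by (simp add: cmod_power2 Re_power2)
    from this[of "1 / Z r"] show ?thesis by (simp add: G_def R_def norm_divide power_divide)
  qed
  define L where "L s = integral {0..s} (\<lambda>r. Re (2 / (Z r)\<^sup>2))" for s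
  \<comment> \<open>the sums truncated at \<open>s\<close> are full sums for the path stopped at \<open>s\<close>, whose bracket is stopped at \<open>s\<close>\<close>
  define w where "w s = (LINT x:{0..t}|interval_measure (\<lambda>x. F (min x s)). Re (1 / (Z x)\<^sup>2))" for s
  have wlim: "(\<lambda>n. \<Sum>K\<in>\<rho> n. Re (1 / (Z (Inf K))\<^sup>2) * (\<beta> (min (Sup K) s) - \<beta> (min (Inf K) s))\<^sup>2) \<longlonglongrightarrow> w s"
    if s: "s \<in> {0..t}" for s
    unfolding w_def
  proof (rule weighted_square_sums_tendsto[where X="\<lambda>r. \<beta> (min r s)", OF _ _ _ t0 \<rho> mesh _ _ contZ2])
    show "F (min x s) \<le> F (min x' s)" if "x \<le> x'" for x x' using that by (intro Fmono) auto
    show "continuous_on UNIV (\<lambda>x. F (min x s))" by (rule continuous_on_compose2[OF Fcont]) (auto intro!: continuous_intros)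
    show "F (min 0 s) = 0" using F0 s by (simp add: min_def)
    show "continuous_on {0..t} (\<lambda>r. \<beta> (min r s))"
      by (rule continuous_on_compose2[OF \<beta>]) (use s in \<open>auto intro!: continuous_intros\<close>)
    fix c assume c: "c \<in> {0..t}"
    have "follmer_qsum (\<rho> n) (\<lambda>r. \<beta> (min r s)) c = follmer_qsum (\<rho> n) \<beta> (min c s)" for n
      by (simp add: follmer_qsum_def min.assoc)
    moreover have "min c s \<in> {0..t}" using c s by auto
    ultimately show "(\<lambda>n. follmer_qsum (\<rho> n) (\<lambda>r. \<beta> (min r s)) c) \<longlonglongrightarrow> F (min c s)"
      using q\<beta>[of "min c s"] Fin[of "min c s"] by simp
  qed
  define J where "J s = ln (norm (Z s)) - ln (norm (Z 0)) + L s + w s / 2" for s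
  define H where "H s = integral {0..s} (\<lambda>r. G r * deriv A r)" for s
  have sumN: "(\<lambda>n. follmer_sum (\<rho> n) G N s) \<longlonglongrightarrow> J s - H s" if s: "s \<in> {0..t}" for s
  proof -
    have "(\<lambda>n. follmer_sum (\<rho> n) G \<beta> s) \<longlonglongrightarrow> J s"
      using ito_reverse_flow[OF t0 \<rho> mesh \<beta> k Imz s q\<beta>[OF s]] wlim[OF s]
      unfolding J_def L_def G_def Z_def by blast
    moreover have "(\<lambda>n. follmer_sum (\<rho> n) G A s) \<longlonglongrightarrow> H s"
      unfolding H_def by (rule follmer_sum_cameron_martin[OF A t0 contG \<rho> mesh s])
    moreover have "follmer_sum (\<rho> n) G N s = follmer_sum (\<rho> n) G \<beta> s - follmer_sum (\<rho> n) G A s" for n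
      unfolding follmer_sum_def N_def \<beta>_def sum_subtractf[symmetric]
      by (intro sum.cong) (simp_all add: algebra_simps)
    ultimately show ?thesis by (simp add: tendsto_diff)
  qed
  have integrable: "follmer_integrable t \<rho> G N"
    unfolding follmer_integrable_def using sumN convergentI by blast
  have integral: "follmer_integral t \<rho> G N = J t - H t"
    unfolding follmer_integral_def using sumN[OF tt] by (rule limI)
  define B where "B = (LINT x:{0..t}|interval_measure F. (G x)\<^sup>2)"
  define B' where "B' = (LINT x:{0..t}|interval_measure F. R x)"
  define P where "P = integral {0..t} R"
  have contG2: "continuous_on {0..t} (\<lambda>r. (G r)\<^sup>2)" by (intro continuous_intros contG)
  have "F (min x t) = F x" for x by (simp add: Feq cl_def)
  then have "w t = (LINT x:{0..t}|interval_measure F. 2 * (G x)\<^sup>2 - R x)" by (simp add: w_def ReZ2)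
  also have "\<dots> = 2 * B - B'"
    using set_integrable_interval_measure[OF Fmono Fcont F0 t0 contG2] set_integrable_interval_measure[OF Fmono Fcont F0 t0 contR]
    unfolding B_def B'_def set_lebesgue_integral_def by (simp add: right_diff_distrib mult.left_commute[of _ 2])
  finally have wt: "w t = 2 * B - B'" .
  have P0: "integral {0..t} (\<lambda>r. (G r)\<^sup>2) \<le> P" unfolding P_def
    using G2R by (intro integral_le integrable_continuous_real contG2 contR)
  have "B \<le> \<kappa> * integral {0..t} (\<lambda>r. (G r)\<^sup>2)" unfolding B_def
    by (rule interval_measure_integral_le[OF Fmono Fcont F0 t0 \<rho> mesh contG2 _ Flip \<kappa>0]) auto
  also have "\<dots> \<le> \<kappa> * P" using P0 \<kappa>0 by (rule mult_left_mono)
  finally have BP: "B \<le> \<kappa> * P" .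
  have BP': "B' \<le> \<kappa> * P" unfolding B'_def P_def
    by (rule interval_measure_integral_le[OF Fmono Fcont F0 t0 \<rho> mesh contR _ Flip \<kappa>0]) (auto simp: R_def)
  have "H t \<le> (2 - \<kappa>) * integral {0..t} (\<lambda>r. (G r)\<^sup>2) + ?C"
    unfolding H_def by (rule cameron_martin_young[OF A t0 contG]) (use \<kappa> in simp)
  also have "(2 - \<kappa>) * integral {0..t} (\<lambda>r. (G r)\<^sup>2) \<le> (2 - \<kappa>) * P" using P0 \<kappa> by (intro mult_left_mono) auto
  finally have HP: "H t \<le> (2 - \<kappa>) * P + ?C" by simp
  have lnZ: "ln y + 2 * P \<le> ln (norm (Z t))"
  proof -
    have "ln (Im (k t)) = ln y + 2 * P"
      using reverse_flow_log_Im[OF t0 k Imz \<beta>] by (simp add: P_def R_def[abs_def] Z_def)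
    moreover have "Im (\<i> * of_real y) \<le> Im (k t)" using k tt unfolding reverse_flow_def by blast
    then have "0 < Im (k t)" using Imz by (rule less_le_trans[rotated])
    moreover have "Im (k t) \<le> norm (Z t)" using abs_Im_le_cmod[of "Z t"] by (simp add: Z_def)
    ultimately show ?thesis by (metis ln_mono order_less_le_trans)
  qed
  have Z0: "ln (norm (Z 0)) = ln y" using k \<beta>0 y by (simp add: Z_def reverse_flow_def norm_mult)
  have "deriv (loewner_f U t) (\<i> * of_real y + of_real (U t)) = exp (integral {0..t} (\<lambda>s. 2 / (Z s)\<^sup>2))"
    using deriv_loewner_f[OF t0 Ut y] k unfolding \<beta>_def Z_def by blast
  moreover have "Re (integral {0..t} (\<lambda>s. 2 / (Z s)\<^sup>2)) = L t"
  proof -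
    have "(\<lambda>s. 2 / (Z s)\<^sup>2) integrable_on {0..t}" using Z by (intro integrable_continuous_real continuous_intros contZ) auto
    from integral_linear[OF this bounded_linear_Re] show ?thesis by (simp add: L_def o_def)
  qed
  ultimately have der: "ln (cmod (deriv (loewner_f U t) (\<i> * of_real y + of_real (U t)))) = L t" by simp
  have "(2 - \<kappa>) * P = 2 * P - \<kappa> * P" by (simp add: algebra_simps)
  \<comment> \<open>the surplus \<open>2 P\<close> of \<open>log |Z t|\<close> is spent on \<open>B / 2 + B' / 2 \<le> \<kappa> P\<close> and on \<open>(2 - \<kappa>) P\<close> from \<open>H t\<close>\<close>
  then have "L t \<le> follmer_integral t \<rho> G N - 3 / 2 * B + ?C"
    using integral HP lnZ BP BP' wt Z0 unfolding J_def by linarith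
  moreover have "bracket_integral t \<rho> (\<lambda>r. (G r)\<^sup>2) N = B" by (simp add: bracket_integral_def B_def F_def)
  ultimately show ?thesis using contG integrable der by auto
qed

theorem theorem3:
  fixes \<kappa> :: real
  assumes "\<kappa> < 2"
  shows "\<exists>b p \<epsilon> :: real. 2 < b \<and> 1 < p \<and> 0 < \<epsilon> \<and>
    (\<forall>(T::real) (\<alpha>::real) (\<pi> :: nat \<Rightarrow> real set set) (U :: real \<Rightarrow> real).
       0 < T \<longrightarrow> 1/3 < \<alpha> \<longrightarrow> \<alpha> < 1/2 \<longrightarrow> partition_sequence T \<pi> \<longrightarrow>
       U \<in> holder_paths \<alpha> T \<inter> follmer_paths T \<pi> \<kappa> \<longrightarrow>
       (\<forall>t\<in>{0..T}. \<forall>A\<in>cameron_martin t.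
          let N = (\<lambda>s. reverse_path t U s - A s);
              \<rho> = (\<lambda>n. reverse_partition t (\<pi> n))
          in \<forall>y>0. \<exists>G :: real \<Rightarrow> real.
               continuous_on {0..t} G \<and>
               follmer_integrable t \<rho> G N \<and>
               cmod (deriv (loewner_f U t) (\<i> * of_real y + of_real (U t))) powr b
                 \<le> exp (b * follmer_integral t \<rho> G N
                         - p * b\<^sup>2 / 2 * bracket_integral t \<rho> (\<lambda>r. (G r)\<^sup>2) N)
                   * exp (b / (4 * \<epsilon>) * (cameron_martin_norm t A)\<^sup>2)))"
proof (rule exI[of _ "5/2"], rule exI[of _ "6/5"], rule exI[of _ "2 - \<kappa>"], unfold Let_def, intro conjI allI impI ballI)
  show "0 < 2 - \<kappa>" using assms by simp
  fix T \<alpha> :: real and \<pi> :: "nat \<Rightarrow> real set set" and U :: "real \<Rightarrow> real" and t :: real and A :: "real \<Rightarrow> real" and y :: real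
  assume hyps: "0 < T" "1/3 < \<alpha>" "\<alpha> < 1/2" "partition_sequence T \<pi>" "U \<in> holder_paths \<alpha> T \<inter> follmer_paths T \<pi> \<kappa>"
    "t \<in> {0..T}" "A \<in> cameron_martin t" "0 < y"
  let ?N = "\<lambda>s. reverse_path t U s - A s" and ?\<rho> = "\<lambda>n. reverse_partition t (\<pi> n)"
  let ?d = "cmod (deriv (loewner_f U t) (\<i> * of_real y + of_real (U t)))"
  let ?I = "\<lambda>G. follmer_integral t ?\<rho> G ?N" and ?B = "\<lambda>G. bracket_integral t ?\<rho> (\<lambda>r. (G r)\<^sup>2) ?N"
  let ?C = "1 / (4 * (2 - \<kappa>)) * (cameron_martin_norm t A)\<^sup>2"
  have Ut: "continuous_on {0..t} U"
    by (rule continuous_on_subset[OF holder_paths_continuous[of U \<alpha> T]]) (use hyps in auto)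
  have \<beta>: "continuous_on {0..t} (reverse_path t U)" unfolding reverse_path_def[abs_def]
    by (intro continuous_intros continuous_on_compose2[OF Ut]) auto
  obtain k where k: "reverse_flow (reverse_path t U) t (\<i> * of_real y) k"
    using reverse_flow_exists[OF _ \<beta>, of "\<i> * of_real y"] hyps by auto
  have der: "deriv (loewner_f U t) (\<i> * of_real y + of_real (U t)) = exp (integral {0..t} (\<lambda>s. 2 / (k s + of_real (reverse_path t U s))\<^sup>2))"
    by (rule deriv_loewner_f[OF _ Ut _ k]) (use hyps in auto)
  have "\<exists>G. continuous_on {0..t} G \<and> follmer_integrable t ?\<rho> G ?N \<and>
     ln ?d \<le> ?I G - 3 / 2 * ?B G + ?C"
  proof (cases "t = 0")
    case False
    then show ?thesis
      using loewner_derivative_moment_bound[OF assms, of \<alpha> T \<pi> U t A y] hyps by auto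
  next
    case True
    \<comment> \<open>for \<open>t = 0\<close> all sums are empty and the derivative is \<open>1\<close>\<close>
    have "{K \<in> \<pi> n. Inf K < t} = {}" for n
    proof -
      have "\<pi> n division_of {0..T}" using hyps(4) by (simp add: partition_sequence_def)
      then have "0 \<le> Inf K" if "K \<in> \<pi> n" for K using division_nonempty_IccE[OF _ that] by metis
      then show ?thesis using True by fastforce
    qed
    then have "reverse_partition t (\<pi> n) = {}" for n by (simp only: reverse_partition_def image_empty)
    then have sum0: "follmer_sum (reverse_partition t (\<pi> n)) (\<lambda>_. 0) ?N s = 0" for n s by (simp add: follmer_sum_def)
    have "ln ?d = 0" unfolding der using True by simp
    moreover have "0 \<le> ?C" using assms by simp
    moreover have "follmer_integral t ?\<rho> (\<lambda>_. 0) ?N = 0" unfolding follmer_integral_def sum0 by (rule limI) simp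
    moreover have "bracket_integral t ?\<rho> (\<lambda>r. 0\<^sup>2) ?N = 0" by (simp add: bracket_integral_def set_lebesgue_integral_def)
    moreover have "follmer_integrable t ?\<rho> (\<lambda>_. 0) ?N" unfolding follmer_integrable_def sum0 by (simp add: convergent_const)
    ultimately show ?thesis by (intro exI[of _ "\<lambda>_. 0"]) simp
  qed
  then obtain G where G: "continuous_on {0..t} G" "follmer_integrable t ?\<rho> G ?N"
    and le: "ln ?d \<le> ?I G - 3 / 2 * ?B G + ?C" by blast
  have "0 < ?d" unfolding der by simp
  then have "?d powr (5/2) = exp (5/2 * ln ?d)" by (simp add: powr_def)
  also have "\<dots> \<le> exp (5/2 * (?I G - 3 / 2 * ?B G + ?C))" using le by simp
  also have "\<dots> = exp (5/2 * ?I G - 6/5 * (5/2)\<^sup>2 / 2 * ?B G)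
      * exp (5/2 / (4 * (2 - \<kappa>)) * (cameron_martin_norm t A)\<^sup>2)"
    unfolding exp_add[symmetric] by (simp add: power2_eq_square algebra_simps)
  finally show "\<exists>G. continuous_on {0..t} G \<and> follmer_integrable t ?\<rho> G ?N \<and>
      ?d powr (5/2) \<le> exp (5/2 * ?I G - 6/5 * (5/2)\<^sup>2 / 2 * ?B G)
      * exp (5/2 / (4 * (2 - \<kappa>)) * (cameron_martin_norm t A)\<^sup>2)"
    using G by blast
qed auto

end
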